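(* Let $g, c_1, c_2$ be real parameters with $g\neq 0$, and let $A$ be the self-adjoint operator in $\ell_2$ (with standard orthonormal basis $a_0,a_1,a_2,\dots$) given by the infinite Jacobi matrix $$ A=\begin{pmatrix} c_1&g\sqrt{1}&0&0&0&\cdots\\ g\sqrt{1}&1+c_2&g\sqrt{2}&0&0&\cdots\\ 0&g\sqrt{2}&2+c_1&g\sqrt{3}&0&\cdots\\ 0&0&g\sqrt{3}&3+c_2&g\sqrt{4}&\cdots\\ 0&0&0&g\sqrt{4}&4+c_1&\cdots\\ \vdots&\vdots&\vdots&\vdots&\vdots&\ddots \end{pmatrix}, $$ i.e. $A_{n,n}=n+c_1$ for even $n$, $A_{n,n}=n+c_2$ for odd $n$, $A_{n,n+1}=A_{n+1,n}=g\sqrt{n+1}$ ($n=0,1,2,\dots$), and all other entries zero. Then $A$ has discrete spectrum, and its eigenvalues $\lambda_n(A)$, $n=0,1,2,\dots$, satisfy $$ \lambda_n(A)=n-g^2+\frac{c_1+c_2}{2}+O\!\left(\frac{1}{n^{1/16}}\right),\qquad n\to\infty . $$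
   Context: The Jacobi matrix defines a self-adjoint operator with simple spectrum and domain dense in $\ell_2(\mathbb{N})$. The eigenvalues $\lambda_n(A)$ are enumerated in increasing order starting from $n=0$. *)

theory Defs
  imports Complex_Main "HOL-Library.Landau_Symbols"
begin

definition is_l2 :: "(nat \<Rightarrow> complex) \<Rightarrow> bool" where
  "is_l2 x \<longleftrightarrow> summable (\<lambda>n. (cmod (x n))^2)"

definition l2_norm :: "(nat \<Rightarrow> complex) \<Rightarrow> real" where
  "l2_norm x = sqrt (\<Sum>n. (cmod (x n))^2)"

definition jac_diag :: "real \<Rightarrow> real \<Rightarrow> nat \<Rightarrow> real" where
  "jac_diag c1 c2 n = real n + (if even n then c1 else c2)"

definition jac_off :: "real \<Rightarrow> nat \<Rightarrow> real" where
  "jac_off g n = g * sqrt (real (n + 1))"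

definition jac_apply :: "real \<Rightarrow> real \<Rightarrow> real \<Rightarrow> (nat \<Rightarrow> complex) \<Rightarrow> nat \<Rightarrow> complex" where
  "jac_apply g c1 c2 x n =
     (if n = 0 then 0 else complex_of_real (jac_off g (n - 1)) * x (n - 1))
     + complex_of_real (jac_diag c1 c2 n) * x n
     + complex_of_real (jac_off g n) * x (Suc n)"

text \<open>The self-adjoint operator A: maximal domain (the Jacobi matrix is in the
limit point case since the sum of 1/(g sqrt(n+1)) diverges, so the maximal
operator is the unique self-adjoint realisation).\<close>

definition jac_dom :: "real \<Rightarrow> real \<Rightarrow> real \<Rightarrow> (nat \<Rightarrow> complex) set" where
  "jac_dom g c1 c2 = {x. is_l2 x \<and> is_l2 (jac_apply g c1 c2 x)}"

definition jac_resolvent_set :: "real \<Rightarrow> real \<Rightarrow> real \<Rightarrow> complex set" where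
  "jac_resolvent_set g c1 c2 =
     {z. (\<forall>y. is_l2 y \<longrightarrow>
            (\<exists>!x. x \<in> jac_dom g c1 c2 \<and> (\<lambda>n. jac_apply g c1 c2 x n - z * x n) = y))
       \<and> (\<exists>C. \<forall>x \<in> jac_dom g c1 c2.
            l2_norm x \<le> C * l2_norm (\<lambda>n. jac_apply g c1 c2 x n - z * x n))}"

definition jac_spectrum :: "real \<Rightarrow> real \<Rightarrow> real \<Rightarrow> complex set" where
  "jac_spectrum g c1 c2 = UNIV - jac_resolvent_set g c1 c2"

definition jac_eigvec :: "real \<Rightarrow> real \<Rightarrow> real \<Rightarrow> complex \<Rightarrow> (nat \<Rightarrow> complex) \<Rightarrow> bool" where
  "jac_eigvec g c1 c2 z x \<longleftrightarrow>
     x \<in> jac_dom g c1 c2 \<and> x \<noteq> (\<lambda>_. 0) \<and> jac_apply g c1 c2 x = (\<lambda>n. z * x n)"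

end

theory Submission
  imports Defs "HOL-Analysis.Analysis"
begin

text \<open>
  Put \<open>c = (c1 + c2) / 2\<close>, \<open>s = (c1 - c2) / 2\<close> and let \<open>P\<close> be the parity \<open>diag ((-1) ^ k)\<close>. Then
  \<open>A - c + g\<^sup>2 = H + s P\<close>, where \<open>H\<close> is a displaced harmonic oscillator with eigenvalues
  \<open>0, 1, 2, ...\<close> and the Charlier functions as eigenbasis. In this basis \<open>P\<close> becomes a matrix with
  rows of norm \<open>1\<close>, whose entries satisfy a three-term recurrence with slowly varying
  coefficients; so a row of norm \<open>1\<close> is spread out, and its entries near the diagonal at height \<open>n\<close>
  are \<open>O(n powr (-1/8))\<close>. An eigenvector is a fixed point of the square of the Birman-Schwinger
  operator, whose norm at \<open>\<nu>\<close> is of the order \<open>n powr (-1/8) / (\<nu> - n)\<^sup>2\<close>. Hence the large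
  eigenvalues lie within \<open>O(n powr (-1/16))\<close> of the integers, uniformly for bounded \<open>s\<close>.
  For the numbering, let \<open>s\<close> vary continuously to \<open>0\<close>: the eigenvalues are the zeros of a
  function that is continuous in \<open>(\<nu>, s)\<close> and changes sign at each of them, and they cannot
  cross \<open>n + 1/2\<close> for large \<open>n\<close>, so their number below \<open>n + 1/2\<close> stays \<open>n + 1\<close>.
\<close>

section \<open>The space of square summable sequences\<close>

text \<open>The perturbation \<open>s P\<close> is bounded but not small: to first order an
  eigenvalue is only known to lie within \<open>\<bar>s\<bar>\<close> of an integer. Smallness
  appears in second order, because \<open>P\<close> has norm 1 while its entries in the eigenbasis
  are small. The exponent comes from a window of length J of order \<open>n powr (1/4)\<close>, in
  which one step of the recurrence changes the energy of a column by a factor 1 + O(1/J) only; so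
  squared entries are O(1/J), the second-order bound reads \<open>d ^ 4 * J = O(1)\<close> for the
  distance d to n, and d is \<open>O(n powr (-1/16))\<close>. Localization does not tell how many
  eigenvalues sit near an integer. The scalar function used for counting matches the solution of the
  recurrence from the left with the square summable one from the right at a row K. This row can stay
  fixed while the parameters vary, since the diagonal grows like k and the off-diagonal like
  \<open>sqrt k\<close>. Where the two solutions do not match, the same construction gives a bounded
  inverse explicitly, so the spectrum consists of eigenvalues without any appeal to compact
  operators.\<close>

definition sq_summable :: "(nat \<Rightarrow> 'a::real_normed_vector) \<Rightarrow> bool" where
  "sq_summable x \<longleftrightarrow> summable (\<lambda>k. (norm (x k))\<^sup>2)"

lemma sq_summable_prod:
  assumes "sq_summable x" "sq_summable y"
  shows "summable (\<lambda>k. norm (x k) * norm (y k))"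
proof (rule summable_comparison_test)
  show "summable (\<lambda>k. (norm (x k))\<^sup>2 + (norm (y k))\<^sup>2)"
    using assms unfolding sq_summable_def by (rule summable_add)
  have "norm (x k) * norm (y k) \<le> (norm (x k))\<^sup>2 + (norm (y k))\<^sup>2" for k
    using sum_squares_bound[of "norm (x k)" "norm (y k)"]
      mult_nonneg_nonneg[OF norm_ge_zero norm_ge_zero, of "x k" "y k"] by linarith
  then show "\<exists>N. \<forall>k\<ge>N. norm (norm (x k) * norm (y k)) \<le> (norm (x k))\<^sup>2 + (norm (y k))\<^sup>2"
    by simp
qed

lemma sq_summable_add:
  assumes "sq_summable x" "sq_summable y"
  shows "sq_summable (\<lambda>k. x k + y k)"
  unfolding sq_summable_def
proof (rule summable_comparison_test)
  show "summable (\<lambda>k. 2 * (norm (x k))\<^sup>2 + 2 * (norm (y k))\<^sup>2)"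
    using assms unfolding sq_summable_def by (intro summable_add summable_mult)
  have "(norm (x k + y k))\<^sup>2 \<le> 2 * (norm (x k))\<^sup>2 + 2 * (norm (y k))\<^sup>2" for k
  proof -
    have "(norm (x k + y k))\<^sup>2 \<le> (norm (x k) + norm (y k))\<^sup>2"
      by (simp add: norm_triangle_ineq power_mono)
    also have "\<dots> \<le> 2 * (norm (x k))\<^sup>2 + 2 * (norm (y k))\<^sup>2"
      using sum_squares_bound[of "norm (x k)" "norm (y k)"] by (simp add: power2_sum)
    finally show ?thesis .
  qed
  then show "\<exists>N. \<forall>k\<ge>N. norm ((norm (x k + y k))\<^sup>2) \<le> 2 * (norm (x k))\<^sup>2 + 2 * (norm (y k))\<^sup>2"
    by simp
qed

lemma sq_summable_mono:
  assumes "sq_summable x" "\<And>k. norm (y k) \<le> C * norm (x k)"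
  shows "sq_summable y"
  unfolding sq_summable_def
proof (rule summable_comparison_test)
  show "summable (\<lambda>k. C\<^sup>2 * (norm (x k))\<^sup>2)"
    using assms(1) unfolding sq_summable_def by (rule summable_mult)
  have "(norm (y k))\<^sup>2 \<le> C\<^sup>2 * (norm (x k))\<^sup>2" for k
    using power_mono[OF assms(2)[of k] norm_ge_zero, of 2] by (simp add: power_mult_distrib)
  then show "\<exists>N. \<forall>k\<ge>N. norm ((norm (y k))\<^sup>2) \<le> C\<^sup>2 * (norm (x k))\<^sup>2"
    by simp
qed

lemma sq_summable_mult:
  fixes x :: "nat \<Rightarrow> 'a::real_normed_field"
  assumes "sq_summable x"
  shows "sq_summable (\<lambda>k. c * x k)"
  using assms by (rule sq_summable_mono[where C = "norm c"]) (simp add: norm_mult)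

lemma sq_summable_scaleR:
  assumes "sq_summable x"
  shows "sq_summable (\<lambda>k. c *\<^sub>R x k)"
  using assms by (rule sq_summable_mono[where C = "\<bar>c\<bar>"]) simp

lemma sq_summable_uminus:
  assumes "sq_summable x"
  shows "sq_summable (\<lambda>k. - x k)"
  using assms by (rule sq_summable_mono[where C = 1]) simp

lemma sq_summable_diff:
  "sq_summable x \<Longrightarrow> sq_summable y \<Longrightarrow> sq_summable (\<lambda>k. x k - y k)"
  using sq_summable_add[OF _ sq_summable_uminus, of x y] by simp

lemma sq_summable_finite: "finite {k. x k \<noteq> 0} \<Longrightarrow> sq_summable x"
  unfolding sq_summable_def by (rule summable_finite) auto

lemma sq_summable_Suc: "sq_summable (\<lambda>k. x (Suc k)) \<longleftrightarrow> sq_summable x"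
  unfolding sq_summable_def by (rule summable_Suc_iff)

lemma is_l2_iff: "is_l2 x \<longleftrightarrow> sq_summable x"
  by (simp add: is_l2_def sq_summable_def)

text \<open>One type for both scalar fields: complex sequences enter the resolvent set, real ones
  carry the sign and counting arguments.\<close>

typedef (overloaded) ('a::euclidean_space) ell2 = "{x::nat \<Rightarrow> 'a. sq_summable x}"
  morphisms coord Abs_ell2
  by (rule exI[of _ "\<lambda>_. 0"]) (simp add: sq_summable_def)

setup_lifting type_definition_ell2

lemma sq_summable_coord [simp]: "sq_summable (coord x)"
  using coord by auto

lemma coord_Abs [simp]: "sq_summable x \<Longrightarrow> coord (Abs_ell2 x) = x"
  by (simp add: Abs_ell2_inverse)

lemma ell2_eqI: "(\<And>k. coord x k = coord y k) \<Longrightarrow> x = y"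
  by (metis coord_inject ext)

instantiation ell2 :: (euclidean_space) real_inner
begin

lift_definition zero_ell2 :: "'a ell2" is "\<lambda>_. 0"
  by (simp add: sq_summable_def)
lift_definition plus_ell2 :: "'a ell2 \<Rightarrow> 'a ell2 \<Rightarrow> 'a ell2" is "\<lambda>x y k. x k + y k"
  by (rule sq_summable_add)
lift_definition minus_ell2 :: "'a ell2 \<Rightarrow> 'a ell2 \<Rightarrow> 'a ell2" is "\<lambda>x y k. x k - y k"
  by (rule sq_summable_diff)
lift_definition uminus_ell2 :: "'a ell2 \<Rightarrow> 'a ell2" is "\<lambda>x k. - x k"
  by (rule sq_summable_uminus)
lift_definition scaleR_ell2 :: "real \<Rightarrow> 'a ell2 \<Rightarrow> 'a ell2" is "\<lambda>c x k. c *\<^sub>R x k"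
  by (rule sq_summable_scaleR)
definition inner_ell2 :: "'a ell2 \<Rightarrow> 'a ell2 \<Rightarrow> real" where
  "inner_ell2 x y = (\<Sum>k. coord x k \<bullet> coord y k)"
definition norm_ell2 :: "'a ell2 \<Rightarrow> real" where
  "norm_ell2 x = sqrt (x \<bullet> x)"
definition dist_ell2 :: "'a ell2 \<Rightarrow> 'a ell2 \<Rightarrow> real" where
  "dist_ell2 x y = norm (x - y)"
definition sgn_ell2 :: "'a ell2 \<Rightarrow> 'a ell2" where
  "sgn_ell2 x = scaleR (inverse (norm x)) x"
definition uniformity_ell2 :: "('a ell2 \<times> 'a ell2) filter" where
  "uniformity_ell2 = (INF e\<in>{0<..}. principal {(x, y). dist x y < e})"
definition open_ell2 :: "'a ell2 set \<Rightarrow> bool" where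
  "open_ell2 U \<longleftrightarrow> (\<forall>x\<in>U. eventually (\<lambda>(x', y). x' = x \<longrightarrow> y \<in> U) uniformity)"

lemma ell2_inner_summable: "summable (\<lambda>k. coord x k \<bullet> coord y k)" for x y :: "'a ell2"
  by (rule summable_norm_cancel,
      rule summable_comparison_test[OF _ sq_summable_prod[of "coord x" "coord y"]])
     (auto simp: Cauchy_Schwarz_ineq2)

instance
proof
  fix x y z :: "'a ell2" and r s :: real
  show "x + y + z = x + (y + z)" by transfer (simp add: add.assoc)
  show "x + y = y + x" by transfer (simp add: add.commute)
  show "0 + x = x" by transfer simp
  show "- x + x = 0" by transfer simp
  show "x - y = x + - y" by transfer simp
  show "r *\<^sub>R (x + y) = r *\<^sub>R x + r *\<^sub>R y" by transfer (simp add: algebra_simps)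
  show "(r + s) *\<^sub>R x = r *\<^sub>R x + s *\<^sub>R x" by transfer (simp add: algebra_simps)
  show "r *\<^sub>R s *\<^sub>R x = (r * s) *\<^sub>R x" by transfer simp
  show "1 *\<^sub>R x = x" by transfer simp
  show "dist x y = norm (x - y)" by (rule dist_ell2_def)
  show "sgn x = inverse (norm x) *\<^sub>R x" by (rule sgn_ell2_def)
  show "uniformity = (INF e\<in>{0<..}. principal {(x::'a ell2, y). dist x y < e})"
    by (rule uniformity_ell2_def)
  show "open U \<longleftrightarrow> (\<forall>x\<in>U. eventually (\<lambda>(x', y). x' = x \<longrightarrow> y \<in> U) uniformity)"
    for U :: "'a ell2 set"
    by (rule open_ell2_def)
  show "x \<bullet> y = y \<bullet> x" by (simp add: inner_ell2_def inner_commute)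
  show "(x + y) \<bullet> z = x \<bullet> z + y \<bullet> z"
    unfolding inner_ell2_def
    by (simp add: plus_ell2.rep_eq inner_add_left suminf_add ell2_inner_summable)
  show "(r *\<^sub>R x) \<bullet> y = r * (x \<bullet> y)"
    unfolding inner_ell2_def
    by (simp add: scaleR_ell2.rep_eq suminf_mult ell2_inner_summable)
  show "0 \<le> x \<bullet> x"
    unfolding inner_ell2_def by (intro suminf_nonneg ell2_inner_summable) simp
  show "x \<bullet> x = 0 \<longleftrightarrow> x = 0"
    unfolding inner_ell2_def
    by (subst suminf_eq_zero_iff[OF ell2_inner_summable])
       (auto intro!: ell2_eqI simp: zero_ell2.rep_eq)
  show "norm x = sqrt (x \<bullet> x)" by (rule norm_ell2_def)
qed

end

lemmas coord_simps [simp] =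
  zero_ell2.rep_eq plus_ell2.rep_eq minus_ell2.rep_eq uminus_ell2.rep_eq scaleR_ell2.rep_eq

lemma ell2_norm_sq: "(norm x)\<^sup>2 = (\<Sum>k. (norm (coord x k))\<^sup>2)" for x :: "'a::euclidean_space ell2"
  unfolding power2_norm_eq_inner inner_ell2_def ..

lemma ell2_norm_sums: "(\<lambda>k. (norm (coord x k))\<^sup>2) sums (norm x)\<^sup>2" for x :: "'a::euclidean_space ell2"
  unfolding ell2_norm_sq using sq_summable_coord[of x, unfolded sq_summable_def]
  by (rule summable_sums)

lemma sum_coord_le_norm: "finite I \<Longrightarrow> (\<Sum>k\<in>I. (norm (coord x k))\<^sup>2) \<le> (norm x)\<^sup>2"
  for x :: "'a::euclidean_space ell2"
  unfolding ell2_norm_sq using sq_summable_coord[of x, unfolded sq_summable_def]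
  by (rule sum_le_suminf) auto

lemma norm_coord_le: "norm (coord x k) \<le> norm x" for x :: "'a::euclidean_space ell2"
proof -
  have "(norm (coord x k))\<^sup>2 \<le> (norm x)\<^sup>2"
    using sum_coord_le_norm[of "{k}" x] by simp
  then show ?thesis by (rule power2_le_imp_le) simp
qed

lemma norm_ell2_le:
  fixes x :: "'a::euclidean_space ell2"
  assumes "\<And>n. (\<Sum>k<n. (norm (coord x k))\<^sup>2) \<le> C\<^sup>2" "0 \<le> C"
  shows "norm x \<le> C"
proof -
  have "(norm x)\<^sup>2 \<le> C\<^sup>2"
    unfolding ell2_norm_sq
    using sq_summable_coord[of x, unfolded sq_summable_def] assms(1) by (rule suminf_le_const)
  then show ?thesis using assms(2) by (rule power2_le_imp_le)
qed

lemma coord_sum: "coord (\<Sum>i\<in>I. f i) k = (\<Sum>i\<in>I. coord (f i) k)"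
  by (induction I rule: infinite_finite_induct) simp_all

lemma bounded_linear_coord: "bounded_linear (\<lambda>x. coord x k)"
  by (rule bounded_linear_intro[of _ 1]) (simp_all add: norm_coord_le)

lemma norm_Abs_ell2:
  "sq_summable x \<Longrightarrow> (norm (Abs_ell2 x))\<^sup>2 = (\<Sum>k. (norm (x k))\<^sup>2)"
  by (simp add: ell2_norm_sq)

text \<open>Completeness is what the contraction argument in \<open>tail_fixpoint\<close> rests on.
  The limit is taken coordinatewise, and the Cauchy bound passes to it through finite partial
  sums.\<close>

instance ell2 :: (euclidean_space) banach
proof
  fix X :: "nat \<Rightarrow> 'a ell2"
  assume X: "Cauchy X"
  have "Cauchy (\<lambda>n. coord (X n) k)" for k
    using bounded_linear.Cauchy[OF bounded_linear_coord X] .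
  then have "\<exists>l. (\<lambda>n. coord (X n) k) \<longlonglongrightarrow> l" for k
    using Cauchy_convergent convergent_def by blast
  then obtain l where l: "\<And>k. (\<lambda>n. coord (X n) k) \<longlonglongrightarrow> l k"
    by metis
  have bnd: "(\<Sum>k<K. (norm (l k - coord (X n) k))\<^sup>2) \<le> e\<^sup>2"
    if "\<forall>m\<ge>M. \<forall>n\<ge>M. norm (X m - X n) < e" "n \<ge> M" for e M K n
  proof (rule tendsto_upperbound)
    show "(\<lambda>m. \<Sum>k<K. (norm (coord (X m) k - coord (X n) k))\<^sup>2)
            \<longlonglongrightarrow> (\<Sum>k<K. (norm (l k - coord (X n) k))\<^sup>2)"
      by (intro tendsto_intros l)
    show "eventually (\<lambda>m. (\<Sum>k<K. (norm (coord (X m) k - coord (X n) k))\<^sup>2) \<le> e\<^sup>2) sequentially"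
      unfolding eventually_sequentially
    proof (intro exI[of _ M] allI impI)
      fix m assume "M \<le> m"
      then have "norm (X m - X n) < e" using that by blast
      then have "(norm (X m - X n))\<^sup>2 \<le> e\<^sup>2" by (simp add: power_mono)
      then show "(\<Sum>k<K. (norm (coord (X m) k - coord (X n) k))\<^sup>2) \<le> e\<^sup>2"
        using sum_coord_le_norm[of "{..<K}" "X m - X n"] by simp
    qed
  qed simp
  have ex: "\<exists>M. \<forall>m\<ge>M. \<forall>n\<ge>M. norm (X m - X n) < e" if "e > 0" for e
    using CauchyD[OF X that] .
  obtain M where M: "\<forall>m\<ge>M. \<forall>n\<ge>M. norm (X m - X n) < 1"
    using ex[of 1] by auto
  have "sq_summable (\<lambda>k. l k - coord (X M) k)"
    unfolding sq_summable_def
  proof (rule bounded_imp_summable)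
    show "(\<Sum>k\<le>n. (norm (l k - coord (X M) k))\<^sup>2) \<le> 1\<^sup>2" for n
      using bnd[OF M order_refl, of "Suc n"] by (simp only: lessThan_Suc_atMost)
  qed simp
  from sq_summable_add[OF this sq_summable_coord[of "X M"]]
  have sl: "sq_summable l" by simp
  have "X \<longlonglongrightarrow> Abs_ell2 l"
  proof (rule LIMSEQ_I)
    fix r :: real assume "r > 0"
    then obtain M where M: "\<forall>m\<ge>M. \<forall>n\<ge>M. norm (X m - X n) < r / 2"
      using ex[of "r / 2"] by auto
    have "norm (X n - Abs_ell2 l) < r" if "n \<ge> M" for n
    proof -
      have "norm (Abs_ell2 l - X n) \<le> r / 2"
        using bnd[OF M that] \<open>r > 0\<close> by (intro norm_ell2_le) (simp_all add: sl)
      then show ?thesis using \<open>r > 0\<close> by (simp add: norm_minus_commute)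
    qed
    then show "\<exists>no. \<forall>n\<ge>no. norm (X n - Abs_ell2 l) < r" by blast
  qed
  then show "convergent X" unfolding convergent_def by (rule exI)
qed

definition ell2_unit :: "nat \<Rightarrow> 'a::{euclidean_space,real_normed_field} ell2" where
  "ell2_unit j = Abs_ell2 (\<lambda>k. if k = j then 1 else 0)"

lemma coord_unit: "coord (ell2_unit j) k = (if k = j then 1 else 0)"
  unfolding ell2_unit_def by (subst coord_Abs) (auto intro: sq_summable_finite)

lemma norm_unit [simp]: "norm (ell2_unit j :: 'a::{euclidean_space,real_normed_field} ell2) = 1"
proof -
  have "(\<Sum>k. (norm (coord (ell2_unit j :: 'a ell2) k))\<^sup>2) = (\<Sum>k\<in>{j}. (norm (coord (ell2_unit j :: 'a ell2) k))\<^sup>2)"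
    by (rule suminf_finite) (auto simp: coord_unit)
  then have "(norm (ell2_unit j :: 'a ell2))\<^sup>2 = 1\<^sup>2"
    by (simp add: ell2_norm_sq coord_unit)
  then show ?thesis by (rule power2_eq_imp_eq) simp_all
qed

lift_definition ell2_smult :: "'a::{euclidean_space,real_normed_field} \<Rightarrow> 'a ell2 \<Rightarrow> 'a ell2"
  is "\<lambda>c x k. c * x k"
  by (rule sq_summable_mult)

declare ell2_smult.rep_eq [simp]

lemma ell2_trunc_tendsto:
  fixes x :: "real ell2"
  shows "(\<lambda>n. \<Sum>k<n. coord x k *\<^sub>R ell2_unit k) \<longlonglongrightarrow> x"
proof -
  let ?S = "\<lambda>n. \<Sum>k<n. coord x k *\<^sub>R ell2_unit k"
  have co: "coord (?S n) k = (if k < n then coord x k else 0)" for n k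
    by (simp add: coord_sum coord_unit if_distrib cong: if_cong)
  have "(norm (?S n - x))\<^sup>2 = (norm x)\<^sup>2 - (\<Sum>k<n. (norm (coord x k))\<^sup>2)" for n
  proof -
    have s: "summable (\<lambda>k. (norm (coord y k))\<^sup>2)" for y :: "real ell2"
      using sq_summable_coord[of y] unfolding sq_summable_def .
    have "(\<Sum>k. (norm (coord (?S n - x) k))\<^sup>2) = (\<Sum>k. (norm (coord (?S n - x) (k + n)))\<^sup>2)
        + (\<Sum>k<n. (norm (coord (?S n - x) k))\<^sup>2)"
      by (rule suminf_split_initial_segment[OF s])
    also have "\<dots> = (\<Sum>k. (norm (coord x (k + n)))\<^sup>2)"
      using co by simp
    also have "\<dots> = (norm x)\<^sup>2 - (\<Sum>k<n. (norm (coord x k))\<^sup>2)"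
      using suminf_split_initial_segment[OF s[of x], of n] by (simp add: ell2_norm_sq)
    finally show ?thesis by (simp add: ell2_norm_sq[of "?S n - x"])
  qed
  moreover have "(\<lambda>n. (norm x)\<^sup>2 - (\<Sum>k<n. (norm (coord x k))\<^sup>2)) \<longlonglongrightarrow> (norm x)\<^sup>2 - (norm x)\<^sup>2"
    using ell2_norm_sums[of x] unfolding sums_def by (intro tendsto_intros)
  ultimately have "(\<lambda>n. (norm (?S n - x))\<^sup>2) \<longlonglongrightarrow> 0" by simp
  then have "(\<lambda>n. sqrt ((norm (?S n - x))\<^sup>2)) \<longlonglongrightarrow> sqrt 0"
    by (rule tendsto_real_sqrt)
  then have "(\<lambda>n. ?S n - x) \<longlonglongrightarrow> 0"
    by (simp only: real_sqrt_abs abs_norm_cancel real_sqrt_zero tendsto_norm_zero_iff)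
  then show ?thesis
    by (rule LIM_zero_cancel)
qed

section \<open>Jacobi matrices\<close>

text \<open>The rows of a Jacobi matrix with off-diagonal \<open>b\<close>; the spectral parameter
  is absorbed into the diagonal \<open>e\<close>, which therefore may be complex.\<close>

definition jrow :: "(nat \<Rightarrow> real) \<Rightarrow> (nat \<Rightarrow> 'a) \<Rightarrow> (nat \<Rightarrow> 'a) \<Rightarrow> nat \<Rightarrow> 'a::real_normed_field" where
  "jrow b e x k = (if k = 0 then 0 else of_real (b (k - 1)) * x (k - 1))
     + e k * x k + of_real (b k) * x (Suc k)"

lemma jac_apply_eq:
  "jac_apply g c1 c2 x = jrow (jac_off g) (\<lambda>k. complex_of_real (jac_diag c1 c2 k)) x"
  by (rule ext) (simp add: jac_apply_def jrow_def)

lemma jrow_add: "jrow b e (\<lambda>k. x k + y k) k = jrow b e x k + jrow b e y k"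
  by (simp add: jrow_def algebra_simps)

lemma jrow_mult: "jrow b e (\<lambda>k. c * x k) k = c * jrow b e x k"
  by (simp add: jrow_def algebra_simps)

lemma jrow_diff: "jrow b e (\<lambda>k. x k - y k) k = jrow b e x k - jrow b e y k"
  by (simp add: jrow_def algebra_simps)

lemma jrow_diag_diff: "jrow b (\<lambda>k. e k - z) x k = jrow b e x k - z * x k"
  by (simp add: jrow_def algebra_simps)

lemma jrow_of_real:
  "jrow b (\<lambda>k. of_real (e k)) (\<lambda>k. of_real (x k)) k = (of_real (jrow b e x k) :: 'a::real_normed_field)"
  by (simp add: jrow_def)

lemma jrow_cnj:
  "jrow b (\<lambda>k. complex_of_real (e k)) (\<lambda>k. cnj (x k)) k = cnj (jrow b (\<lambda>k. of_real (e k)) x k)"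
  by (simp add: jrow_def)

text \<open>Carleman's argument: the Wronskian has a limit, and a nonzero limit would make
  \<open>1/b\<close> summable.\<close>

lemma jrow_symmetric:
  fixes x y :: "nat \<Rightarrow> 'a::{real_normed_field,banach}"
  assumes b: "\<And>k. b k \<noteq> 0" and nb: "\<not> summable (\<lambda>k. 1 / \<bar>b k\<bar>)"
    and x: "sq_summable x" "sq_summable (jrow b e x)"
    and y: "sq_summable y" "sq_summable (jrow b e y)"
  shows "(\<Sum>k. jrow b e x k * y k) = (\<Sum>k. x k * jrow b e y k)"
proof -
  have s: "summable (\<lambda>k. u k * v k)" if "sq_summable u" "sq_summable v" for u v :: "nat \<Rightarrow> 'a"
    using sq_summable_prod[OF that] by (intro summable_norm_cancel[of "\<lambda>k. u k * v k"]) (simp add: norm_mult)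
  define W where "W n = of_real (b n) * (x (Suc n) * y n - x n * y (Suc n))" for n
  have part: "(\<Sum>k<Suc n. jrow b e x k * y k - x k * jrow b e y k) = W n" for n
    by (induction n) (simp_all add: W_def jrow_def algebra_simps)
  define w where "w = (\<Sum>k. jrow b e x k * y k) - (\<Sum>k. x k * jrow b e y k)"
  have "(\<lambda>k. jrow b e x k * y k - x k * jrow b e y k) sums w"
    unfolding w_def using x y by (intro sums_diff summable_sums s)
  then have "(\<lambda>n. \<Sum>k<Suc n. jrow b e x k * y k - x k * jrow b e y k) \<longlonglongrightarrow> w"
    unfolding sums_def by (rule LIMSEQ_Suc)
  then have W: "W \<longlonglongrightarrow> w" unfolding part .
  have "w = 0"
  proof (rule ccontr)
    assume "w \<noteq> 0"
    then have w: "norm w / 2 > 0" by simp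
    have "(\<lambda>n. norm (W n)) \<longlonglongrightarrow> norm w" using W by (rule tendsto_norm)
    moreover have "norm w / 2 < norm w" using w by linarith
    ultimately have ev: "eventually (\<lambda>n. norm w / 2 < norm (W n)) sequentially"
      by (rule order_tendstoD)
    define h where "h n = norm (x (Suc n)) * norm (y n) + norm (x n) * norm (y (Suc n))" for n
    have sh: "summable h"
      unfolding h_def using x y by (intro summable_add sq_summable_prod) (simp_all add: sq_summable_Suc)
    have "eventually (\<lambda>n. norm (1 / \<bar>b n\<bar>) \<le> 2 / norm w * h n) sequentially"
      using ev
    proof eventually_elim
      case (elim n)
      have "norm (W n) \<le> \<bar>b n\<bar> * h n"
        unfolding W_def h_def norm_mult
        using norm_triangle_ineq4[of "x (Suc n) * y n" "x n * y (Suc n)"]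
        by (simp add: norm_mult mult_left_mono)
      with elim have "norm w / 2 \<le> \<bar>b n\<bar> * h n" by linarith
      then show ?case using w b[of n] by (simp add: field_simps)
    qed
    then have "summable (\<lambda>k. 1 / \<bar>b k\<bar>)"
      by (rule summable_comparison_test_ev) (intro summable_mult sh)
    with nb show False by simp
  qed
  then show ?thesis unfolding w_def by simp
qed

lemma jac_off_nonzero: "g \<noteq> 0 \<Longrightarrow> jac_off g k \<noteq> 0"
  by (simp add: jac_off_def)

lemma jac_off_not_summable:
  assumes "g \<noteq> 0"
  shows "\<not> summable (\<lambda>k. 1 / \<bar>jac_off g k\<bar>)"
proof
  assume "summable (\<lambda>k. 1 / \<bar>jac_off g k\<bar>)"
  then have s: "summable (\<lambda>k. \<bar>g\<bar> * (1 / \<bar>jac_off g k\<bar>))" by (rule summable_mult)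
  have le: "1 / real (Suc k) \<le> \<bar>g\<bar> * (1 / \<bar>jac_off g k\<bar>)" for k
  proof -
    have "sqrt (real (Suc k)) \<le> real (Suc k)"
      by (rule real_le_lsqrt) (auto simp: power2_eq_square)
    then show ?thesis using assms by (simp add: jac_off_def abs_mult field_simps)
  qed
  have "summable (\<lambda>k. 1 / real (Suc k))"
    by (rule summable_comparison_test'[OF s, of 0]) (use le in simp)
  then show False
    using not_summable_harmonic[where 'a = real] by (subst (asm) summable_Suc_iff) (simp add: field_simps)
qed

section \<open>Solutions of the recurrence from the left\<close>

text \<open>Row \<open>k\<close> solved for entry \<open>Suc k\<close>, with a free initial value.
  For \<open>y = 0\<close>, \<open>a = 1\<close> and a diagonal shifted by the spectral parameter
  these are the orthogonal polynomials of the Jacobi matrix at that parameter.\<close>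

fun forward :: "(nat \<Rightarrow> real) \<Rightarrow> (nat \<Rightarrow> 'a) \<Rightarrow> (nat \<Rightarrow> 'a) \<Rightarrow> 'a \<Rightarrow> nat \<Rightarrow> 'a::real_normed_field" where
  "forward b e y a 0 = a"
| "forward b e y a (Suc 0) = (y 0 - e 0 * a) / of_real (b 0)"
| "forward b e y a (Suc (Suc k)) = (y (Suc k) - e (Suc k) * forward b e y a (Suc k)
     - of_real (b k) * forward b e y a k) / of_real (b (Suc k))"

lemma jrow_forward:
  assumes "\<And>k. b k \<noteq> 0"
  shows "jrow b e (forward b e y a) k = y k"
  using assms by (cases k) (simp_all add: jrow_def)

lemma forward_unique:
  assumes b: "\<And>k. b k \<noteq> 0" and "\<And>k. k < n \<Longrightarrow> jrow b e x k = y k" and "k \<le> n"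
  shows "x k = forward b e y (x 0) k"
  using assms(2,3)
proof (induction k rule: less_induct)
  case (less k)
  show ?case
  proof (cases k)
    case (Suc i)
    show ?thesis
    proof (cases i)
      case 0
      then show ?thesis
        using Suc less.prems(1)[of 0] less.prems(2) b[of 0] by (simp add: jrow_def field_simps)
    next
      case (Suc j)
      then show ?thesis
        using \<open>k = Suc i\<close> less.IH[of j] less.IH[of i] less.prems b[of i] less.prems(1)[of i]
        by (simp add: jrow_def field_simps)
    qed
  qed simp
qed

lemma forward_zero: "forward b e (\<lambda>_. 0) a k = a * forward b e (\<lambda>_. 0) 1 k"
  by (induction k rule: induct_nat_012) (simp_all add: algebra_simps diff_divide_distrib)

lemma forward_of_real:
  "forward b (\<lambda>k. of_real (e k)) (\<lambda>_. 0) 1 k = (of_real (forward b e (\<lambda>_. 0) 1 k) :: 'a::real_normed_field)"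
  by (induction k rule: induct_nat_012) simp_all

text \<open>The resolvent set asks for a norm estimate of the inverse. As the inverse is assembled
  from solutions picked by choice, this estimate alone is tracked, not linearity.\<close>

definition norm_bounded :: "('a::real_normed_vector \<Rightarrow> 'b::real_normed_vector) \<Rightarrow> bool" where
  "norm_bounded f \<longleftrightarrow> (\<exists>C. \<forall>y. norm (f y) \<le> C * norm y)"

lemma norm_bounded_add:
  assumes "norm_bounded f" "norm_bounded h"
  shows "norm_bounded (\<lambda>y. f y + h y)"
proof -
  obtain C D where "\<And>y. norm (f y) \<le> C * norm y" "\<And>y. norm (h y) \<le> D * norm y"
    using assms unfolding norm_bounded_def by blast
  then have "norm (f y + h y) \<le> (C + D) * norm y" for y
    by (metis (no_types) norm_triangle_mono distrib_right)
  then show ?thesis unfolding norm_bounded_def by blast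
qed

lemma norm_bounded_mono:
  assumes "norm_bounded f" "\<And>y. norm (h y) \<le> C * norm (f y)" "0 \<le> C"
  shows "norm_bounded h"
proof -
  obtain D where D: "\<And>y. norm (f y) \<le> D * norm y"
    using assms unfolding norm_bounded_def by blast
  have "norm (h y) \<le> (C * D) * norm y" for y
    using assms(2)[of y] mult_left_mono[OF D[of y] assms(3)] by (simp add: mult.assoc)
  then show ?thesis unfolding norm_bounded_def by blast
qed

lemma norm_bounded_diff:
  "norm_bounded f \<Longrightarrow> norm_bounded h \<Longrightarrow> norm_bounded (\<lambda>y. f y - h y)"
  using norm_bounded_add[of f "\<lambda>y. - h y"] norm_bounded_mono[of h "\<lambda>y. - h y" 1] by simp

lemma norm_bounded_mult:
  fixes f :: "'b::real_normed_vector \<Rightarrow> 'a::real_normed_field"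
  assumes "norm_bounded f"
  shows "norm_bounded (\<lambda>y. c * f y)"
  using assms by (rule norm_bounded_mono[where C = "norm c"]) (simp_all add: norm_mult)

lemma norm_bounded_divide:
  fixes f :: "'b::real_normed_vector \<Rightarrow> 'a::real_normed_field"
  assumes "norm_bounded f"
  shows "norm_bounded (\<lambda>y. f y / c)"
  using norm_bounded_mult[OF assms, of "1 / c"] by simp

lemma norm_bounded_sum:
  "(\<And>i. i \<in> I \<Longrightarrow> norm_bounded (f i)) \<Longrightarrow> norm_bounded (\<lambda>y. \<Sum>i\<in>I. f i y)"
proof (induction I rule: infinite_finite_induct)
  case (insert i I)
  then show ?case using norm_bounded_add[of "f i"] by simp
qed (auto simp: norm_bounded_def intro: exI[of _ 0])

lemma norm_bounded_coord: "norm_bounded (\<lambda>y :: 'a::euclidean_space ell2. coord y k)"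
  unfolding norm_bounded_def by (rule exI[of _ 1]) (simp add: norm_coord_le)

lemma norm_bounded_forward:
  fixes e :: "nat \<Rightarrow> 'a::{real_normed_field,euclidean_space}"
  shows "norm_bounded (\<lambda>y. forward b e (coord y) 0 k)"
proof (induction k rule: induct_nat_012)
  case 0
  show ?case unfolding norm_bounded_def by (rule exI[of _ 0]) simp
qed (simp_all add: norm_bounded_coord norm_bounded_divide norm_bounded_diff norm_bounded_mult)

section \<open>Solutions of the recurrence from the right\<close>

text \<open>The quarters make \<open>tail_op\<close> a contraction with constant 1/2, the bound
  \<open>1 \<le> norm (e k)\<close> keeps division by the diagonal from enlarging norms, and
  \<open>1 \<le> K\<close> makes \<open>K - 1\<close> a genuine row, the one where solutions are
  matched.\<close>

definition diag_dominant :: "(nat \<Rightarrow> real) \<Rightarrow> (nat \<Rightarrow> 'a::real_normed_field) \<Rightarrow> nat \<Rightarrow> bool" where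
  "diag_dominant b e K \<longleftrightarrow> 1 \<le> K \<and>
     (\<forall>k\<ge>K. \<bar>b (k - 1)\<bar> \<le> norm (e k) / 4 \<and> \<bar>b k\<bar> \<le> norm (e k) / 4 \<and> 1 \<le> norm (e k))"

text \<open>The rows from \<open>K\<close> on, divided by the diagonal, become the fixed point
  equation \<open>x = tail_op b e K x + w\<close>. The zeros below \<open>K\<close> leave it to
  \<open>w\<close> to prescribe the boundary values there.\<close>

definition tail_op :: "(nat \<Rightarrow> real) \<Rightarrow> (nat \<Rightarrow> 'a) \<Rightarrow> nat \<Rightarrow> 'a ell2 \<Rightarrow> 'a::{real_normed_field,euclidean_space} ell2" where
  "tail_op b e K x = Abs_ell2 (\<lambda>k. if k < K then 0
     else - (of_real (b (k - 1)) * coord x (k - 1) + of_real (b k) * coord x (Suc k)) / e k)"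

text \<open>An entry is at most a quarter of the sum of its two neighbours, its square at most an
  eighth of the sum of their squares, and each coordinate is a neighbour at most twice. Partial sums
  are bounded because the estimate must also prove that the sequence is square summable.\<close>

lemma tail_op_aux:
  fixes x :: "'a::{real_normed_field,euclidean_space} ell2"
  assumes K: "diag_dominant b e K"
  defines "u \<equiv> \<lambda>k. if k < K then 0
     else - (of_real (b (k - 1)) * coord x (k - 1) + of_real (b k) * coord x (Suc k)) / e k"
  shows "(\<Sum>k<n. (norm (u k))\<^sup>2) \<le> (norm x / 2)\<^sup>2"
proof -
  have u: "(norm (u k))\<^sup>2 \<le> 1/8 * (norm (coord x (Suc k)))\<^sup>2 + (if k = 0 then 0 else 1/8 * (norm (coord x (k - 1)))\<^sup>2)" for k
  proof (cases "k < K")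
    case False
    then have k: "k \<noteq> 0" "\<bar>b (k - 1)\<bar> \<le> norm (e k) / 4" "\<bar>b k\<bar> \<le> norm (e k) / 4" "1 \<le> norm (e k)"
      using K by (auto simp: diag_dominant_def)
    let ?a = "of_real (b (k - 1)) * coord x (k - 1) + of_real (b k) * coord x (Suc k)"
    have a: "norm ?a \<le> norm (e k) / 4 * norm (coord x (k - 1)) + norm (e k) / 4 * norm (coord x (Suc k))"
      unfolding norm_mult norm_of_real using k
      by (intro norm_triangle_mono) (simp_all only: norm_mult norm_of_real mult_right_mono norm_ge_zero)
    have "norm (u k) = norm ?a / norm (e k)"
      using False by (simp only: u_def if_False norm_divide norm_minus_cancel)
    also have "\<dots> \<le> 1/4 * (norm (coord x (k - 1)) + norm (coord x (Suc k)))"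
      by (subst pos_divide_le_eq) (use a k(4) in \<open>linarith, simp add: algebra_simps\<close>)
    finally have "norm (u k) \<le> 1/4 * (norm (coord x (k - 1)) + norm (coord x (Suc k)))" .
    then have "(norm (u k))\<^sup>2 \<le> (1/4 * (norm (coord x (k - 1)) + norm (coord x (Suc k))))\<^sup>2"
      by (rule power_mono) simp
    also have "\<dots> \<le> 1/8 * (norm (coord x (Suc k)))\<^sup>2 + 1/8 * (norm (coord x (k - 1)))\<^sup>2"
      using sum_squares_bound[of "norm (coord x (k - 1))" "norm (coord x (Suc k))"]
      by (simp add: power_mult_distrib power2_sum power_divide) 
    finally show ?thesis using k(1) by simp
  qed (simp add: u_def)
  have "(\<Sum>k<n. (norm (u k))\<^sup>2) \<le>
      (\<Sum>k<n. 1/8 * (norm (coord x (Suc k)))\<^sup>2 + (if k = 0 then 0 else 1/8 * (norm (coord x (k - 1)))\<^sup>2))"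
    by (rule sum_mono) (rule u)
  also have "\<dots> = 1/8 * (\<Sum>k<n. (norm (coord x (Suc k)))\<^sup>2) + 1/8 * (\<Sum>k<n - 1. (norm (coord x k))\<^sup>2)"
  proof -
    have "(\<Sum>k<n. if k = 0 then 0 else 1/8 * (norm (coord x (k - 1)))\<^sup>2) = 1/8 * (\<Sum>k<n - 1. (norm (coord x k))\<^sup>2)"
      by (cases n) (simp_all add: sum.lessThan_Suc_shift sum_distrib_left del: sum.lessThan_Suc)
    then show ?thesis by (simp add: sum.distrib sum_distrib_left)
  qed
  also have "\<dots> \<le> 1/8 * (norm x)\<^sup>2 + 1/8 * (norm x)\<^sup>2"
  proof -
    have "(\<Sum>k<n. (norm (coord x (Suc k)))\<^sup>2) \<le> (\<Sum>k<Suc n. (norm (coord x k))\<^sup>2)"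
      by (subst sum.lessThan_Suc_shift) simp
    also have "\<dots> \<le> (norm x)\<^sup>2" by (rule sum_coord_le_norm) simp
    finally show ?thesis using sum_coord_le_norm[of "{..<n - 1}" x] by simp
  qed
  also have "\<dots> = (norm x / 2)\<^sup>2" by (simp add: power_divide)
  finally show ?thesis .
qed

lemma coord_tail_op:
  assumes K: "diag_dominant b e K"
  shows "coord (tail_op b e K x) k = (if k < K then 0
     else - (of_real (b (k - 1)) * coord x (k - 1) + of_real (b k) * coord x (Suc k)) / e k)"
proof -
  have "sq_summable (\<lambda>k. if k < K then 0
     else - (of_real (b (k - 1)) * coord x (k - 1) + of_real (b k) * coord x (Suc k)) / e k)"
    unfolding sq_summable_def
    by (rule bounded_imp_summable[of _ "(norm x / 2)\<^sup>2"])
       (use tail_op_aux[OF K, of x] in \<open>simp_all only: lessThan_Suc_atMost[symmetric] zero_le_power2\<close>)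
  then show ?thesis unfolding tail_op_def by (subst coord_Abs) auto
qed

lemma norm_tail_op:
  assumes K: "diag_dominant b e K"
  shows "norm (tail_op b e K x) \<le> norm x / 2"
  by (rule norm_ell2_le) (simp_all only: coord_tail_op[OF K] tail_op_aux[OF K], simp)

lemma tail_op_diff:
  assumes K: "diag_dominant b e K"
  shows "tail_op b e K (x - y) = tail_op b e K x - tail_op b e K y"
  by (rule ell2_eqI) (simp add: coord_tail_op[OF K] diff_divide_distrib add_divide_distrib algebra_simps)

lemma tail_fixpoint:
  fixes w :: "'a::{real_normed_field,euclidean_space} ell2"
  assumes K: "diag_dominant b e K"
  shows "\<exists>x. tail_op b e K x + w = x"
proof -
  have "\<exists>!x. x \<in> UNIV \<and> tail_op b e K x + w = x"
    by (rule Banach_fix[where c = "1/2"])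
       (use norm_tail_op[OF K] in \<open>auto simp: dist_norm tail_op_diff[OF K, symmetric] complete_UNIV\<close>)
  then show ?thesis by blast
qed

definition tail_sol :: "(nat \<Rightarrow> real) \<Rightarrow> (nat \<Rightarrow> 'a) \<Rightarrow> nat \<Rightarrow> 'a ell2 \<Rightarrow> 'a::{real_normed_field,euclidean_space} ell2" where
  "tail_sol b e K w = (SOME x. tail_op b e K x + w = x)"

lemma tail_sol: "diag_dominant b e K \<Longrightarrow> tail_op b e K (tail_sol b e K w) + w = tail_sol b e K w"
  unfolding tail_sol_def using tail_fixpoint by (rule someI_ex)

lemma norm_tail_sol:
  assumes K: "diag_dominant b e K"
  shows "norm (tail_sol b e K w) \<le> 2 * norm w"
proof -
  have "norm (tail_sol b e K w) \<le> norm (tail_op b e K (tail_sol b e K w)) + norm w"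
    using norm_triangle_ineq[of "tail_op b e K (tail_sol b e K w)" w] by (simp add: tail_sol[OF K])
  then show ?thesis using norm_tail_op[OF K, of "tail_sol b e K w"] by linarith
qed

text \<open>Entrywise the two operators differ by the factor \<open>(e' k - e k) / e k\<close>,
  hence by \<open>r\<close> relative to \<open>tail_op b e' K\<close> of the second solution, whose
  norm is at most that of \<open>w\<close>. The contraction absorbs half of the difference of the
  solutions. All continuity in the parameters of the right-hand solution comes from here.\<close>

lemma tail_sol_lipschitz:
  assumes K: "diag_dominant b e K" and K': "diag_dominant b e' K"
    and r: "\<And>k. norm (e k - e' k) \<le> r"
  shows "norm (tail_sol b e K w - tail_sol b e' K w) \<le> 2 * r * norm w"
proof -
  let ?x = "tail_sol b e K w" and ?y = "tail_sol b e' K w"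
  let ?T = "tail_op b e K" and ?T' = "tail_op b e' K"
  have r0: "0 \<le> r" using r[of 0] norm_ge_zero order_trans by blast
  have "norm (?T ?y - ?T' ?y) \<le> r * norm (?T' ?y)"
  proof (rule norm_ell2_le)
    have "norm (coord (?T ?y - ?T' ?y) k) \<le> r * norm (coord (?T' ?y) k)" for k
    proof (cases "k < K")
      case False
      then have e: "1 \<le> norm (e k)" "1 \<le> norm (e' k)"
        using K K' by (auto simp: diag_dominant_def)
      then have ne: "e k \<noteq> 0" "e' k \<noteq> 0" by auto
      have "coord (?T ?y - ?T' ?y) k = (e' k - e k) / e k * coord (?T' ?y) k"
        using False ne by (simp add: coord_tail_op[OF K] coord_tail_op[OF K'] field_simps)
      moreover have "norm ((e' k - e k) / e k) \<le> r"
        using e r[of k] r0 frac_le[of r "norm (e k - e' k)" 1 "norm (e k)"] by (simp add: norm_divide norm_minus_commute)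
      ultimately show ?thesis by (simp only: norm_mult mult_right_mono norm_ge_zero)
    qed (simp add: coord_tail_op[OF K] coord_tail_op[OF K'])
    then have "(\<Sum>k<n. (norm (coord (?T ?y - ?T' ?y) k))\<^sup>2) \<le> (\<Sum>k<n. (r * norm (coord (?T' ?y) k))\<^sup>2)" for n
      by (intro sum_mono power_mono) auto
    also have "\<dots> n \<le> (r * norm (?T' ?y))\<^sup>2" for n
      using sum_coord_le_norm[of "{..<n}" "?T' ?y"]
      by (simp add: power_mult_distrib sum_distrib_left[symmetric] mult_left_mono)
    finally show "(\<Sum>k<n. (norm (coord (?T ?y - ?T' ?y) k))\<^sup>2) \<le> (r * norm (?T' ?y))\<^sup>2" for n .
  qed (use r0 in simp)
  also have "\<dots> \<le> r * norm w"
    using norm_tail_op[OF K', of ?y] norm_tail_sol[OF K', of w] r0 by (intro mult_left_mono) auto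
  finally have 1: "norm (?T ?y - ?T' ?y) \<le> r * norm w" .
  have "?x - ?y = (?T ?x + w) - (?T' ?y + w)"
    by (simp only: tail_sol[OF K] tail_sol[OF K'])
  then have "?x - ?y = ?T (?x - ?y) + (?T ?y - ?T' ?y)"
    unfolding tail_op_diff[OF K] by (simp only: add_diff_cancel_right add_diff_eq diff_add_cancel)
  then have "norm (?x - ?y) \<le> norm (?T (?x - ?y)) + norm (?T ?y - ?T' ?y)"
    by (metis norm_triangle_ineq)
  then show ?thesis using norm_tail_op[OF K, of "?x - ?y"] 1 by linarith
qed

lemma coord_tail_sol_less:
  "diag_dominant b e K \<Longrightarrow> k < K \<Longrightarrow> coord (tail_sol b e K w) k = coord w k"
  by (metis (no_types, lifting) tail_sol coord_tail_op plus_ell2.rep_eq add_0)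

lemma jrow_tail_sol:
  assumes K: "diag_dominant b e K" and k: "K \<le> k"
  shows "jrow b e (coord (tail_sol b e K w)) k = e k * coord w k"
proof -
  have ne: "e k \<noteq> 0" "k \<noteq> 0" using K k by (auto simp: diag_dominant_def)
  let ?x = "coord (tail_sol b e K w)"
  have "?x k = coord (tail_op b e K (tail_sol b e K w) + w) k"
    by (simp only: tail_sol[OF K])
  also have "\<dots> = - (of_real (b (k - 1)) * ?x (k - 1) + of_real (b k) * ?x (Suc k)) / e k + coord w k"
    using k by (simp add: coord_tail_op[OF K])
  finally have "e k * ?x k = - (of_real (b (k - 1)) * ?x (k - 1) + of_real (b k) * ?x (Suc k)) + e k * coord w k"
    using ne by (simp add: field_simps)
  then show ?thesis using ne by (simp add: jrow_def)
qed

text \<open>The discrete Jost (or Weyl) solution: square summable, homogeneous from row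
  \<open>K\<close> on, normalized at \<open>K - 1\<close>.\<close>

definition jost :: "(nat \<Rightarrow> real) \<Rightarrow> (nat \<Rightarrow> 'a) \<Rightarrow> nat \<Rightarrow> 'a::{real_normed_field,euclidean_space} ell2" where
  "jost b e K = tail_sol b e K (ell2_unit (K - 1))"

lemma coord_jost: "diag_dominant b e K \<Longrightarrow> k < K \<Longrightarrow> coord (jost b e K) k = (if k = K - 1 then 1 else 0)"
  by (simp add: jost_def coord_tail_sol_less coord_unit)

lemma jrow_jost: "diag_dominant b e K \<Longrightarrow> K \<le> k \<Longrightarrow> jrow b e (coord (jost b e K)) k = 0"
  by (auto simp: jost_def jrow_tail_sol coord_unit diag_dominant_def)

text \<open>The head stops below \<open>K - 1\<close>; the overlap entry is supplied by
  \<open>x\<close>. Written as a finite sum of unit vectors, the result lies in \<open>ell2\<close>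
  by construction, and norm bounds and continuity are inherited termwise.\<close>

definition glue :: "nat \<Rightarrow> (nat \<Rightarrow> 'a) \<Rightarrow> 'a ell2 \<Rightarrow> 'a::{real_normed_field,euclidean_space} ell2" where
  "glue K u x = (\<Sum>k<K - 1. ell2_smult (u k) (ell2_unit k)) + x"

lemma coord_glue: "coord (glue K u x) k = (if k < K - 1 then u k else 0) + coord x k"
  by (simp add: glue_def coord_sum coord_unit if_distrib cong: if_cong)

text \<open>The matching defect of the two solutions; its zeros are the eigenvalues.\<close>

definition defect :: "(nat \<Rightarrow> real) \<Rightarrow> (nat \<Rightarrow> 'a) \<Rightarrow> nat \<Rightarrow> 'a::{real_normed_field,euclidean_space}" where
  "defect b e K = forward b e (\<lambda>_. 0) 1 (K - 1) * coord (jost b e K) K - forward b e (\<lambda>_. 0) 1 K"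

definition glued :: "(nat \<Rightarrow> real) \<Rightarrow> (nat \<Rightarrow> 'a) \<Rightarrow> nat \<Rightarrow> 'a::{real_normed_field,euclidean_space} ell2" where
  "glued b e K = glue K (forward b e (\<lambda>_. 0) 1) (ell2_smult (forward b e (\<lambda>_. 0) 1 (K - 1)) (jost b e K))"

lemma jrow_cong_le:
  assumes "\<And>j. j \<le> Suc k \<Longrightarrow> x j = y j"
  shows "jrow b e x k = jrow b e y k"
  using assms by (simp add: jrow_def)

lemma jrow_cong_ge:
  assumes "\<And>j. k - 1 \<le> j \<Longrightarrow> x j = y j"
  shows "jrow b e x k = jrow b e y k"
  using assms by (simp add: jrow_def)

lemma coord_glued_less: "diag_dominant b e K \<Longrightarrow> k < K \<Longrightarrow> coord (glued b e K) k = forward b e (\<lambda>_. 0) 1 k"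
  by (cases "k = K - 1") (auto simp: glued_def coord_glue coord_jost)

lemma coord_glued_0: "diag_dominant b e K \<Longrightarrow> coord (glued b e K) 0 = 1"
  by (subst coord_glued_less) (auto simp: diag_dominant_def)

lemma coord_glued_ge: "K - 1 \<le> k \<Longrightarrow>
    coord (glued b e K) k = forward b e (\<lambda>_. 0) 1 (K - 1) * coord (jost b e K) k"
  by (simp add: glued_def coord_glue)

text \<open>Row \<open>K - 1\<close> is the only one that sees both solutions: it follows the left
  one up to its own entry but meets the right one at \<open>K\<close>. The residual is thus a
  multiple of one unit vector, which later makes the Wronskian identity scalar.\<close>

lemma jrow_glued:
  assumes K: "diag_dominant b e K" and b: "\<And>k. b k \<noteq> 0"
  shows "jrow b e (coord (glued b e K)) k = (if k = K - 1 then of_real (b k) * defect b e K else 0)"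
proof -
  let ?p = "forward b e (\<lambda>_. 0) 1"
  have K1: "1 \<le> K" using K by (simp add: diag_dominant_def)
  consider "k < K - 1" | "k = K - 1" | "K \<le> k" by linarith
  then show ?thesis
  proof cases
    case 1
    then have "jrow b e (coord (glued b e K)) k = jrow b e ?p k"
      by (intro jrow_cong_le coord_glued_less[OF K]) auto
    then show ?thesis using 1 by (simp add: jrow_forward[OF b])
  next
    case 2
    have "jrow b e (coord (glued b e K)) k = jrow b e ?p k + of_real (b k) * (coord (glued b e K) K - ?p K)"
      using 2 K1 unfolding jrow_def by (simp add: coord_glued_less[OF K] algebra_simps)
    then show ?thesis using 2 by (simp add: jrow_forward[OF b] coord_glued_ge defect_def)
  next
    case 3
    then have "jrow b e (coord (glued b e K)) k = jrow b e (\<lambda>k. ?p (K - 1) * coord (jost b e K) k) k"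
      by (intro jrow_cong_ge) (simp add: coord_glued_ge)
    then show ?thesis using 3 K1 by (simp add: jrow_mult jrow_jost[OF K])
  qed
qed

text \<open>Variation of constants: on the left a particular solution plus \<alpha> times the
  homogeneous one, on the right a particular solution plus \<beta> times the Jost solution.
  Agreement at \<open>K - 1\<close> fixes \<beta>; agreement at \<open>K\<close> is a linear
  equation for \<alpha> whose coefficient is, up to sign, the defect.\<close>

lemma jacobi_inverse:
  fixes e :: "nat \<Rightarrow> 'a::{real_normed_field,euclidean_space}"
  assumes K: "diag_dominant b e K" and b: "\<And>k. b k \<noteq> 0" and F: "defect b e K \<noteq> 0"
  shows "\<exists>S. norm_bounded S \<and> (\<forall>y k. jrow b e (coord (S y)) k = coord y k)"
proof -
  have K1: "1 \<le> K" using K by (simp add: diag_dominant_def)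
  let ?p = "forward b e (\<lambda>_. 0) 1" and ?q = "\<lambda>y. forward b e (coord y) 0"
  let ?f = "jost b e K"
  define w :: "'a ell2 \<Rightarrow> 'a ell2" where "w y = Abs_ell2 (\<lambda>k. if k < K then 0 else coord y k / e k)" for y
  have wle: "norm (if k < K then 0 else coord y k / e k) \<le> 1 * norm (coord y k)" for y k
  proof (cases "k < K")
    case False
    then have "1 \<le> norm (e k)" using K by (auto simp: diag_dominant_def)
    then show ?thesis using False frac_le[of "norm (coord y k)" "norm (coord y k)" 1 "norm (e k)"]
      by (simp add: norm_divide)
  qed simp
  have cw: "coord (w y) k = (if k < K then 0 else coord y k / e k)" for y k
    unfolding w_def by (subst coord_Abs) (auto intro: sq_summable_mono[OF sq_summable_coord[of y] wle])
  have nw: "norm (w y) \<le> norm y" for y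
  proof (rule norm_ell2_le)
    fix n
    have "(\<Sum>k<n. (norm (coord (w y) k))\<^sup>2) \<le> (\<Sum>k<n. (norm (coord y k))\<^sup>2)"
      using wle[of _ y] by (intro sum_mono power_mono) (auto simp: cw)
    also have "\<dots> \<le> (norm y)\<^sup>2" by (rule sum_coord_le_norm) simp
    finally show "(\<Sum>k<n. (norm (coord (w y) k))\<^sup>2) \<le> (norm y)\<^sup>2" .
  qed simp
  define X where "X y = tail_sol b e K (w y)" for y
  define \<alpha> where "\<alpha> y = (?q y K - ?q y (K - 1) * coord ?f K - coord (X y) K) / defect b e K" for y
  define \<beta> where "\<beta> y = \<alpha> y * ?p (K - 1) + ?q y (K - 1)" for y
  define S where "S y = glue K (\<lambda>k. \<alpha> y * ?p k + ?q y k) (ell2_smult (\<beta> y) ?f + X y)" for y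
  have X0: "coord (X y) k = 0" if "k < K" for k y
    using that by (simp add: X_def coord_tail_sol_less[OF K] cw)
  have lo: "coord (S y) k = \<alpha> y * ?p k + ?q y k" if "k < K" for k y
    using that K1 by (cases "k = K - 1") (auto simp: S_def coord_glue coord_jost[OF K] X0 \<beta>_def)
  have hi: "coord (S y) k = \<beta> y * coord ?f k + coord (X y) k" if "K - 1 \<le> k" for k y
    using that by (simp add: S_def coord_glue)
  have mid: "coord (S y) K = \<alpha> y * ?p K + ?q y K" for y
    using F unfolding hi[of K, simplified] \<beta>_def \<alpha>_def by (simp add: defect_def field_simps)
  have rows: "jrow b e (coord (S y)) k = coord y k" for y k
  proof (cases "k < K")
    case True
    have "jrow b e (coord (S y)) k = jrow b e (\<lambda>k. \<alpha> y * ?p k + ?q y k) k"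
      by (rule jrow_cong_le) (use True lo mid in \<open>metis less_Suc_eq_le le_less_trans less_antisym not_less_eq\<close>)
    then show ?thesis by (simp add: jrow_add jrow_mult jrow_forward[OF b])
  next
    case False
    have "jrow b e (coord (S y)) k = jrow b e (\<lambda>k. \<beta> y * coord ?f k + coord (X y) k) k"
      by (rule jrow_cong_ge) (use False hi in simp)
    moreover have "1 \<le> norm (e k)" using False K by (auto simp: diag_dominant_def)
    then have "e k \<noteq> 0" by auto
    ultimately show ?thesis
      using False by (simp add: jrow_add jrow_mult jrow_jost[OF K] X_def jrow_tail_sol[OF K] cw)
  qed
  have bX: "norm_bounded X"
    unfolding norm_bounded_def
  proof (intro exI[of _ 2] allI)
    fix y show "norm (X y) \<le> 2 * norm y"
      using norm_tail_sol[OF K, of "w y"] nw[of y] by (simp add: X_def)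
  qed
  have bc: "norm_bounded (\<lambda>y. coord (X y) K)"
    using bX by (rule norm_bounded_mono[where C = 1]) (simp_all add: norm_coord_le)
  have b\<alpha>: "norm_bounded \<alpha>"
    unfolding \<alpha>_def using norm_bounded_mult[OF norm_bounded_forward[of b e "K - 1"], of "coord ?f K"] bc
    by (intro norm_bounded_divide norm_bounded_diff norm_bounded_forward) (simp_all add: mult.commute)
  have bs: "norm_bounded (\<lambda>y. \<alpha> y * ?p k + ?q y k)" for k
    using norm_bounded_mult[OF b\<alpha>, of "?p k"] by (intro norm_bounded_add norm_bounded_forward) (simp add: mult.commute)
  have sm: "norm (ell2_smult c x) \<le> norm x * norm c" for c :: 'a and x
    by (rule norm_ell2_le)
       (simp_all add: norm_mult power_mult_distrib sum_distrib_left[symmetric] mult.commute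
          mult_left_mono sum_coord_le_norm)
  have "norm_bounded S"
    unfolding S_def glue_def
    by (intro norm_bounded_add norm_bounded_sum bX)
       (auto intro: norm_bounded_mono[OF bs sm] norm_bounded_mono[of \<beta>, OF bs[of "K - 1", folded \<beta>_def] sm])
  with rows show ?thesis by blast
qed

section \<open>Spectrum and eigenvalues\<close>

text \<open>What matters is that \<open>K\<close> depends on \<open>e\<close> only through
  \<open>M\<close>: one matching row serves a whole compact set of parameters.\<close>

lemma jac_off_diag_dominant:
  "\<exists>K. \<forall>e :: nat \<Rightarrow> 'a::real_normed_field.
     (\<forall>k. norm (e k - of_nat k) \<le> M) \<longrightarrow> diag_dominant (jac_off g) e K"
proof -
  obtain K :: nat where K0: "16 * g\<^sup>2 + 1 + 2 * \<bar>M\<bar> + 1 < real K" using reals_Archimedean2 by blast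
  have K: "\<bar>g\<bar> * sqrt (real (k + 1)) \<le> (real k - M) / 4 \<and> 1 \<le> real k - M" if "k \<ge> K" for k
  proof -
    define t q m where "t = \<bar>g\<bar> * sqrt (real (k + 1))" and "q = g\<^sup>2" and "m = \<bar>M\<bar>"
    \<comment> \<open>AM-GM for \<open>4 * \<bar>g\<bar>\<close> and
      \<open>sqrt (real (k + 1))\<close>, weighted so that only half of the growth of the diagonal
      is spent.\<close>
    have "8 * t \<le> 16 * q + (real k + 1)"
      using sum_squares_bound[of "4 * \<bar>g\<bar>" "sqrt (real (k + 1))"]
      by (simp add: t_def q_def power_mult_distrib add.commute)
    moreover have "16 * q + 1 + 2 * m + 1 < real k" "0 \<le> q" "0 \<le> m" "M \<le> m"
      using K0 that by (auto simp: q_def m_def)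
    ultimately show ?thesis unfolding t_def[symmetric] by argo
  qed
  have "diag_dominant (jac_off g) e (Suc K)" if e: "\<And>k. norm (e k - of_nat k) \<le> M" for e :: "nat \<Rightarrow> 'a"
    unfolding diag_dominant_def
  proof (intro conjI allI impI)
    fix k assume "Suc K \<le> k"
    then have k: "\<bar>g\<bar> * sqrt (real (k + 1)) \<le> (real k - M) / 4" "1 \<le> real k - M"
      using K[of k] by auto
    have "real k - M \<le> norm (e k)"
      using e[of k] norm_triangle_ineq2[of "of_nat k" "e k"] by (simp add: norm_minus_commute)
    with k have "\<bar>g\<bar> * sqrt (real (k + 1)) \<le> norm (e k) / 4" and "1 \<le> norm (e k)" by auto
    moreover have "\<bar>g\<bar> * sqrt (real k) \<le> \<bar>g\<bar> * sqrt (real (k + 1))"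
      by (intro mult_left_mono) auto
    ultimately show "\<bar>jac_off g (k - 1)\<bar> \<le> norm (e k) / 4" "\<bar>jac_off g k\<bar> \<le> norm (e k) / 4" "1 \<le> norm (e k)"
      using \<open>Suc K \<le> k\<close> by (auto simp: jac_off_def abs_mult)
  qed simp
  then show ?thesis by blast
qed

lemma jac_dom_iff:
  "x \<in> jac_dom g c1 c2 \<longleftrightarrow>
     sq_summable x \<and> sq_summable (jrow (jac_off g) (\<lambda>k. complex_of_real (jac_diag c1 c2 k)) x)"
  by (simp add: jac_dom_def is_l2_iff jac_apply_eq)

lemma jac_eigvec_iff:
  "jac_eigvec g c1 c2 z x \<longleftrightarrow> sq_summable x \<and> x \<noteq> (\<lambda>_. 0) \<and>
     (\<forall>k. jrow (jac_off g) (\<lambda>k. complex_of_real (jac_diag c1 c2 k) - z) x k = 0)"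
  by (auto simp: jac_eigvec_def jac_dom_iff jac_apply_eq jrow_diag_diff fun_eq_iff
      intro: sq_summable_mult)
     (metis (no_types, lifting) ext sq_summable_mult)

lemma jac_eigvec_forward:
  assumes "g \<noteq> 0" "jac_eigvec g c1 c2 z x"
  shows "x k = x 0 * forward (jac_off g) (\<lambda>k. complex_of_real (jac_diag c1 c2 k) - z) (\<lambda>_. 0) 1 k"
proof -
  let ?e = "\<lambda>k. complex_of_real (jac_diag c1 c2 k) - z"
  have "x k = forward (jac_off g) ?e (\<lambda>_. 0) (x 0) k"
    by (rule forward_unique[where n = k])
       (use assms jac_off_nonzero[of g] in \<open>auto simp: jac_eigvec_iff\<close>)
  then show ?thesis unfolding forward_zero[of _ _ "x 0"] .
qed

lemma jac_eigvec_0_nonzero: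
  assumes "g \<noteq> 0" "jac_eigvec g c1 c2 z x"
  shows "x 0 \<noteq> 0"
proof
  assume "x 0 = 0"
  have "x k = 0" for k
    by (subst jac_eigvec_forward[OF assms]) (simp add: \<open>x 0 = 0\<close>)
  then show False using assms(2) by (auto simp: jac_eigvec_iff)
qed

text \<open>The recurrence from the left determines an eigenvector by its entry 0, so every
  eigenspace is a line.\<close>

lemma jac_eigvec_multiple:
  assumes "g \<noteq> 0" "jac_eigvec g c1 c2 z x" "jac_eigvec g c1 c2 z y"
  shows "\<exists>c. y = (\<lambda>k. c * x k)"
proof (intro exI ext)
  fix k
  let ?p = "forward (jac_off g) (\<lambda>k. complex_of_real (jac_diag c1 c2 k) - z) (\<lambda>_. 0) 1 k"
  have "y k = y 0 * ?p" "x k = x 0 * ?p"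
    by (rule jac_eigvec_forward[OF assms(1,3)], rule jac_eigvec_forward[OF assms(1,2)])
  then show "y k = y 0 / x 0 * x k"
    using jac_eigvec_0_nonzero[OF assms(1,2)] by simp
qed

text \<open>The bilinear Carleman identity is applied to the eigenvector and its complex conjugate,
  which belongs to \<open>cnj z\<close> because the matrix is real.\<close>

lemma jac_eigval_real:
  assumes "g \<noteq> 0" "jac_eigvec g c1 c2 z x"
  shows "z \<in> \<real>"
proof -
  let ?d = "\<lambda>k. complex_of_real (jac_diag c1 c2 k)"
  have x: "sq_summable x" "\<And>k. jrow (jac_off g) ?d x k = z * x k"
    using assms(2) by (auto simp: jac_eigvec_iff jrow_diag_diff)
  then have y: "sq_summable (\<lambda>k. cnj (x k))" "\<And>k. jrow (jac_off g) ?d (\<lambda>k. cnj (x k)) k = cnj z * cnj (x k)"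
    by (auto simp: jrow_cnj sq_summable_def)
  have s: "sq_summable (jrow (jac_off g) ?d x)" "sq_summable (jrow (jac_off g) ?d (\<lambda>k. cnj (x k)))"
    using sq_summable_mult[OF x(1), of z] sq_summable_mult[OF y(1), of "cnj z"] x(2) y(2)
    by (simp_all add: x(2)[THEN ext] y(2)[THEN ext])
  have sm: "summable (\<lambda>k. x k * cnj (x k))"
    using summable_of_real[of "\<lambda>k. (cmod (x k))\<^sup>2", where 'a = complex] x(1)
    by (simp only: complex_norm_square sq_summable_def)
  have "(\<Sum>k. z * x k * cnj (x k)) = (\<Sum>k. x k * (cnj z * cnj (x k)))"
    using jrow_symmetric[OF jac_off_nonzero[OF assms(1)] jac_off_not_summable[OF assms(1)] x(1) s(1) y(1) s(2)]
    by (simp add: x(2) y(2))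
  then have "z * (\<Sum>k. x k * cnj (x k)) = cnj z * (\<Sum>k. x k * cnj (x k))"
    using sm by (simp add: suminf_mult mult.assoc mult.left_commute)
  moreover have "(\<Sum>k. x k * cnj (x k)) \<noteq> 0"
  proof
    assume "(\<Sum>k. x k * cnj (x k)) = 0"
    then have "complex_of_real (\<Sum>k. (cmod (x k))\<^sup>2) = 0"
      unfolding suminf_of_real[OF x(1)[unfolded sq_summable_def]] complex_norm_square .
    then have "(\<Sum>k. (cmod (x k))\<^sup>2) = 0" by (simp only: of_real_eq_0_iff)
    then have "(cmod (x 0))\<^sup>2 = 0"
      using x(1) by (subst (asm) suminf_eq_zero_iff) (auto simp: sq_summable_def)
    then show False using jac_eigvec_0_nonzero[OF assms] by simp
  qed
  ultimately have "z = cnj z" by simp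
  then show ?thesis by (metis Reals_cnj_iff)
qed

lemma l2_norm_eq: "sq_summable x \<Longrightarrow> l2_norm x = norm (Abs_ell2 x)"
  unfolding l2_norm_def by (metis norm_Abs_ell2 norm_ge_zero real_sqrt_unique)

text \<open>Without an eigenvector the defect cannot vanish, since the glued sequence, whose entry 0
  is 1, would be one; and a nonvanishing defect gives a bounded inverse. An eigenvector, conversely,
  destroys uniqueness.\<close>

lemma jac_spectrum_iff:
  assumes g: "g \<noteq> 0"
  shows "z \<in> jac_spectrum g c1 c2 \<longleftrightarrow> (\<exists>x. jac_eigvec g c1 c2 z x)"
proof
  assume "\<exists>x. jac_eigvec g c1 c2 z x"
  then obtain x where x: "jac_eigvec g c1 c2 z x" ..
  have z: "jac_apply g c1 c2 (\<lambda>_. 0) = (\<lambda>_. 0)" by (rule ext) (simp add: jac_apply_def)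
  show "z \<in> jac_spectrum g c1 c2"
  proof (rule ccontr)
    assume "z \<notin> jac_spectrum g c1 c2"
    then have "z \<in> jac_resolvent_set g c1 c2" by (simp add: jac_spectrum_def)
    then have "\<exists>!x. x \<in> jac_dom g c1 c2 \<and> (\<lambda>n. jac_apply g c1 c2 x n - z * x n) = (\<lambda>_. 0)"
      unfolding jac_resolvent_set_def by (auto simp: is_l2_def)
    moreover have "(\<lambda>_. 0) \<in> jac_dom g c1 c2 \<and>
        (\<lambda>n. jac_apply g c1 c2 (\<lambda>_. 0) n - z * 0) = (\<lambda>_. 0)"
      by (simp add: jac_dom_def z is_l2_def)
    moreover have "x \<in> jac_dom g c1 c2 \<and> (\<lambda>n. jac_apply g c1 c2 x n - z * x n) = (\<lambda>_. 0)"
      using x by (simp add: jac_eigvec_def)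
    ultimately have "x = (\<lambda>_. 0)" by blast
    then show False using x by (simp add: jac_eigvec_def)
  qed
next
  assume spec: "z \<in> jac_spectrum g c1 c2"
  show "\<exists>x. jac_eigvec g c1 c2 z x"
  proof (rule ccontr)
    assume no: "\<nexists>x. jac_eigvec g c1 c2 z x"
    let ?d = "\<lambda>k. complex_of_real (jac_diag c1 c2 k)"
    let ?b = "jac_off g"
    define e where "e k = ?d k - z" for k
    have "norm (e k - of_nat k) \<le> max \<bar>c1\<bar> \<bar>c2\<bar> + norm z" for k
    proof -
      have "e k - of_nat k = of_real (if even k then c1 else c2) - z"
        by (simp add: e_def jac_diag_def)
      then show ?thesis
        using norm_triangle_ineq4[of "of_real (if even k then c1 else c2)" z] by (auto split: if_splits)
    qed
    then obtain K where K: "diag_dominant ?b e K"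
      using jac_off_diag_dominant by blast
    have F: "defect ?b e K \<noteq> 0"
    proof
      assume "defect ?b e K = 0"
      then have "jrow ?b e (coord (glued ?b e K)) k = 0" for k
        by (simp add: jrow_glued[OF K jac_off_nonzero[OF g]])
      moreover have "coord (glued ?b e K) \<noteq> (\<lambda>_. 0)"
        using coord_glued_0[OF K] by (auto simp: fun_eq_iff intro!: exI[of _ 0])
      ultimately have "jac_eigvec g c1 c2 z (coord (glued ?b e K))"
        unfolding jac_eigvec_iff e_def by simp
      with no show False by blast
    qed
    obtain S where S: "norm_bounded S" "\<And>y k. jrow ?b e (coord (S y)) k = coord y k"
      using jacobi_inverse[OF K jac_off_nonzero[OF g] F] by blast
    then obtain C where C: "\<And>y. norm (S y) \<le> C * norm y" unfolding norm_bounded_def by blast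
    have ap: "jac_apply g c1 c2 x n - z * x n = jrow ?b e x n" for x n
      unfolding jac_apply_eq e_def jrow_diag_diff ..
    have uniq: "x = y" if "sq_summable x" "sq_summable y" "\<And>k. jrow ?b e x k = jrow ?b e y k" for x y
    proof (rule ccontr)
      assume "x \<noteq> y"
      then have "jac_eigvec g c1 c2 z (\<lambda>k. x k - y k)"
        using that unfolding e_def by (auto simp: jac_eigvec_iff sq_summable_diff jrow_diff fun_eq_iff)
      with no show False by blast
    qed
    have dom: "coord (S y) \<in> jac_dom g c1 c2" for y
    proof -
      have "jac_apply g c1 c2 (coord (S y)) = (\<lambda>n. coord y n + z * coord (S y) n)"
        using ap[of "coord (S y)"] S(2)[of y] by (auto simp: fun_eq_iff algebra_simps)
      then show ?thesis
        using sq_summable_add[OF sq_summable_coord[of y] sq_summable_mult[OF sq_summable_coord[of "S y"], of z]]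
        by (simp add: jac_dom_def is_l2_iff)
    qed
    have "z \<in> jac_resolvent_set g c1 c2"
      unfolding jac_resolvent_set_def
    proof (intro CollectI conjI allI impI)
      fix y :: "nat \<Rightarrow> complex" assume y: "is_l2 y"
      show "\<exists>!x. x \<in> jac_dom g c1 c2 \<and> (\<lambda>n. jac_apply g c1 c2 x n - z * x n) = y"
      proof (rule ex1I[of _ "coord (S (Abs_ell2 y))"])
        show "coord (S (Abs_ell2 y)) \<in> jac_dom g c1 c2 \<and>
            (\<lambda>n. jac_apply g c1 c2 (coord (S (Abs_ell2 y))) n - z * coord (S (Abs_ell2 y)) n) = y"
          using y dom by (auto simp: ap S(2) is_l2_iff)
        fix x assume "x \<in> jac_dom g c1 c2 \<and> (\<lambda>n. jac_apply g c1 c2 x n - z * x n) = y"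
        then show "x = coord (S (Abs_ell2 y))"
          using y by (intro uniq) (auto simp: ap S(2) is_l2_iff jac_dom_iff)
      qed
    next
      show "\<exists>C. \<forall>x\<in>jac_dom g c1 c2. l2_norm x \<le> C * l2_norm (\<lambda>n. jac_apply g c1 c2 x n - z * x n)"
      proof (intro exI[of _ C] ballI)
        fix x assume x: "x \<in> jac_dom g c1 c2"
        define y where "y = (\<lambda>n. jac_apply g c1 c2 x n - z * x n)"
        have sx: "sq_summable x" and sy: "sq_summable y"
          using x unfolding y_def jac_dom_def is_l2_iff by (auto intro: sq_summable_diff sq_summable_mult)
        have "x = coord (S (Abs_ell2 y))"
          using sx sy by (intro uniq) (simp_all add: S(2), simp add: y_def ap)
        then have "Abs_ell2 x = S (Abs_ell2 y)" by (simp add: coord_inverse)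
        then show "l2_norm x \<le> C * l2_norm (\<lambda>n. jac_apply g c1 c2 x n - z * x n)"
          unfolding y_def[symmetric] l2_norm_eq[OF sx] l2_norm_eq[OF sy] using C by simp
      qed
    qed
    with spec show False by (simp add: jac_spectrum_def)
  qed
qed

text \<open>With \<open>c\<close> and \<open>s\<close> the half sum and half difference of \<open>c1\<close> and \<open>c2\<close>, the operator
  \<open>A - c + g\<^sup>2\<close> has the diagonal below; for \<open>s = 0\<close> its eigenvalues are the natural numbers.\<close>

definition shifted_diag :: "real \<Rightarrow> real \<Rightarrow> nat \<Rightarrow> real" where
  "shifted_diag g s k = real k + g\<^sup>2 + s * (-1) ^ k"

definition shifted_eigvals :: "real \<Rightarrow> real \<Rightarrow> real set" where
  "shifted_eigvals g s = {\<nu>. \<exists>x. x \<noteq> 0 \<and>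
     (\<forall>k. jrow (jac_off g) (shifted_diag g s) (coord x) k = \<nu> * coord x k)}"

lemma jac_diag_shifted:
  "jac_diag c1 c2 k = shifted_diag g ((c1 - c2) / 2) k + ((c1 + c2) / 2 - g\<^sup>2)"
  by (auto simp: jac_diag_def shifted_diag_def field_simps)

text \<open>A complex eigenvector for a real eigenvalue is \<open>x 0\<close> times the real
  solution from the left. That solution is then square summable itself, and the problem descends to
  real sequences.\<close>

lemma jac_eigval_iff:
  assumes g: "g \<noteq> 0"
  shows "(\<exists>x. jac_eigvec g c1 c2 (complex_of_real l) x) \<longleftrightarrow>
    l - ((c1 + c2) / 2 - g\<^sup>2) \<in> shifted_eigvals g ((c1 - c2) / 2)"
proof -
  let ?d = "\<lambda>k. jac_diag c1 c2 k - l" and ?b = "jac_off g"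
  let ?nu = "l - ((c1 + c2) / 2 - g\<^sup>2)" and ?s = "(c1 - c2) / 2"
  have d: "?d = (\<lambda>k. shifted_diag g ?s k - ?nu)"
    by (simp add: jac_diag_shifted[of c1 c2 _ g] fun_eq_iff)
  have dc: "(\<lambda>k. complex_of_real (jac_diag c1 c2 k) - complex_of_real l) = (\<lambda>k. of_real (?d k))"
    by simp
  show ?thesis
  proof
    assume "\<exists>x. jac_eigvec g c1 c2 (complex_of_real l) x"
    then obtain x where x: "jac_eigvec g c1 c2 (complex_of_real l) x" ..
    let ?p = "forward ?b ?d (\<lambda>_. 0) 1"
    have xp: "x k = x 0 * of_real (?p k)" for k
      using jac_eigvec_forward[OF g x, of k] unfolding dc forward_of_real .
    have x0: "x 0 \<noteq> 0" by (rule jac_eigvec_0_nonzero[OF g x])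
    have p: "sq_summable ?p"
    proof (rule sq_summable_mono)
      show "sq_summable x" using x by (simp add: jac_eigvec_iff)
      show "norm (?p k) \<le> (1 / norm (x 0)) * norm (x k)" for k
        using x0 by (subst xp) (simp add: norm_mult)
    qed
    have "jrow ?b (\<lambda>k. shifted_diag g ?s k - ?nu) (coord (Abs_ell2 ?p)) k = 0" for k
      unfolding d[symmetric] using p by (simp add: jrow_forward[OF jac_off_nonzero[OF g]])
    moreover have "coord (Abs_ell2 ?p) 0 = 1" using p by simp
    then have "Abs_ell2 ?p \<noteq> 0" by force
    ultimately show "?nu \<in> shifted_eigvals g ?s"
      unfolding shifted_eigvals_def jrow_diag_diff by force
  next
    assume "?nu \<in> shifted_eigvals g ?s"
    then obtain x where x: "x \<noteq> 0" "\<And>k. jrow ?b ?d (coord x) k = 0"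
      unfolding shifted_eigvals_def d jrow_diag_diff by force
    have "jac_eigvec g c1 c2 (complex_of_real l) (\<lambda>k. complex_of_real (coord x k))"
      unfolding jac_eigvec_iff
    proof (intro conjI allI)
      show "sq_summable (\<lambda>k. complex_of_real (coord x k))"
        by (rule sq_summable_mono[OF sq_summable_coord[of x], of _ 1]) simp
      show "(\<lambda>k. complex_of_real (coord x k)) \<noteq> (\<lambda>_. 0)"
        using x(1) ell2_eqI[of x 0] by (auto simp: fun_eq_iff)
      show "jrow ?b (\<lambda>k. complex_of_real (jac_diag c1 c2 k) - complex_of_real l)
          (\<lambda>k. complex_of_real (coord x k)) k = 0" for k
        unfolding dc jrow_of_real x(2) by simp
    qed
    then show "\<exists>x. jac_eigvec g c1 c2 (complex_of_real l) x" by blast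
  qed
qed

section \<open>The eigenbasis of the displaced oscillator\<close>

text \<open>Normalized Charlier functions: the columns of the displacement operator
  \<open>exp (g a - g a\<^sup>*)\<close> in the number basis. They diagonalize \<open>A\<close> when \<open>c1 = c2\<close>.\<close>

fun charlier :: "real \<Rightarrow> nat \<Rightarrow> nat \<Rightarrow> real" where
  "charlier g 0 k = exp (- g\<^sup>2 / 2) * (- g) ^ k / sqrt (fact k)"
| "charlier g (Suc n) k = ((if k = 0 then 0 else sqrt (real k) * charlier g n (k - 1))
     + g * charlier g n k) / sqrt (real (Suc n))"

text \<open>The creation operator displaced by \<open>g\<close>, applied to the \<open>n\<close>-th
  function. Together with \<open>charlier_lower\<close> it provides the ladder algebra of an
  oscillator.\<close>

lemma charlier_raise:
  "sqrt (real (Suc n)) * charlier g (Suc n) k =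
     (if k = 0 then 0 else sqrt (real k) * charlier g n (k - 1)) + g * charlier g n k"
  by (simp del: of_nat_Suc)

declare charlier.simps(2) [simp del]

lemma charlier_raise': "n \<noteq> 0 \<Longrightarrow> sqrt (real n) * charlier g n k =
    (if k = 0 then 0 else sqrt (real k) * charlier g (n - 1) (k - 1)) + g * charlier g (n - 1) k"
  using charlier_raise[of "n - 1" g k] by simp

lemma sqrt_of_nat_twice: "sqrt (real j) * (sqrt (real j) * y) = real j * y"
  by (simp add: mult.assoc[symmetric])

lemma charlier_raise_twice:
  "real n * charlier g n k
     = sqrt (real n) * (if k = 0 then 0 else sqrt (real k) * charlier g (n - 1) (k - 1))
       + g * (sqrt (real n) * charlier g (n - 1) k)"
proof (cases "n = 0")
  case False
  have "sqrt (real n) * (sqrt (real n) * charlier g n k) = sqrt (real n) * (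
      (if k = 0 then 0 else sqrt (real k) * charlier g (n - 1) (k - 1)) + g * charlier g (n - 1) k)"
    unfolding charlier_raise'[OF False] ..
  then show ?thesis unfolding sqrt_of_nat_twice by (simp add: algebra_simps)
qed simp

text \<open>The creation operator applied to the lowering relation. That relation is an assumption
  here because the induction that proves it uses this consequence.\<close>

lemma charlier_lower_twice:
  assumes "\<And>k. sqrt (real (Suc k)) * charlier g n (Suc k) + g * charlier g n k
      = sqrt (real n) * charlier g (n - 1) k"
  shows "real k * charlier g n k + g * (if k = 0 then 0 else sqrt (real k) * charlier g n (k - 1))
      = sqrt (real n) * (if k = 0 then 0 else sqrt (real k) * charlier g (n - 1) (k - 1))"
proof (cases k)
  case (Suc j)
  have "sqrt (real k) * (sqrt (real k) * charlier g n k + g * charlier g n j)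
    = sqrt (real k) * (sqrt (real n) * charlier g (n - 1) j)"
    using assms[of j] Suc by simp
  then have "real k * charlier g n k + sqrt (real k) * (g * charlier g n j)
    = sqrt (real k) * (sqrt (real n) * charlier g (n - 1) j)"
    unfolding distrib_left sqrt_of_nat_twice .
  then show ?thesis using Suc by (simp add: mult_ac del: of_nat_Suc)
qed simp

text \<open>For \<open>n = 0\<close> the right-hand side vanishes because of the factor \<open>sqrt 0\<close>.\<close>

lemma charlier_lower:
  "sqrt (real (Suc k)) * charlier g n (Suc k) + g * charlier g n k = sqrt (real n) * charlier g (n - 1) k"
proof (induction n arbitrary: k)
  case 0
  show ?case by (simp add: real_sqrt_mult del: of_nat_Suc)
next
  case (Suc n)
  note a = charlier_lower_twice[OF Suc.IH, of k] and b = charlier_raise_twice[of n g k]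
    and sq = sqrt_of_nat_twice
  have "sqrt (real (Suc n)) * (sqrt (real (Suc k)) * charlier g (Suc n) (Suc k) + g * charlier g (Suc n) k)
      = sqrt (real (Suc k)) * (sqrt (real (Suc n)) * charlier g (Suc n) (Suc k))
        + g * (sqrt (real (Suc n)) * charlier g (Suc n) k)"
    by (simp add: algebra_simps del: of_nat_Suc)
  \<comment> \<open>The commutation relation of the ladder operators enters: lowering after raising
    has the weight \<open>real (Suc k)\<close>, one more than the number operator.\<close>
  also have "\<dots> = real (Suc k) * charlier g n k + g * (sqrt (real (Suc k)) * charlier g n (Suc k) + g * charlier g n k)
      + g * (if k = 0 then 0 else sqrt (real k) * charlier g n (k - 1))"
    unfolding charlier_raise using sq[of "Suc k"] by (simp add: algebra_simps del: of_nat_Suc)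
  also have "\<dots> = real (Suc n) * charlier g n k"
    unfolding Suc.IH using a b by (simp add: algebra_simps)
  also have "\<dots> = sqrt (real (Suc n)) * (sqrt (real (Suc n)) * charlier g n k)"
    using sq[of "Suc n"] by simp
  finally show ?case by (simp del: of_nat_Suc)
qed

text \<open>The number operator is the product of the ladder operators; undoing the displacement by
  \<open>g\<close> in both factors leaves \<open>n\<close>, the constant \<open>g\<^sup>2\<close>
  and a term linear in the displaced ladder operators.\<close>

lemma charlier_number:
  "real k * charlier g n k = (real n + g\<^sup>2) * charlier g n k
     - g * (sqrt (real n) * charlier g (n - 1) k + sqrt (real (Suc n)) * charlier g (Suc n) k)"
proof -
  show ?thesis
    using charlier_lower_twice[OF charlier_lower, of k g n] charlier_raise_twice[of n g k]
    unfolding charlier_raise by (simp add: algebra_simps power2_eq_square)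
qed

text \<open>The matrix is the displaced creation operator times the displaced annihilation operator;
  the summand \<open>g\<^sup>2\<close> of \<open>shifted_diag\<close> completes this
  product.\<close>

lemma jrow_charlier:
  "jrow (jac_off g) (shifted_diag g 0) (charlier g n) k = real n * charlier g n k"
proof -
  have "jrow (jac_off g) (shifted_diag g 0) (charlier g n) k =
      g * (if k = 0 then 0 else sqrt (real k) * charlier g n (k - 1)) + real k * charlier g n k
      + g * (sqrt (real (Suc k)) * charlier g n (Suc k) + g * charlier g n k)"
    by (simp add: jrow_def jac_off_def shifted_diag_def algebra_simps power2_eq_square)
  then show ?thesis
    unfolding charlier_lower charlier_number[of k] using charlier_raise[of n g k]
    by (simp add: algebra_simps power2_eq_square)
qed

text \<open>The rate \<rho> varies within the induction: a raising step costs a factor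
  \<open>sqrt (real k)\<close>, which is paid for by using the hypothesis at
  \<open>\<rho> / 2\<close>.\<close>

lemma charlier_decay:
  assumes "0 < \<rho>"
  shows "\<exists>C\<ge>0. \<forall>k. \<bar>charlier g n k\<bar> \<le> C * \<rho> ^ k"
  using assms
proof (induction n arbitrary: \<rho>)
  case 0
  \<comment> \<open>Then \<open>a ^ k / fact k\<close>, a single term of the exponential series, is
    the square of the quantity to be bounded, divided by \<open>\<rho> ^ (2 * k)\<close>.\<close>
  define a where "a = (g / \<rho>)\<^sup>2"
  have *: "\<bar>g\<bar> ^ k / sqrt (fact k) \<le> sqrt (exp a) * \<rho> ^ k" for k
  proof -
    have "a ^ k / fact k \<le> exp a"
    proof -
      have "(\<Sum>n\<in>{k}. a ^ n /\<^sub>R fact n) \<le> (\<Sum>n. a ^ n /\<^sub>R fact n)"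
        by (intro sum_le_suminf summable_exp_generic) (auto simp: a_def)
      then show ?thesis unfolding exp_def by (simp add: field_simps)
    qed
    then have "sqrt (a ^ k / fact k) \<le> sqrt (exp a)" by simp
    moreover have "sqrt (a ^ k / fact k) = (\<bar>g\<bar> / \<rho>) ^ k / sqrt (fact k)"
      using 0 unfolding a_def power2_eq_square power_mult_distrib real_sqrt_divide real_sqrt_mult
      by (simp add: real_sqrt_power[symmetric] power_abs abs_divide flip: real_sqrt_mult)
    ultimately have "(\<bar>g\<bar> / \<rho>) ^ k / sqrt (fact k) \<le> sqrt (exp a)" by simp
    then have "(\<bar>g\<bar> / \<rho>) ^ k / sqrt (fact k) * \<rho> ^ k \<le> sqrt (exp a) * \<rho> ^ k"
      using 0 by (intro mult_right_mono) auto
    then show ?thesis using 0 by (simp add: power_divide)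
  qed
  show ?case
  proof (intro exI[of _ "exp (- g\<^sup>2 / 2) * sqrt (exp a)"] conjI allI)
    fix k
    have "\<bar>charlier g 0 k\<bar> = exp (- g\<^sup>2 / 2) * (\<bar>g\<bar> ^ k / sqrt (fact k))"
      by (simp add: abs_mult power_abs)
    also have "\<dots> \<le> exp (- g\<^sup>2 / 2) * (sqrt (exp a) * \<rho> ^ k)"
      by (rule mult_left_mono[OF *]) simp
    finally show "\<bar>charlier g 0 k\<bar> \<le> exp (- g\<^sup>2 / 2) * sqrt (exp a) * \<rho> ^ k"
      by (simp add: mult.assoc)
  qed simp
next
  case (Suc n)
  obtain C where C: "C \<ge> 0" "\<And>k. \<bar>charlier g n k\<bar> \<le> C * (\<rho> / 2) ^ k"
    using Suc.IH[of "\<rho> / 2"] Suc.prems by auto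
  show ?case
  proof (intro exI[of _ "C * (2 / \<rho> + \<bar>g\<bar>)"] conjI allI)
    fix k
    have p: "C * (\<rho> / 2) ^ k \<le> C * \<rho> ^ k"
      using C Suc.prems by (intro mult_left_mono power_mono) auto
    have 1: "\<bar>if k = 0 then 0 else sqrt (real k) * charlier g n (k - 1)\<bar> \<le> C * (2 / \<rho>) * \<rho> ^ k"
    proof (cases k)
      case (Suc j)
      have "sqrt (real k) \<le> 2 ^ k"
      proof (rule real_le_lsqrt)
        have "real k \<le> 2 ^ k" using of_nat_less_two_power[of k, where 'a = real] by simp
        also have "(2::real) ^ k \<le> (2 ^ k)\<^sup>2" by (simp add: power2_eq_square)
        finally show "real k \<le> (2 ^ k)\<^sup>2" .
      qed simp
      then have "sqrt (real k) * \<bar>charlier g n j\<bar> \<le> 2 ^ k * (C * (\<rho> / 2) ^ j)"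
        by (intro mult_mono C) auto
      also have "\<dots> = C * (2 / \<rho>) * \<rho> ^ k"
        using Suc Suc.prems by (simp add: power_divide)
      finally show ?thesis using Suc by (simp add: abs_mult)
    qed (use C Suc.prems in simp)
    have 2: "\<bar>g * charlier g n k\<bar> \<le> C * \<bar>g\<bar> * \<rho> ^ k"
      using mult_left_mono[OF order_trans[OF C(2)[of k] p], of "\<bar>g\<bar>"] by (simp add: abs_mult mult_ac)
    have "\<bar>charlier g (Suc n) k\<bar> \<le> \<bar>sqrt (real (Suc n)) * charlier g (Suc n) k\<bar>"
      by (simp add: abs_mult mult_le_cancel_right1)
    also have "\<dots> \<le> C * (2 / \<rho> + \<bar>g\<bar>) * \<rho> ^ k"
      unfolding charlier_raise using 1 2 by (simp add: algebra_simps del: mult_eq_0_iff)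
    finally show "\<bar>charlier g (Suc n) k\<bar> \<le> C * (2 / \<rho> + \<bar>g\<bar>) * \<rho> ^ k" .
  qed (use C Suc.prems in simp)
qed

lemma sq_summable_charlier: "sq_summable (charlier g n)"
proof -
  obtain C where C: "\<And>k. \<bar>charlier g n k\<bar> \<le> C * (1 / 2) ^ k"
    using charlier_decay[of "1 / 2" g n] by auto
  have "summable (\<lambda>k. ((1 / 4) :: real) ^ k)" by (rule summable_geometric) simp
  then have "sq_summable (\<lambda>k. (1 / 2 :: real) ^ k)"
    by (simp add: sq_summable_def power2_eq_square power_mult_distrib[symmetric])
  then show ?thesis by (rule sq_summable_mono[where C = C]) (use C in simp)
qed

section \<open>Orthonormality and completeness of the Charlier functions\<close>

definition psi :: "real \<Rightarrow> nat \<Rightarrow> real ell2" where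
  "psi g n = Abs_ell2 (charlier g n)"

lemma coord_psi [simp]: "coord (psi g n) = charlier g n"
  by (simp add: psi_def sq_summable_charlier)

lemma inner_real_ell2: "x \<bullet> y = (\<Sum>k. coord x k * coord y k)" for x y :: "real ell2"
  by (simp add: inner_ell2_def)

lemma summable_real_ell2: "summable (\<lambda>k. coord x k * coord y k)" for x y :: "real ell2"
  using ell2_inner_summable[of x y] by simp

lemma jac_symmetric_real:
  fixes x y x' y' :: "real ell2"
  assumes g: "g \<noteq> 0" and x: "\<And>k. jrow (jac_off g) e (coord x) k = coord x' k"
    and y: "\<And>k. jrow (jac_off g) e (coord y) k = coord y' k"
  shows "x' \<bullet> y = x \<bullet> y'"
  using jrow_symmetric[OF jac_off_nonzero[OF g] jac_off_not_summable[OF g], of "coord x" e "coord y"]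
  unfolding ext[of "jrow (jac_off g) e (coord x)" "coord x'", OF x]
    ext[of "jrow (jac_off g) e (coord y)" "coord y'", OF y]
  by (simp add: inner_real_ell2)

lemma psi_orthogonal:
  assumes g: "g \<noteq> 0" and "m \<noteq> n"
  shows "psi g m \<bullet> psi g n = 0"
proof -
  have "(real m *\<^sub>R psi g m) \<bullet> psi g n = psi g m \<bullet> (real n *\<^sub>R psi g n)"
    by (rule jac_symmetric_real[OF g, of "shifted_diag g 0"]) (simp_all add: jrow_charlier)
  then show ?thesis using assms(2) by simp
qed

text \<open>Raising and lowering are adjoint: an index shift in the series moves the creation
  operator to the other factor and turns the norm at \<open>Suc n\<close> into the norm at
  \<open>n\<close>. The base case is the exponential series.\<close>

lemma psi_norm: "psi g n \<bullet> psi g n = 1"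
proof (induction n)
  case 0
  have "(\<lambda>k. (g\<^sup>2) ^ k /\<^sub>R fact k) sums exp (g\<^sup>2)" by (rule exp_converges)
  then have "(\<lambda>k. exp (- g\<^sup>2) * ((g\<^sup>2) ^ k /\<^sub>R fact k)) sums (exp (- g\<^sup>2) * exp (g\<^sup>2))"
    by (rule sums_mult)
  moreover have "exp (- g\<^sup>2) * ((g\<^sup>2) ^ k /\<^sub>R fact k) = charlier g 0 k * charlier g 0 k" for k
  proof -
    have "charlier g 0 k * charlier g 0 k = (exp (- g\<^sup>2 / 2) * exp (- g\<^sup>2 / 2)) * ((- g) ^ k * (- g) ^ k)
        / (sqrt (fact k) * sqrt (fact k))" by simp
    also have "exp (- g\<^sup>2 / 2) * exp (- g\<^sup>2 / 2) = exp (- g\<^sup>2)"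
      unfolding exp_add[symmetric] by simp
    also have "(- g) ^ k * (- g) ^ k = (g\<^sup>2) ^ k"
      unfolding power_mult_distrib[symmetric] by (simp add: power2_eq_square)
    also have "sqrt (fact k) * sqrt (fact k) = (fact k :: real)" by simp
    finally show ?thesis by (simp only: divide_inverse real_scaleR_def mult_ac)
  qed
  ultimately have "(\<lambda>k. charlier g 0 k * charlier g 0 k) sums 1"
    by (simp add: exp_add[symmetric])
  then show ?case unfolding inner_real_ell2 coord_psi by (rule sums_unique[symmetric])
next
  case (Suc n)
  let ?a = "\<lambda>k. if k = 0 then 0 else sqrt (real k) * charlier g n (k - 1)"
  let ?c = "charlier g (Suc n)" and ?d = "charlier g n"
  have sc: "summable (\<lambda>k. charlier g i k * charlier g j k)" for i j
    using summable_real_ell2[of "psi g i" "psi g j"] by simp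
  have a: "?a k * ?c k = sqrt (real (Suc n)) * (?c k * ?c k) - g * (?d k * ?c k)" for k
    using charlier_raise[of n g k] by (metis add_diff_cancel_right' left_diff_distrib mult.assoc)
  have sa: "summable (\<lambda>k. ?a k * ?c k)"
    unfolding a by (intro summable_diff summable_mult sc)
  have "sqrt (real (Suc n)) * (psi g (Suc n) \<bullet> psi g (Suc n)) = (\<Sum>k. ?a k * ?c k) + g * (\<Sum>k. ?d k * ?c k)"
    unfolding a inner_real_ell2 coord_psi
    by (simp add: suminf_diff[symmetric] suminf_mult sc summable_mult del: of_nat_Suc)
  also have "(\<Sum>k. ?a k * ?c k) = (\<Sum>k. ?a (Suc k) * ?c (Suc k))"
    using suminf_split_head[OF sa] by simp
  also have "\<dots> + g * (\<Sum>k. ?d k * ?c k) = (\<Sum>k. ?a (Suc k) * ?c (Suc k) + g * (?d k * ?c k))"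
    unfolding suminf_mult[OF sc, symmetric] using sa
    by (intro suminf_add summable_mult sc) (subst summable_Suc_iff)
  also have "\<dots> = (\<Sum>k. sqrt (real (Suc n)) * (?d k * ?d k))"
  proof (rule arg_cong[where f = suminf], rule ext)
    fix k
    have "?a (Suc k) * ?c (Suc k) + g * (?d k * ?c k) = ?d k * (sqrt (real (Suc k)) * ?c (Suc k) + g * ?c k)"
      by (simp add: algebra_simps del: of_nat_Suc)
    then show "?a (Suc k) * ?c (Suc k) + g * (?d k * ?c k) = sqrt (real (Suc n)) * (?d k * ?d k)"
      unfolding charlier_lower by simp
  qed
  also have "\<dots> = sqrt (real (Suc n)) * (psi g n \<bullet> psi g n)"
    by (simp add: suminf_mult sc inner_real_ell2 del: of_nat_Suc)
  finally show ?case using Suc.IH by (simp del: of_nat_Suc)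
qed

lemma psi_inner: "g \<noteq> 0 \<Longrightarrow> psi g m \<bullet> psi g n = (if m = n then 1 else 0)"
  by (simp add: psi_norm psi_orthogonal)

text \<open>Self-duality of the Charlier functions; it turns orthonormality into completeness.\<close>

lemma charlier_symmetric: "charlier g n k = (-1) ^ (n + k) * charlier g k n"
proof (induction n arbitrary: k)
  case 0
  have "charlier g k 0 = exp (- g\<^sup>2 / 2) * g ^ k / sqrt (fact k)"
    by (induction k) (simp_all add: charlier.simps(2) real_sqrt_mult mult_ac)
  then show ?case by (simp add: power_minus[of g])
next
  case (Suc n)
  have "sqrt (real (Suc n)) * charlier g (Suc n) k
    = (if k = 0 then 0 else sqrt (real k) * ((-1) ^ (n + (k - 1)) * charlier g (k - 1) n))
      + g * ((-1) ^ (n + k) * charlier g k n)"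
    unfolding charlier_raise by (simp only: Suc.IH[symmetric])
  also have "\<dots> = (-1) ^ (n + k) * (g * charlier g k n - sqrt (real k) * charlier g (k - 1) n)"
    by (cases k) (simp_all add: algebra_simps)
  also have "\<dots> = sqrt (real (Suc n)) * ((-1) ^ (Suc n + k) * charlier g k (Suc n))"
    unfolding charlier_lower[symmetric] by (simp add: algebra_simps)
  finally show ?case by (rule mult_left_cancel[THEN iffD1, rotated]) simp
qed

lift_definition parity :: "real ell2 \<Rightarrow> real ell2" is "\<lambda>x k. (-1) ^ k * x k"
  by (simp add: sq_summable_def abs_mult power_mult_distrib flip: power_mult)

declare parity.rep_eq [simp]

lemma minus_one_square: "(-1::real) ^ k * ((-1) ^ k * y) = y"
  by (simp add: mult.assoc[symmetric] flip: power_add power_mult_distrib)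

lemma inner_parity: "parity x \<bullet> parity y = x \<bullet> y"
proof -
  have "(-1) ^ k * u * ((-1) ^ k * v) = u * v" for k and u v :: real
    using minus_one_square[of k "u * v"] by (simp add: mult_ac)
  from this[of _ "coord x _" "coord y _"] show ?thesis by (simp only: inner_real_ell2 parity.rep_eq)
qed

lemma norm_parity [simp]: "norm (parity x) = norm x"
  by (simp add: norm_eq_sqrt_inner[where 'a = "real ell2"] inner_parity)

lemma parity_diff: "parity (x - y) = parity x - parity y"
  by (rule ell2_eqI) (simp add: algebra_simps)

lemma parity_scaleR: "parity (c *\<^sub>R x) = c *\<^sub>R parity x"
  by (rule ell2_eqI) simp

lemma parity_sum: "parity (\<Sum>i\<in>I. f i) = (\<Sum>i\<in>I. parity (f i))"
  by (rule ell2_eqI) (simp add: coord_sum sum_distrib_left)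

lemma psi_inner_unit: "psi g n \<bullet> ell2_unit k = coord ((-1) ^ k *\<^sub>R parity (psi g k)) n"
proof -
  have "psi g n \<bullet> ell2_unit k = (\<Sum>j\<in>{k}. charlier g n j * coord (ell2_unit k) j)"
    unfolding inner_real_ell2 coord_psi by (rule suminf_finite) (auto simp: coord_unit)
  then show ?thesis
    by (simp add: coord_unit charlier_symmetric[of g n k] power_add)
qed

text \<open>By self-duality the coefficient sequence \<open>y\<close> of \<open>x\<close> is the
  same linear combination of signed Charlier functions. These are orthonormal like the unit vectors,
  so \<open>x\<close> and \<open>y\<close> have equal norms.\<close>

lemma psi_parseval_finite:
  assumes g: "g \<noteq> 0" and x: "x = (\<Sum>k<N. c k *\<^sub>R ell2_unit k)"
  shows "(\<lambda>n. (psi g n \<bullet> x)\<^sup>2) sums (norm x)\<^sup>2"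
proof -
  define y where "y = (\<Sum>k<N. c k *\<^sub>R ((-1) ^ k *\<^sub>R parity (psi g k)))"
  have c: "coord y n = psi g n \<bullet> x" for n
    unfolding y_def x inner_sum_right inner_scaleR_right psi_inner_unit by (simp add: coord_sum mult.assoc)
  have "(norm y)\<^sup>2 = (\<Sum>k<N. (norm (c k *\<^sub>R ((-1) ^ k *\<^sub>R parity (psi g k))))\<^sup>2)"
    unfolding y_def
    by (rule norm_sum_Pythagorean) (auto simp: pairwise_def orthogonal_def inner_parity psi_orthogonal[OF g])
  also have "\<dots> = (\<Sum>k<N. (c k)\<^sup>2)"
    by (simp add: norm_eq_sqrt_inner[of "psi g _"] psi_norm power_mult_distrib flip: power_mult)
  finally have y: "(norm y)\<^sup>2 = (\<Sum>k<N. (c k)\<^sup>2)" .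
  have u: "ell2_unit i \<bullet> (ell2_unit j :: real ell2) = 0" if "i \<noteq> j" for i j
  proof -
    have "(\<lambda>k. coord (ell2_unit i) k * coord (ell2_unit j) k :: real) = (\<lambda>_. 0)"
      using that by (intro ext) (simp add: coord_unit)
    then show ?thesis by (simp only: inner_real_ell2 suminf_zero)
  qed
  have "(norm x)\<^sup>2 = (\<Sum>k<N. (norm (c k *\<^sub>R ell2_unit k :: real ell2))\<^sup>2)"
    unfolding x by (rule norm_sum_Pythagorean) (auto simp: pairwise_def orthogonal_def u)
  then have "(norm x)\<^sup>2 = (norm y)\<^sup>2" using y by simp
  then show ?thesis using ell2_norm_sums[of y] by (simp add: c)
qed

text \<open>Finite sums of squared coefficients are continuous in \<open>x\<close>, so the bound
  passes from truncations to the limit. It precedes the equality because it makes the coefficient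
  map into \<open>ell2\<close> well defined and continuous.\<close>

lemma psi_bessel:
  assumes g: "g \<noteq> 0" and I: "finite I"
  shows "(\<Sum>n\<in>I. (psi g n \<bullet> x)\<^sup>2) \<le> (norm x)\<^sup>2"
proof (rule LIMSEQ_le)
  let ?S = "\<lambda>N. \<Sum>k<N. coord x k *\<^sub>R (ell2_unit k :: real ell2)"
  show "(\<lambda>N. \<Sum>n\<in>I. (psi g n \<bullet> ?S N)\<^sup>2) \<longlonglongrightarrow> (\<Sum>n\<in>I. (psi g n \<bullet> x)\<^sup>2)"
    by (intro tendsto_intros ell2_trunc_tendsto)
  show "(\<lambda>N. (norm (?S N))\<^sup>2) \<longlonglongrightarrow> (norm x)\<^sup>2"
    by (rule tendsto_power[OF tendsto_norm[OF ell2_trunc_tendsto]])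
  have "(\<Sum>n\<in>I. (psi g n \<bullet> ?S N)\<^sup>2) \<le> (norm (?S N))\<^sup>2" for N
    using psi_parseval_finite[OF g, of "?S N" "coord x" N] I
    by (metis (no_types, lifting) sum_le_suminf sums_summable sums_unique zero_le_power2)
  then show "\<exists>N. \<forall>n\<ge>N. (\<Sum>i\<in>I. (psi g i \<bullet> ?S n)\<^sup>2) \<le> (norm (?S n))\<^sup>2" by blast
qed

lemma sq_summable_psi_coeff: "g \<noteq> 0 \<Longrightarrow> sq_summable (\<lambda>n. psi g n \<bullet> x)"
  unfolding sq_summable_def
  by (rule bounded_imp_summable[of _ "(norm x)\<^sup>2"]) (simp_all add: psi_bessel)

text \<open>The coefficient map \<open>U\<close> is bounded by Bessel's inequality and isometric on
  truncations, which approximate every vector; hence it is isometric.\<close>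

lemma psi_parseval:
  assumes g: "g \<noteq> 0"
  shows "(\<lambda>n. (psi g n \<bullet> x)\<^sup>2) sums (norm x)\<^sup>2"
proof -
  define U where "U x = Abs_ell2 (\<lambda>n. psi g n \<bullet> x)" for x
  have cU: "coord (U x) n = psi g n \<bullet> x" for x n
    unfolding U_def by (simp add: sq_summable_psi_coeff[OF g])
  have nU: "norm (U x) \<le> norm x" for x
    by (rule norm_ell2_le) (simp_all add: cU psi_bessel[OF g])
  have "bounded_linear U"
  proof (rule bounded_linear_intro[of _ 1])
    show "U (x + y) = U x + U y" for x y by (rule ell2_eqI) (simp add: cU inner_add_right)
    show "U (r *\<^sub>R x) = r *\<^sub>R U x" for r x by (rule ell2_eqI) (simp add: cU)
  qed (simp add: nU)
  let ?S = "\<lambda>N. \<Sum>k<N. coord x k *\<^sub>R (ell2_unit k :: real ell2)"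
  have "(\<lambda>N. norm (U (?S N))) \<longlonglongrightarrow> norm (U x)"
    by (intro tendsto_norm bounded_linear.tendsto[OF \<open>bounded_linear U\<close>] ell2_trunc_tendsto)
  moreover have "norm (U (?S N)) = norm (?S N)" for N
  proof -
    have "(norm (U (?S N)))\<^sup>2 = (norm (?S N))\<^sup>2"
      using psi_parseval_finite[OF g refl, where c = "coord x" and N = N] ell2_norm_sums[of "U (?S N)"]
      by (intro sums_unique2[of "\<lambda>n. (psi g n \<bullet> ?S N)\<^sup>2"]) (simp_all add: cU)
    then show ?thesis by (rule power2_eq_imp_eq) auto
  qed
  moreover have "(\<lambda>N. norm (?S N)) \<longlonglongrightarrow> norm x"
    by (intro tendsto_norm ell2_trunc_tendsto)
  ultimately have "norm (U x) = norm x" using LIMSEQ_unique by auto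
  then show ?thesis using ell2_norm_sums[of "U x"] by (simp add: cU)
qed

section \<open>Parity in the eigenbasis of the displaced oscillator\<close>

text \<open>Conjugating a displacement by parity inverts it, so these entries involve the
  displacement twice: up to signs alternating in \<open>m\<close>, the recurrence below is that of
  the Charlier functions with parameter \<open>2 * g\<close>.\<close>

definition pmat :: "real \<Rightarrow> nat \<Rightarrow> nat \<Rightarrow> real" where
  "pmat g m n = psi g m \<bullet> parity (psi g n)"

lemma sum_pmat_le: "g \<noteq> 0 \<Longrightarrow> finite I \<Longrightarrow> (\<Sum>m\<in>I. (pmat g m n)\<^sup>2) \<le> 1"
  using psi_bessel[of g I "parity (psi g n)"]
  by (simp add: pmat_def norm_eq_sqrt_inner[of "psi g n"] psi_norm)

text \<open>Conjugation by parity turns \<open>g\<close> into \<open>-g\<close>, that is, it maps \<open>A\<close> to twice its diagonal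
  minus \<open>A\<close>, and the number operator is tridiagonal in the basis \<open>psi\<close>.\<close>

lemma pmat_recurrence:
  assumes g: "g \<noteq> 0"
  shows "(real m - real n + 4 * g\<^sup>2) * pmat g m n
    = 2 * g * (sqrt (real m) * pmat g (m - 1) n + sqrt (real (Suc m)) * pmat g (Suc m) n)"
proof -
  define numop where "numop m = (real m + g\<^sup>2) *\<^sub>R psi g m
    - g *\<^sub>R (sqrt (real m) *\<^sub>R psi g (m - 1) + sqrt (real (Suc m)) *\<^sub>R psi g (Suc m))" for m
  have N: "coord (numop m) k = real k * charlier g m k" for m k
    unfolding numop_def by (simp add: charlier_number[of k] del: of_nat_Suc)
  \<comment> \<open>The image of \<open>parity (psi g n)\<close> under the unperturbed matrix: twice
    the diagonal, which is the number operator plus \<open>g\<^sup>2\<close>, minus the eigenvalue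
    \<open>n\<close>.\<close>
  define y where "y = 2 *\<^sub>R parity (numop n) + (2 * g\<^sup>2 - real n) *\<^sub>R parity (psi g n)"
  have "jrow (jac_off g) (shifted_diag g 0) (coord (parity (psi g n))) k = coord y k" for k
  proof -
    have "jrow (jac_off g) (shifted_diag g 0) (\<lambda>k. (-1) ^ k * charlier g n k) k
        = (-1) ^ k * (2 * (real k + g\<^sup>2) * charlier g n k
          - jrow (jac_off g) (shifted_diag g 0) (charlier g n) k)"
      by (cases k) (simp_all add: jrow_def shifted_diag_def algebra_simps)
    then show ?thesis
      by (simp add: jrow_charlier y_def N algebra_simps)
  qed
  then have "(real m *\<^sub>R psi g m) \<bullet> parity (psi g n) = psi g m \<bullet> y"
    by (intro jac_symmetric_real[OF g, of "shifted_diag g 0"]) (simp_all add: jrow_charlier)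
  \<comment> \<open>The number operator commutes with parity, so it may act on the left factor,
    where it shifts the index \<open>m\<close>.\<close>
  moreover have "psi g m \<bullet> parity (numop n) = numop m \<bullet> parity (psi g n)"
    by (simp add: inner_real_ell2 N mult_ac)
  ultimately have "real m * pmat g m n = 2 * (numop m \<bullet> parity (psi g n)) + (2 * g\<^sup>2 - real n) * pmat g m n"
    by (simp add: y_def inner_add_right pmat_def)
  then show ?thesis
    unfolding numop_def by (simp add: inner_add_left inner_diff_left pmat_def[symmetric] algebra_simps)
qed

text \<open>The recurrence reads \<open>u = \<alpha> * v - r * w\<close> with
  \<open>\<bar>\<alpha>\<bar> = a\<close> and \<open>r\<^sup>2 = 1 + 1 / m\<close>. Squaring, with
  the cross term bounded by means of \<open>r \<le> 2\<close>, shows that the energy grows to the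
  left only by terms in \<open>a\<close> and \<open>1 / m\<close>, which are small near the
  diagonal.\<close>

lemma pmat_energy_step:
  fixes m n :: nat
  assumes g: "g \<noteq> 0" and m: "1 \<le> m"
  defines "a \<equiv> \<bar>real m - real n + 4 * g\<^sup>2\<bar> / (2 * \<bar>g\<bar> * sqrt (real m))"
  shows "(pmat g (m - 1) n)\<^sup>2 + (pmat g m n)\<^sup>2
    \<le> (1 + 1 / real m + a\<^sup>2 + 2 * a) * ((pmat g m n)\<^sup>2 + (pmat g (Suc m) n)\<^sup>2)"
proof -
  define u v w where "u = pmat g (m - 1) n" and "v = pmat g m n" and "w = pmat g (Suc m) n"
  define \<alpha> where "\<alpha> = (real m - real n + 4 * g\<^sup>2) / (2 * g * sqrt (real m))"
  define r where "r = sqrt (real (Suc m)) / sqrt (real m)"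
  have m0: "sqrt (real m) > 0" using m by simp
  have u: "u = \<alpha> * v - r * w"
    using pmat_recurrence[OF g, of m n] g m0
    unfolding u_def v_def w_def \<alpha>_def r_def by (simp add: field_simps del: of_nat_Suc)
  have \<alpha>: "\<bar>\<alpha>\<bar> = a" unfolding \<alpha>_def a_def by (simp add: abs_mult)
  have r2: "r\<^sup>2 = 1 + 1 / real m"
    using m unfolding r_def by (simp add: power_divide field_simps)
  have r0: "r \<ge> 0" by (simp add: r_def)
  have "r\<^sup>2 \<le> 2\<^sup>2" using m by (simp add: r2 field_simps)
  then have r: "r \<le> 2" by (rule power2_le_imp_le) simp
  have a0: "0 \<le> a" unfolding \<alpha>[symmetric] by simp
  have "- (2 * (\<alpha> * v) * (r * w)) \<le> 2 * a * r * (\<bar>v\<bar> * \<bar>w\<bar>)"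
  proof -
    have "- (2 * (\<alpha> * v) * (r * w)) \<le> \<bar>2 * (\<alpha> * v) * (r * w)\<bar>" by (rule abs_ge_minus_self)
    also have "\<dots> = 2 * a * r * (\<bar>v\<bar> * \<bar>w\<bar>)" using r0 by (simp add: abs_mult \<alpha>)
    finally show ?thesis .
  qed
  also have "\<dots> \<le> a * r * (v\<^sup>2 + w\<^sup>2)"
    using mult_left_mono[OF sum_squares_bound[of "\<bar>v\<bar>" "\<bar>w\<bar>"], of "a * r"] a0 r0
    by (simp add: algebra_simps)
  also have "\<dots> \<le> a * 2 * (v\<^sup>2 + w\<^sup>2)"
    using a0 r by (intro mult_right_mono mult_left_mono) auto
  finally have "u\<^sup>2 \<le> a\<^sup>2 * v\<^sup>2 + 2 * a * (v\<^sup>2 + w\<^sup>2) + (1 + 1 / real m) * w\<^sup>2"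
    unfolding u r2[symmetric] \<alpha>[symmetric] by (simp add: power2_diff power_mult_distrib mult_ac)
  moreover have "0 \<le> a\<^sup>2 * w\<^sup>2" "0 \<le> v\<^sup>2 / real m" by simp_all
  moreover have "(1 + 1 / real m + a\<^sup>2 + 2 * a) * (v\<^sup>2 + w\<^sup>2) =
      (a\<^sup>2 * v\<^sup>2 + 2 * a * (v\<^sup>2 + w\<^sup>2) + (1 + 1 / real m) * w\<^sup>2) + v\<^sup>2 + a\<^sup>2 * w\<^sup>2 + v\<^sup>2 / real m"
    by (simp add: algebra_simps)
  ultimately show ?thesis
    unfolding u_def[symmetric] v_def[symmetric] w_def[symmetric] by linarith
qed

text \<open>The energy \<open>u\<^sub>m\<^sup>2 + u\<^sub>m\<^sub>+\<^sub>1\<^sup>2\<close> of a column of \<open>pmat\<close> varies only by a bounded factor over a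
  stretch of length \<open>n powr (1/4)\<close>, while the column is normalized.\<close>

lemma pmat_decay:
  assumes g: "g \<noteq> 0"
  shows "\<exists>C\<ge>0. \<forall>J\<ge>2. \<forall>m n. J ^ 4 \<le> n \<longrightarrow> \<bar>real m - real n\<bar> \<le> real J \<longrightarrow>
     (pmat g m n)\<^sup>2 \<le> C / real J"
proof -
  \<comment> \<open>For \<open>\<bar>i - n\<bar> \<le> 2 * J\<close> and
    \<open>sqrt i \<ge> J\<^sup>2 / 2\<close> the coefficient in the energy step is at most
    \<open>A / J\<close>. Then \<open>c / J\<close> collects the terms
    \<open>1 / i \<le> 2 / J\<close>, \<open>a\<^sup>2\<close> and \<open>2 * a\<close> of that
    step.\<close>
  define A where "A = (2 + 4 * g\<^sup>2) / \<bar>g\<bar>"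
  define c where "c = 2 + A\<^sup>2 + 2 * A"
  have A0: "0 \<le> A" using g by (simp add: A_def)
  have c0: "0 \<le> c" using A0 by (simp add: c_def)
  have "(pmat g m n)\<^sup>2 \<le> 2 * exp c / real J"
    if J: "2 \<le> J" and n: "J ^ 4 \<le> n" and mn: "\<bar>real m - real n\<bar> \<le> real J" for J m n :: nat
  proof -
    define E where "E i = (pmat g i n)\<^sup>2 + (pmat g (Suc i) n)\<^sup>2" for i
    have E0: "0 \<le> E i" for i by (simp add: E_def)
    have J1: "real J \<ge> 2" using J by simp
    have J4: "2 * real J \<le> real J ^ 4"
    proof -
      have "2 * real J \<le> 2 ^ 3 * real J" by simp
      also have "\<dots> \<le> real J ^ 3 * real J" using J1 by (intro mult_right_mono power_mono) auto
      finally show ?thesis by (simp add: power_numeral_reduce mult_ac)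
    qed
    have n': "real J ^ 4 \<le> real n" using n by (metis of_nat_le_iff of_nat_power)
    \<comment> \<open>Here \<open>J ^ 4 \<le> n\<close> is used: it makes \<open>sqrt i\<close> at
      least of order \<open>J\<^sup>2\<close>, so that \<open>J\<close> steps together multiply the
      energy by at most \<open>exp c\<close>.\<close>
    have step: "E (i - 1) \<le> (1 + c / real J) * E i" if i: "m + 1 \<le> i" "i \<le> m + J" for i
    proof -
      have i1: "1 \<le> i" using i by simp
      have di: "\<bar>real i - real n\<bar> \<le> 2 * real J" using i mn by linarith
      have "real i \<ge> real n - real J" using i mn by linarith
      then have ri: "real J ^ 4 / 2 \<le> real i" using J4 n' by linarith
      have "((real J)\<^sup>2 / 2)\<^sup>2 = real J ^ 4 / 4"
        by (simp add: power_divide flip: power_mult)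
      also have "\<dots> \<le> real i"
        using ri zero_le_power[of "real J" 4] by simp
      finally have "((real J)\<^sup>2 / 2)\<^sup>2 \<le> real i" .
      then have sq: "(real J)\<^sup>2 / 2 \<le> sqrt (real i)" by (rule real_le_rsqrt)
      define a where "a = \<bar>real i - real n + 4 * g\<^sup>2\<bar> / (2 * \<bar>g\<bar> * sqrt (real i))"
      have a0: "0 \<le> a" by (simp add: a_def)
      have "a \<le> ((2 + 4 * g\<^sup>2) * real J) / (2 * \<bar>g\<bar> * ((real J)\<^sup>2 / 2))"
        unfolding a_def
      proof (rule frac_le)
        have "4 * g\<^sup>2 * 1 \<le> 4 * g\<^sup>2 * real J" using J1 by (intro mult_left_mono) auto
        moreover have "0 \<le> 4 * g\<^sup>2" by simp
        ultimately have "\<bar>real i - real n + 4 * g\<^sup>2\<bar> \<le> 2 * real J + 4 * g\<^sup>2 * real J"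
          using di by linarith
        then show "\<bar>real i - real n + 4 * g\<^sup>2\<bar> \<le> (2 + 4 * g\<^sup>2) * real J"
          by (simp add: algebra_simps)
        show "2 * \<bar>g\<bar> * ((real J)\<^sup>2 / 2) \<le> 2 * \<bar>g\<bar> * sqrt (real i)"
          using sq by (intro mult_left_mono) auto
      qed (use g J1 in auto)
      also have "\<dots> = A / real J" using g J1 by (simp add: A_def power2_eq_square field_simps)
      finally have a: "a \<le> A / real J" .
      have "a\<^sup>2 \<le> (A / real J)\<^sup>2" using a a0 by (rule power_mono)
      also have "\<dots> = A\<^sup>2 / real J / real J" by (simp add: power_divide power2_eq_square)
      also have "\<dots> \<le> A\<^sup>2 / real J / 1" using J1 by (intro divide_left_mono) auto
      finally have a2: "a\<^sup>2 \<le> A\<^sup>2 / real J" by simp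
      have "real J / 2 \<le> real i" using ri J4 by linarith
      then have "1 / real i \<le> 2 / real J" using J1 i1 by (simp add: field_simps)
      then have "1 + 1 / real i + a\<^sup>2 + 2 * a \<le> 1 + c / real J"
        using a a2 by (simp add: c_def add_divide_distrib)
      moreover have "E (i - 1) \<le> (1 + 1 / real i + a\<^sup>2 + 2 * a) * E i"
        using pmat_energy_step[OF g i1, of n] i1 by (simp add: E_def a_def)
      ultimately show ?thesis using mult_right_mono[OF _ E0[of i]] by (meson order_trans)
    qed
    have iter: "E m \<le> (1 + c / real J) ^ j * E (m + j)" if "j \<le> J" for j
      using that
    proof (induction j)
      case (Suc j)
      have "E m \<le> (1 + c / real J) ^ j * E (m + j)" using Suc by simp
      also have "\<dots> \<le> (1 + c / real J) ^ j * ((1 + c / real J) * E (m + Suc j))"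
        using step[of "m + Suc j"] Suc.prems c0 by (intro mult_left_mono) auto
      finally show ?case by (simp add: mult_ac)
    qed simp
    have pw: "(1 + c / real J) ^ j \<le> exp c" if "j \<le> J" for j
    proof -
      have "(1 + c / real J) ^ j \<le> exp (c / real J) ^ j"
        using c0 by (intro power_mono exp_ge_add_one_self) auto
      also have "\<dots> = exp (real j * (c / real J))" by (rule exp_of_nat_mult[symmetric])
      also have "\<dots> \<le> exp c" using that J1 c0 by (simp add: field_simps mult_left_mono)
      finally show ?thesis .
    qed
    \<comment> \<open>Averaging: \<open>E m\<close> is compared with the \<open>J\<close> energies
      from \<open>m\<close> on, whose total is at most 2 by the normalization of the column.\<close>
    have "real J * E m = (\<Sum>j<J. E m)" by simp
    also have "\<dots> \<le> (\<Sum>j<J. exp c * E (m + j))"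
    proof (rule sum_mono)
      fix j assume "j \<in> {..<J}"
      then show "E m \<le> exp c * E (m + j)"
        using iter[of j] mult_right_mono[OF pw E0, of j "m + j"] by auto
    qed
    also have "\<dots> = exp c * ((\<Sum>j<J. (pmat g (m + j) n)\<^sup>2) + (\<Sum>j<J. (pmat g (Suc (m + j)) n)\<^sup>2))"
      by (simp only: E_def sum.distrib sum_distrib_left[symmetric])
    also have "\<dots> \<le> exp c * (1 + 1)"
    proof (intro mult_left_mono add_mono)
      show "(\<Sum>j<J. (pmat g (m + j) n)\<^sup>2) \<le> 1"
        using sum_pmat_le[OF g, of "(\<lambda>j. m + j) ` {..<J}" n] by (simp add: sum.reindex)
      show "(\<Sum>j<J. (pmat g (Suc (m + j)) n)\<^sup>2) \<le> 1"
        using sum_pmat_le[OF g, of "(\<lambda>j. Suc (m + j)) ` {..<J}" n] by (simp add: sum.reindex inj_on_def)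
    qed simp
    finally have "E m \<le> 2 * exp c / real J" using J1 by (simp add: field_simps)
    moreover have "(pmat g m n)\<^sup>2 \<le> E m" by (simp add: E_def)
    ultimately show ?thesis by linarith
  qed
  then show ?thesis by (intro exI[of _ "2 * exp c"]) auto
qed

section \<open>Localization of the eigenvalues\<close>

lemma eigval_psi_coeff:
  assumes g: "g \<noteq> 0" and x: "\<And>k. jrow (jac_off g) (shifted_diag g s) (coord x) k = \<nu> * coord x k"
  shows "(real m - \<nu>) * (psi g m \<bullet> x) = - s * (psi g m \<bullet> parity x)"
proof -
  have "jrow (jac_off g) (shifted_diag g 0) (coord x) k = coord (\<nu> *\<^sub>R x - s *\<^sub>R parity x) k" for k
    using x[of k] by (simp add: jrow_def shifted_diag_def algebra_simps)
  then have "(real m *\<^sub>R psi g m) \<bullet> x = psi g m \<bullet> (\<nu> *\<^sub>R x - s *\<^sub>R parity x)"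
    by (intro jac_symmetric_real[OF g, of "shifted_diag g 0"]) (simp_all add: jrow_charlier)
  then show ?thesis by (simp add: inner_diff_right algebra_simps)
qed

lemma shifted_eigvals_0:
  assumes g: "g \<noteq> 0"
  shows "shifted_eigvals g 0 = range real"
proof
  show "range real \<subseteq> shifted_eigvals g 0"
  proof clarify
    fix n
    have "psi g n \<noteq> 0" using psi_norm[of g n] by auto
    then show "real n \<in> shifted_eigvals g 0"
      unfolding shifted_eigvals_def using jrow_charlier by force
  qed
  show "shifted_eigvals g 0 \<subseteq> range real"
  proof
    fix \<nu> assume "\<nu> \<in> shifted_eigvals g 0"
    then obtain x where x: "x \<noteq> 0" "\<And>k. jrow (jac_off g) (shifted_diag g 0) (coord x) k = \<nu> * coord x k"
      unfolding shifted_eigvals_def by blast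
    have "\<exists>m. psi g m \<bullet> x \<noteq> 0"
    proof (rule ccontr)
      assume "\<nexists>m. psi g m \<bullet> x \<noteq> 0"
      then have "(norm x)\<^sup>2 = 0" using sums_unique[OF psi_parseval[OF g, of x]] by simp
      with x(1) show False by simp
    qed
    then obtain m where "psi g m \<bullet> x \<noteq> 0" ..
    then have "\<nu> = real m" using eigval_psi_coeff[OF g x(2), of m] by simp
    then show "\<nu> \<in> range real" by simp
  qed
qed

text \<open>Below this bound every \<open>\<bar>real m - \<nu>\<bar>\<close> exceeds
  \<open>\<bar>s\<bar> + 1\<close>, while parity preserves the norm, so the coefficient equation
  contradicts Parseval. The bound lets eigenvalues on a half line be counted on a compact
  interval.\<close>

lemma shifted_eigvals_lower:
  assumes g: "g \<noteq> 0" and "\<nu> \<in> shifted_eigvals g s"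
  shows "- \<bar>s\<bar> - 1 \<le> \<nu>"
proof (rule ccontr)
  assume less: "\<not> - \<bar>s\<bar> - 1 \<le> \<nu>"
  obtain x where x: "x \<noteq> 0" "\<And>k. jrow (jac_off g) (shifted_diag g s) (coord x) k = \<nu> * coord x k"
    using assms(2) unfolding shifted_eigvals_def by blast
  have "(\<bar>s\<bar> + 1)\<^sup>2 * (psi g m \<bullet> x)\<^sup>2 \<le> s\<^sup>2 * (psi g m \<bullet> parity x)\<^sup>2" for m
  proof -
    have "(\<bar>s\<bar> + 1)\<^sup>2 \<le> (real m - \<nu>)\<^sup>2" using less by (intro power_mono) auto
    then have "(\<bar>s\<bar> + 1)\<^sup>2 * (psi g m \<bullet> x)\<^sup>2 \<le> ((real m - \<nu>) * (psi g m \<bullet> x))\<^sup>2"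
      by (simp add: power_mult_distrib mult_right_mono)
    also have "\<dots> = s\<^sup>2 * (psi g m \<bullet> parity x)\<^sup>2"
      unfolding eigval_psi_coeff[OF g x(2)] by (simp add: power_mult_distrib)
    finally show ?thesis .
  qed
  then have "(\<bar>s\<bar> + 1)\<^sup>2 * (norm x)\<^sup>2 \<le> s\<^sup>2 * (norm (parity x))\<^sup>2"
    by (rule sums_le[OF _ sums_mult[OF psi_parseval[OF g]] sums_mult[OF psi_parseval[OF g]]])
  then have "(\<bar>s\<bar> + 1)\<^sup>2 \<le> \<bar>s\<bar>\<^sup>2" using x(1) by simp
  then show False by (simp add: power2_sum)
qed

lemma sum_inverse_squares_le: "(\<Sum>j=1..k. 1 / (real j)\<^sup>2) \<le> 2"
proof -
  have "(\<Sum>j=1..k. 1 / (real j)\<^sup>2) \<le> 2 - 1 / real k" if "1 \<le> k"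
    using that
  proof (induction k rule: dec_induct)
    case (step k)
    have "1 / (real (Suc k))\<^sup>2 \<le> 1 / (real k * real (Suc k))"
      using step.hyps by (intro divide_left_mono) (auto simp: power2_eq_square)
    also have "\<dots> = 1 / real k - 1 / real (Suc k)"
      using step.hyps by (simp add: field_simps)
    finally show ?case using step.IH by simp
  qed simp
  then show ?thesis by (cases "1 \<le> k") (auto intro: order_trans)
qed

lemma sum_inverse_square_dist_le:
  assumes "finite I"
  shows "(\<Sum>m\<in>I - {n}. 1 / (real m - real n)\<^sup>2) \<le> 4"
proof -
  let ?f = "\<lambda>m. 1 / (real m - real n)\<^sup>2"
  define K where "K = Max (insert 0 I) + n"
  have IK: "m \<le> K" if "m \<in> I" for m
    unfolding K_def using that assms by (intro trans_le_add1 Max_ge) auto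
  have up: "(\<Sum>m\<in>{m\<in>I. n < m}. ?f m) \<le> 2"
  proof -
    have "(\<Sum>m\<in>{m\<in>I. n < m}. ?f m) = (\<Sum>j\<in>(\<lambda>m. m - n) ` {m\<in>I. n < m}. 1 / (real j)\<^sup>2)"
      by (subst sum.reindex) (auto simp: inj_on_def of_nat_diff)
    also have "\<dots> \<le> (\<Sum>j=1..K. 1 / (real j)\<^sup>2)"
    proof (rule sum_mono2)
      show "(\<lambda>m. m - n) ` {m \<in> I. n < m} \<subseteq> {1..K}"
        using IK by (auto simp: Suc_le_eq) (meson diff_le_self le_trans)
    qed auto
    also have "\<dots> \<le> 2" by (rule sum_inverse_squares_le)
    finally show ?thesis .
  qed
  have lo: "(\<Sum>m\<in>{m\<in>I. m < n}. ?f m) \<le> 2"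
  proof -
    have "(\<Sum>m\<in>{m\<in>I. m < n}. ?f m) = (\<Sum>j\<in>(\<lambda>m. n - m) ` {m\<in>I. m < n}. 1 / (real j)\<^sup>2)"
      by (subst sum.reindex) (auto simp: inj_on_def of_nat_diff power2_commute)
    also have "\<dots> \<le> (\<Sum>j=1..K. 1 / (real j)\<^sup>2)"
      by (rule sum_mono2) (auto simp: K_def)
    also have "\<dots> \<le> 2" by (rule sum_inverse_squares_le)
    finally show ?thesis .
  qed
  have "I - {n} = {m\<in>I. m < n} \<union> {m\<in>I. n < m}" by auto
  then have "(\<Sum>m\<in>I - {n}. ?f m) = (\<Sum>m\<in>{m\<in>I. m < n}. ?f m) + (\<Sum>m\<in>{m\<in>I. n < m}. ?f m)"
    using assms by (simp add: sum.union_disjoint disjoint_iff)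
  then show ?thesis using up lo by simp
qed

text \<open>With \<open>d\<close> the distance to \<open>n\<close>, the term \<open>m = n\<close>
  gives \<open>1 / d\<^sup>2\<close>. For other \<open>m\<close> the distance to \<nu> is at least
  half of that to \<open>n\<close>, so the rest is at most \<open>4 * 4\<close>, and
  \<open>16 \<le> 4 / d\<^sup>2\<close> because \<open>d \<le> 1/2\<close>.\<close>

lemma sum_inverse_square_near_le:
  fixes \<nu> :: real and n :: nat
  assumes I: "finite I" and \<nu>: "\<bar>\<nu> - real n\<bar> \<le> 1/2" "\<nu> \<noteq> real n"
  shows "(\<Sum>m\<in>I. 1 / (real m - \<nu>)\<^sup>2) \<le> 5 / (\<nu> - real n)\<^sup>2"
proof -
  let ?d = "\<nu> - real n"
  have d: "0 < ?d\<^sup>2" "?d\<^sup>2 \<le> 1/4"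
    using \<nu> power_mono[OF \<nu>(1), of 2] by (auto simp: power_divide)
  have "1 / (real m - \<nu>)\<^sup>2 \<le> 4 * (1 / (real m - real n)\<^sup>2)" if "m \<noteq> n" for m
  proof -
    have mn: "1 \<le> \<bar>real m - real n\<bar>" using that by linarith
    moreover have "\<bar>real m - real n\<bar> \<le> \<bar>real m - \<nu>\<bar> + \<bar>\<nu> - real n\<bar>" by simp
    ultimately have "\<bar>real m - real n\<bar> / 2 \<le> \<bar>real m - \<nu>\<bar>" using \<nu>(1) by argo
    then have "(\<bar>real m - real n\<bar> / 2)\<^sup>2 \<le> (\<bar>real m - \<nu>\<bar>)\<^sup>2" by (rule power_mono) simp
    then have le: "(real m - real n)\<^sup>2 / 4 \<le> (real m - \<nu>)\<^sup>2" by (simp add: power_divide)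
    have "1 / (real m - \<nu>)\<^sup>2 \<le> 1 / ((real m - real n)\<^sup>2 / 4)"
      using le that by (intro divide_left_mono mult_pos_pos) (auto intro: less_le_trans[OF _ le])
    then show ?thesis by simp
  qed
  then have "(\<Sum>m\<in>I - {n}. 1 / (real m - \<nu>)\<^sup>2) \<le> (\<Sum>m\<in>I - {n}. 4 * (1 / (real m - real n)\<^sup>2))"
    by (intro sum_mono) auto
  also have "\<dots> \<le> 16"
    unfolding sum_distrib_left[symmetric] using sum_inverse_square_dist_le[OF I, of n] by simp
  also have "\<dots> \<le> 4 / ?d\<^sup>2" using d by (simp add: field_simps)
  finally have 1: "(\<Sum>m\<in>I - {n}. 1 / (real m - \<nu>)\<^sup>2) \<le> 4 / ?d\<^sup>2" .
  have "(\<Sum>m\<in>I. 1 / (real m - \<nu>)\<^sup>2) \<le> (\<Sum>m\<in>insert n (I - {n}). 1 / (real m - \<nu>)\<^sup>2)"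
    using I by (intro sum_mono2) auto
  also have "\<dots> = 1 / ?d\<^sup>2 + (\<Sum>m\<in>I - {n}. 1 / (real m - \<nu>)\<^sup>2)"
    using I by (subst sum.insert) (simp_all add: power2_commute[of \<nu>])
  also have "\<dots> \<le> 1 / ?d\<^sup>2 + 4 / ?d\<^sup>2" using 1 by simp
  finally show ?thesis by (simp add: add_divide_distrib[symmetric])
qed

text \<open>The resolvent of the oscillator is small far from \<open>n\<close>, and near \<open>n\<close> the matrix of the
  perturbation is small; so an eigenvector, which is a fixed point of the squared
  Birman-Schwinger operator, forces \<open>\<nu>\<close> to be close to \<open>n\<close>.\<close>

lemma shifted_eigvals_localized:
  assumes g: "g \<noteq> 0"
  shows "\<exists>M\<ge>0. \<forall>J\<ge>2. \<forall>n \<nu> s. 2 * J ^ 4 \<le> n \<longrightarrow> \<bar>s\<bar> \<le> S \<longrightarrow> \<nu> \<in> shifted_eigvals g s \<longrightarrow>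
     \<bar>\<nu> - real n\<bar> \<le> 1/2 \<longrightarrow> \<bar>\<nu> - real n\<bar> ^ 4 * real J \<le> M"
proof -
  obtain C where C0: "C \<ge> 0" and C: "\<And>J m n. 2 \<le> J \<Longrightarrow> J ^ 4 \<le> n \<Longrightarrow> \<bar>real m - real n\<bar> \<le> real J \<Longrightarrow>
      (pmat g m n)\<^sup>2 \<le> C / real J"
    using pmat_decay[OF g] by blast
  \<comment> \<open>The summands stem from near coefficients acting on near ones
    (\<open>50 = 2 * 5 * 5\<close>, both fives from \<open>sum_inverse_square_near_le\<close>), from
    the far part acting on near ones (\<open>32 = 2 * 16\<close>), and from the far part
    itself.\<close>
  define M where "M = 50 * S ^ 4 * C + 32 * S ^ 4 + 16 * S\<^sup>2"
  have M0: "0 \<le> M" using C0 by (simp add: M_def)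
  have "\<bar>\<nu> - real n\<bar> ^ 4 * real J \<le> M"
    if J: "2 \<le> J" and n: "2 * J ^ 4 \<le> n" and s: "\<bar>s\<bar> \<le> S" and ev: "\<nu> \<in> shifted_eigvals g s"
      and \<nu>: "\<bar>\<nu> - real n\<bar> \<le> 1/2" for J n :: nat and \<nu> s :: real
  proof (cases "\<nu> = real n")
    case False
    obtain x where x0: "x \<noteq> 0"
      and x: "\<And>k. jrow (jac_off g) (shifted_diag g s) (coord x) k = \<nu> * coord x k"
      using ev unfolding shifted_eigvals_def by blast
    define h f where "h m = psi g m \<bullet> x" and "f m = psi g m \<bullet> parity x" for m
    have hf: "(real m - \<nu>) * h m = - s * f m" for m
      unfolding h_def f_def by (rule eigval_psi_coeff[OF g x])
    have hf2: "(h m)\<^sup>2 = s\<^sup>2 * (f m)\<^sup>2 / (real m - \<nu>)\<^sup>2" if "real m \<noteq> \<nu>" for m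
    proof -
      have "(real m - \<nu>)\<^sup>2 * (h m)\<^sup>2 = s\<^sup>2 * (f m)\<^sup>2"
        using hf[of m] by (metis power2_minus power_mult_distrib mult_minus_left)
      then show ?thesis using that by (simp add: field_simps)
    qed
    have ne: "real m \<noteq> \<nu>" for m
    proof (cases "m = n")
      case f: False
      then have "1 \<le> \<bar>real m - real n\<bar>" by linarith
      then show ?thesis using \<nu> by linarith
    qed (use False in simp)
    define d X where "d = \<bar>\<nu> - real n\<bar>" and "X = (norm x)\<^sup>2"
    have d0: "0 < d" and d1: "d \<le> 1/2" using \<nu> False by (auto simp: d_def)
    have dm: "d \<le> \<bar>real m - \<nu>\<bar>" for m
    proof (cases "m = n")
      case False
      then have "1 \<le> \<bar>real m - real n\<bar>" by linarith
      then show ?thesis using \<nu> unfolding d_def by linarith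
    qed (simp add: d_def abs_minus_commute)
    have X0: "0 < X" using x0 by (simp add: X_def)
    have fX: "(\<Sum>m\<in>I. (f m)\<^sup>2) \<le> X" if "finite I" for I
      unfolding f_def X_def using psi_bessel[OF g that, of "parity x"] by simp
    have J2: "2 \<le> real J" using J by simp
    \<comment> \<open>With radius \<open>J / 2\<close> two indices in \<open>N\<close> are at most
      \<open>J\<close> apart, as the decay of \<open>pmat\<close> demands; outside \<open>N\<close>
      the distance to \<nu> is still at least \<open>J / 4\<close>.\<close>
    define N where "N = {m. \<bar>real m - real n\<bar> \<le> real J / 2}"
    have "N \<subseteq> {..n + J}"
    proof
      fix m assume "m \<in> N"
      then have "real m \<le> real (n + J)" using J2 unfolding N_def mem_Collect_eq of_nat_add by linarith
      then show "m \<in> {..n + J}" by simp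
    qed
    then have finN: "finite N" by (rule finite_subset) simp
    define xN xF where "xN = (\<Sum>m\<in>N. h m *\<^sub>R psi g m)" and "xF = x - xN"
    have cN: "psi g k \<bullet> xN = (if k \<in> N then h k else 0)" for k
      using finN by (simp add: xN_def inner_sum_right psi_inner[OF g] if_distrib cong: if_cong)
    then have cF: "psi g k \<bullet> xF = (if k \<in> N then 0 else h k)" for k
      by (simp add: xF_def inner_diff_right h_def)
    have F: "(norm xF)\<^sup>2 \<le> 16 * s\<^sup>2 / (real J)\<^sup>2 * X"
    proof -
      have "(psi g k \<bullet> xF)\<^sup>2 \<le> 16 * s\<^sup>2 / (real J)\<^sup>2 * (f k)\<^sup>2" for k
      proof (cases "k \<in> N")
        case False
        then have "real J / 2 < \<bar>real k - real n\<bar>" unfolding N_def by simp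
        moreover have "\<bar>real k - real n\<bar> \<le> \<bar>real k - \<nu>\<bar> + \<bar>\<nu> - real n\<bar>" by simp
        ultimately have "real J / 4 \<le> \<bar>real k - \<nu>\<bar>" using \<nu> J2 by argo
        then have "(real J / 4)\<^sup>2 \<le> \<bar>real k - \<nu>\<bar>\<^sup>2" by (rule power_mono) simp
        then have le: "(real J)\<^sup>2 / 16 \<le> (real k - \<nu>)\<^sup>2" by (simp add: power_divide)
        have "(h k)\<^sup>2 = s\<^sup>2 * (f k)\<^sup>2 / (real k - \<nu>)\<^sup>2" by (rule hf2[OF ne])
        also have "\<dots> \<le> s\<^sup>2 * (f k)\<^sup>2 / ((real J)\<^sup>2 / 16)"
          using le J2 ne[of k] by (intro divide_left_mono mult_pos_pos) auto
        finally show ?thesis using False by (simp add: cF mult_ac)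
      qed (simp add: cF)
      from sums_le[OF this psi_parseval[OF g] sums_mult[OF psi_parseval[OF g, of "parity x", folded f_def]]]
      show ?thesis by (simp add: X_def)
    qed
    have split: "X = (\<Sum>m\<in>N. (h m)\<^sup>2) + (norm xF)\<^sup>2"
    proof -
      have "(\<lambda>k. (if k \<in> N then (h k)\<^sup>2 else 0) + (psi g k \<bullet> xF)\<^sup>2) sums ((\<Sum>m\<in>N. (h m)\<^sup>2) + (norm xF)\<^sup>2)"
        by (intro sums_add psi_parseval[OF g] sums_If_finite_set finN)
      moreover have "(if k \<in> N then (h k)\<^sup>2 else 0) + (psi g k \<bullet> xF)\<^sup>2 = (psi g k \<bullet> x)\<^sup>2" for k
        by (simp add: cF h_def)
      ultimately show ?thesis unfolding X_def using sums_unique2[OF psi_parseval[OF g, of x]] by simp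
    qed
    define W where "W = (\<Sum>m\<in>N. 1 / (real m - \<nu>)\<^sup>2)"
    have W: "W \<le> 5 / d\<^sup>2" using sum_inverse_square_near_le[OF finN \<nu> False] by (simp add: W_def d_def)
    have W0: "0 \<le> W" unfolding W_def by (intro sum_nonneg) simp
    \<comment> \<open>The near coefficients are summed without squares, since the entries of parity
      are bounded one by one. Cauchy-Schwarz against \<open>1 / (k - \<nu>)\<close> brings back the
      norm of \<open>x\<close>.\<close>
    define G where "G = (\<Sum>k\<in>N. \<bar>h k\<bar>)"
    have G: "G\<^sup>2 \<le> s\<^sup>2 * W * X"
    proof -
      have "\<bar>h k\<bar> = \<bar>s\<bar> * (\<bar>1 / (real k - \<nu>)\<bar> * \<bar>f k\<bar>)" for k
      proof -
        have "\<bar>real k - \<nu>\<bar> * \<bar>h k\<bar> = \<bar>s\<bar> * \<bar>f k\<bar>" using hf[of k] by (metis abs_minus_cancel abs_mult mult_minus_left)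
        then show ?thesis using ne[of k] by (simp add: field_simps)
      qed
      then have "G = \<bar>s\<bar> * (\<Sum>k\<in>N. \<bar>1 / (real k - \<nu>)\<bar> * \<bar>f k\<bar>)"
        unfolding G_def by (simp add: sum_distrib_left)
      then have "G\<^sup>2 = s\<^sup>2 * (\<Sum>k\<in>N. \<bar>1 / (real k - \<nu>)\<bar> * \<bar>f k\<bar>)\<^sup>2" by (simp add: power_mult_distrib)
      also have "\<dots> \<le> s\<^sup>2 * ((\<Sum>k\<in>N. \<bar>1 / (real k - \<nu>)\<bar>\<^sup>2) * (\<Sum>k\<in>N. \<bar>f k\<bar>\<^sup>2))"
        by (intro mult_left_mono Cauchy_Schwarz_ineq_sum) simp
      also have "\<dots> = s\<^sup>2 * (W * (\<Sum>k\<in>N. (f k)\<^sup>2))" by (simp add: W_def power_divide)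
      also have "\<dots> \<le> s\<^sup>2 * (W * X)" using fX[OF finN] W0 by (intro mult_left_mono) auto
      finally show ?thesis by (simp add: mult.assoc)
    qed
    define r where "r m = psi g m \<bullet> parity xF" for m
    have r: "(\<Sum>m\<in>N. (r m)\<^sup>2) \<le> (norm xF)\<^sup>2"
      unfolding r_def using psi_bessel[OF g finN, of "parity xF"] by simp
    \<comment> \<open>Through \<open>G\<close> this bound on \<open>f\<close> already contains the
      resolvent once. Passing from \<open>f\<close> to \<open>h\<close> below applies it again,
      which completes the square of the Birman-Schwinger operator.\<close>
    have fm: "(f m)\<^sup>2 \<le> 2 * (C / real J * G\<^sup>2) + 2 * (r m)\<^sup>2" if m: "m \<in> N" for m
    proof -
      have "x = xN + xF" by (simp add: xF_def)
      then have "f m = psi g m \<bullet> parity xN + r m"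
        unfolding f_def r_def by (metis add_diff_cancel_right' diff_add_cancel inner_add_right parity_diff)
      then have fe: "f m = (\<Sum>k\<in>N. h k * pmat g m k) + r m"
        by (simp add: xN_def parity_sum parity_scaleR inner_sum_right pmat_def)
      have "\<bar>\<Sum>k\<in>N. h k * pmat g m k\<bar> \<le> (\<Sum>k\<in>N. \<bar>h k\<bar> * sqrt (C / real J))"
      proof (rule order_trans[OF sum_abs sum_mono])
        fix k assume k: "k \<in> N"
        have mk: "\<bar>real m - real k\<bar> \<le> real J"
          using m k abs_triangle_ineq4[of "real m - real n" "real k - real n"] by (simp add: N_def)
        have "J ^ 4 \<le> k"
        proof -
          have "real J * 1 \<le> real J * real J ^ 3"
            using J2 by (intro mult_left_mono one_le_power) auto
          then have "real J \<le> real J ^ 4" by (simp add: power_numeral_reduce)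
          moreover have "2 * real J ^ 4 \<le> real n" using n by (metis of_nat_le_iff of_nat_mult of_nat_numeral of_nat_power)
          moreover have "real n - real J / 2 \<le> real k"
            using k abs_le_D2[of "real k - real n" "real J / 2"] by (simp add: N_def)
          ultimately have "real J ^ 4 \<le> real k" using J2 by linarith
          then show ?thesis by (metis of_nat_le_iff of_nat_power)
        qed
        from C[OF J this mk] have "sqrt ((pmat g m k)\<^sup>2) \<le> sqrt (C / real J)" by (rule real_sqrt_le_mono)
        then show "\<bar>h k * pmat g m k\<bar> \<le> \<bar>h k\<bar> * sqrt (C / real J)"
          by (simp add: abs_mult mult_left_mono)
      qed
      also have "\<dots> = G * sqrt (C / real J)" by (simp add: G_def sum_distrib_right)
      finally have "\<bar>\<Sum>k\<in>N. h k * pmat g m k\<bar>\<^sup>2 \<le> (G * sqrt (C / real J))\<^sup>2"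
        by (rule power_mono) simp
      also have "\<dots> = C / real J * G\<^sup>2" using C0 by (simp add: power_mult_distrib)
      finally have "(\<Sum>k\<in>N. h k * pmat g m k)\<^sup>2 \<le> C / real J * G\<^sup>2" by simp
      moreover have "(f m)\<^sup>2 \<le> 2 * (\<Sum>k\<in>N. h k * pmat g m k)\<^sup>2 + 2 * (r m)\<^sup>2"
        unfolding fe using sum_squares_bound[of "\<Sum>k\<in>N. h k * pmat g m k" "r m"] by (simp add: power2_sum)
      ultimately show ?thesis by linarith
    qed
    have "(\<Sum>m\<in>N. (h m)\<^sup>2) \<le> (\<Sum>m\<in>N. s\<^sup>2 * (2 * (C / real J * G\<^sup>2)) * (1 / (real m - \<nu>)\<^sup>2) + 2 * s\<^sup>2 / d\<^sup>2 * (r m)\<^sup>2)"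
    proof (rule sum_mono)
      fix m assume m: "m \<in> N"
      have dd: "d\<^sup>2 \<le> (real m - \<nu>)\<^sup>2" using power_mono[OF dm[of m], of 2] d0 by simp
      have "(h m)\<^sup>2 = s\<^sup>2 * (f m)\<^sup>2 / (real m - \<nu>)\<^sup>2" by (rule hf2[OF ne])
      also have "\<dots> \<le> s\<^sup>2 * (2 * (C / real J * G\<^sup>2) + 2 * (r m)\<^sup>2) / (real m - \<nu>)\<^sup>2"
        using fm[OF m] by (intro divide_right_mono mult_left_mono) auto
      also have "\<dots> = s\<^sup>2 * (2 * (C / real J * G\<^sup>2)) * (1 / (real m - \<nu>)\<^sup>2) + 2 * s\<^sup>2 * (r m)\<^sup>2 / (real m - \<nu>)\<^sup>2"
        by (simp add: distrib_left add_divide_distrib mult_ac)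
      also have "2 * s\<^sup>2 * (r m)\<^sup>2 / (real m - \<nu>)\<^sup>2 \<le> 2 * s\<^sup>2 * (r m)\<^sup>2 / d\<^sup>2"
        using dd d0 ne[of m] by (intro divide_left_mono mult_pos_pos) auto
      finally show "(h m)\<^sup>2 \<le> s\<^sup>2 * (2 * (C / real J * G\<^sup>2)) * (1 / (real m - \<nu>)\<^sup>2) + 2 * s\<^sup>2 / d\<^sup>2 * (r m)\<^sup>2"
        by simp
    qed
    also have "\<dots> = s\<^sup>2 * (2 * (C / real J * G\<^sup>2)) * W + 2 * s\<^sup>2 / d\<^sup>2 * (\<Sum>m\<in>N. (r m)\<^sup>2)"
      by (simp only: sum.distrib sum_distrib_left[symmetric] W_def)
    also have "\<dots> \<le> s\<^sup>2 * (2 * (C / real J * (s\<^sup>2 * (5 / d\<^sup>2) * X))) * (5 / d\<^sup>2)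
        + 2 * s\<^sup>2 / d\<^sup>2 * (16 * s\<^sup>2 / (real J)\<^sup>2 * X)"
    proof (intro add_mono mult_mono mult_left_mono W)
      have "s\<^sup>2 * W * X \<le> s\<^sup>2 * (5 / d\<^sup>2) * X"
        using W X0 by (intro mult_right_mono mult_left_mono) auto
      then show "G\<^sup>2 \<le> s\<^sup>2 * (5 / d\<^sup>2) * X" using G by linarith
      show "(\<Sum>m\<in>N. (r m)\<^sup>2) \<le> 16 * s\<^sup>2 / (real J)\<^sup>2 * X" using r F by linarith
    qed (use C0 W0 X0 d0 in \<open>auto intro: sum_nonneg\<close>)
    finally have "X \<le> s\<^sup>2 * (2 * (C / real J * (s\<^sup>2 * (5 / d\<^sup>2) * X))) * (5 / d\<^sup>2)
        + 2 * s\<^sup>2 / d\<^sup>2 * (16 * s\<^sup>2 / (real J)\<^sup>2 * X) + 16 * s\<^sup>2 / (real J)\<^sup>2 * X"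
      using split F by linarith
    also have "\<dots> = X * (50 * s ^ 4 * C / (real J * d ^ 4) + 32 * s ^ 4 / (d\<^sup>2 * (real J)\<^sup>2) + 16 * s\<^sup>2 / (real J)\<^sup>2)"
      by (simp add: algebra_simps power2_eq_square power4_eq_xxxx)
    finally have "1 \<le> 50 * s ^ 4 * C / (real J * d ^ 4) + 32 * s ^ 4 / (d\<^sup>2 * (real J)\<^sup>2) + 16 * s\<^sup>2 / (real J)\<^sup>2"
      using X0 by (simp add: mult_le_cancel_left1)
    \<comment> \<open>Multiplication by \<open>d ^ 4 * J\<close> isolates the leading term; the
      other two keep a power of \<open>d\<close> divided by \<open>J\<close>, which is at most
      1.\<close>
    then have "1 * (d ^ 4 * real J) \<le> (50 * s ^ 4 * C / (real J * d ^ 4) + 32 * s ^ 4 / (d\<^sup>2 * (real J)\<^sup>2)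
        + 16 * s\<^sup>2 / (real J)\<^sup>2) * (d ^ 4 * real J)"
      using d0 by (intro mult_right_mono) auto
    also have "\<dots> = 50 * s ^ 4 * C + 32 * s ^ 4 * (d\<^sup>2 / real J) + 16 * s\<^sup>2 * (d ^ 4 / real J)"
      using d0 J2 by (simp add: field_simps power2_eq_square power4_eq_xxxx)
    also have "\<dots> \<le> 50 * S ^ 4 * C + 32 * S ^ 4 * 1 + 16 * S\<^sup>2 * 1"
    proof -
      have s4: "s ^ 4 \<le> S ^ 4" "s\<^sup>2 \<le> S\<^sup>2"
        using power_mono[OF s, of 4] power_mono[OF s, of 2] by (simp_all add: power_even_abs)
      have p: "d ^ k / real J \<le> 1" for k
      proof -
        have "d ^ k \<le> 1" using d0 d1 by (intro power_le_one) auto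
        then show ?thesis using J2 by (simp add: field_simps)
      qed
      show ?thesis using s4 p C0 d0 by (intro add_mono mult_mono) auto
    qed
    finally show ?thesis by (simp add: d_def M_def)
  qed (simp add: M0)
  then show ?thesis using M0 by blast
qed

section \<open>Counting the eigenvalues by a homotopy\<close>

lemma finite_uniform_radius:
  fixes P :: "'a \<Rightarrow> real \<Rightarrow> bool"
  assumes "finite Z" "\<And>z. z \<in> Z \<Longrightarrow> \<exists>\<epsilon>>0. P z \<epsilon>"
    and mono: "\<And>z \<epsilon> \<delta>. P z \<epsilon> \<Longrightarrow> 0 < \<delta> \<Longrightarrow> \<delta> \<le> \<epsilon> \<Longrightarrow> P z \<delta>"
  shows "\<exists>\<epsilon>>0. \<forall>z\<in>Z. P z \<epsilon>"
  using assms(1,2)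
proof (induction Z rule: finite_induct)
  case empty
  show ?case by (rule exI[of _ 1]) simp
next
  case (insert z Z)
  then obtain \<epsilon> \<delta> where "\<epsilon> > 0" "\<forall>z\<in>Z. P z \<epsilon>" "\<delta> > 0" "P z \<delta>" by fastforce
  then show ?case
    by (intro exI[of _ "min \<epsilon> \<delta>"]) (auto intro: mono[where \<delta> = "min \<epsilon> \<delta>"])
qed

text \<open>A change of sign survives a small change of \<open>s\<close>, so the intermediate value
  theorem gives a zero near each old one; \<open>uniq\<close> makes it the only one there, and
  elsewhere compactness keeps \<open>F\<close> away from 0. The hypothesis \<open>uniq\<close>,
  uniform in \<open>s\<close>, together with \<open>sign\<close> takes the place of a nonvanishing
  derivative.\<close>

lemma card_zeros_locally_constant:
  fixes F :: "real \<Rightarrow> real \<Rightarrow> real"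
  assumes T: "compact T" "s\<^sub>0 \<in> T"
    and cont: "continuous_on ({a..b} \<times> T) (\<lambda>p. F (fst p) (snd p))"
    and ends: "\<And>s. s \<in> T \<Longrightarrow> F a s \<noteq> 0 \<and> F b s \<noteq> 0"
    and uniq: "\<And>x. x \<in> {a..b} \<Longrightarrow> F x s\<^sub>0 = 0 \<Longrightarrow> \<exists>\<epsilon>>0. \<forall>s\<in>T. \<bar>s - s\<^sub>0\<bar> < \<epsilon> \<longrightarrow>
        (\<forall>y\<in>{a..b}. \<forall>z\<in>{a..b}. \<bar>y - x\<bar> < \<epsilon> \<longrightarrow> \<bar>z - x\<bar> < \<epsilon> \<longrightarrow> F y s = 0 \<longrightarrow> F z s = 0 \<longrightarrow> y = z)"
    and sign: "\<And>x. x \<in> {a..b} \<Longrightarrow> F x s\<^sub>0 = 0 \<Longrightarrow>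
        \<exists>\<epsilon>>0. \<forall>\<eta>. 0 < \<eta> \<longrightarrow> \<eta> < \<epsilon> \<longrightarrow> F (x - \<eta>) s\<^sub>0 * F (x + \<eta>) s\<^sub>0 < 0"
  shows "\<exists>\<rho>>0. \<forall>s\<in>T. \<bar>s - s\<^sub>0\<bar> < \<rho> \<longrightarrow> card {x\<in>{a..b}. F x s = 0} = card {x\<in>{a..b}. F x s\<^sub>0 = 0}"
proof -
  define Z where "Z s = {x\<in>{a..b}. F x s = 0}" for s
  have cont1: "continuous_on {a..b} (\<lambda>x. F x s)" if "s \<in> T" for s
  proof -
    have "continuous_on {a..b} (\<lambda>x. (x, s))" by (intro continuous_intros)
    from continuous_on_compose2[OF cont this] that show ?thesis by auto
  qed
  \<comment> \<open>An accumulation point of zeros would be a zero, by closedness, and contradict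
    \<open>uniq\<close> at \<open>s = s\<^sub>0\<close>.\<close>
  have finZ: "finite (Z s\<^sub>0)"
  proof -
    have "finite ({a..b} \<inter> Z s\<^sub>0)"
    proof (rule finite_not_islimpt_in_compact)
      fix z assume z: "z \<in> {a..b}"
      show "\<not> z islimpt Z s\<^sub>0"
      proof
        assume lim: "z islimpt Z s\<^sub>0"
        have "closed {x\<in>{a..b}. F x s\<^sub>0 = 0}"
          using continuous_closed_preimage_constant[OF cont1[OF T(2)], of 0] by simp
        then have "F z s\<^sub>0 = 0"
          using lim unfolding Z_def closed_limpt by blast
        then obtain \<epsilon> where "\<epsilon> > 0" and \<epsilon>: "\<forall>y\<in>{a..b}. \<forall>w\<in>{a..b}. \<bar>y - z\<bar> < \<epsilon> \<longrightarrow> \<bar>w - z\<bar> < \<epsilon> \<longrightarrow>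
            F y s\<^sub>0 = 0 \<longrightarrow> F w s\<^sub>0 = 0 \<longrightarrow> y = w"
          using uniq[OF z] T(2) by auto
        obtain w where "w \<in> Z s\<^sub>0" "w \<noteq> z" "dist w z < \<epsilon>"
          using lim \<open>\<epsilon> > 0\<close> unfolding islimpt_approachable by blast
        then show False
          using \<epsilon>[rule_format, of w z] z \<open>F z s\<^sub>0 = 0\<close> \<open>\<epsilon> > 0\<close> by (auto simp: Z_def dist_real_def)
      qed
    qed simp
    moreover have "{a..b} \<inter> Z s\<^sub>0 = Z s\<^sub>0" by (auto simp: Z_def)
    ultimately show ?thesis by simp
  qed
  \<comment> \<open>The separation \<open>2 * \<epsilon>\<close> makes the neighbourhoods of
    distinct zeros disjoint. Every condition passes to smaller radii, so finitely many zeros admit a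
    common one.\<close>
  define P where "P x \<epsilon> \<longleftrightarrow> a \<le> x - \<epsilon> \<and> x + \<epsilon> \<le> b \<and> (\<forall>y\<in>Z s\<^sub>0. y \<noteq> x \<longrightarrow> 2 * \<epsilon> \<le> \<bar>y - x\<bar>) \<and>
      (\<forall>\<eta>. 0 < \<eta> \<longrightarrow> \<eta> < \<epsilon> \<longrightarrow> F (x - \<eta>) s\<^sub>0 * F (x + \<eta>) s\<^sub>0 < 0) \<and>
      (\<forall>s\<in>T. \<bar>s - s\<^sub>0\<bar> < \<epsilon> \<longrightarrow> (\<forall>y\<in>{a..b}. \<forall>z\<in>{a..b}. \<bar>y - x\<bar> < \<epsilon> \<longrightarrow> \<bar>z - x\<bar> < \<epsilon> \<longrightarrow>
        F y s = 0 \<longrightarrow> F z s = 0 \<longrightarrow> y = z))" for x \<epsilon>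
  have "\<exists>\<epsilon>>0. \<forall>x\<in>Z s\<^sub>0. P x \<epsilon>"
  proof (rule finite_uniform_radius[OF finZ])
    fix x assume "x \<in> Z s\<^sub>0"
    then have x: "x \<in> {a..b}" "F x s\<^sub>0 = 0" by (auto simp: Z_def)
    with ends[OF T(2)] have ab: "a < x" "x < b" by (auto simp: less_le)
    obtain \<epsilon>1 where 1: "\<epsilon>1 > 0" "\<forall>s\<in>T. \<bar>s - s\<^sub>0\<bar> < \<epsilon>1 \<longrightarrow> (\<forall>y\<in>{a..b}. \<forall>z\<in>{a..b}.
        \<bar>y - x\<bar> < \<epsilon>1 \<longrightarrow> \<bar>z - x\<bar> < \<epsilon>1 \<longrightarrow> F y s = 0 \<longrightarrow> F z s = 0 \<longrightarrow> y = z)"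
      using uniq[OF x] by blast
    obtain \<epsilon>2 where 2: "\<epsilon>2 > 0" "\<forall>\<eta>. 0 < \<eta> \<longrightarrow> \<eta> < \<epsilon>2 \<longrightarrow> F (x - \<eta>) s\<^sub>0 * F (x + \<eta>) s\<^sub>0 < 0"
      using sign[OF x] by blast
    obtain d where 3: "d > 0" "\<forall>y\<in>Z s\<^sub>0. y \<noteq> x \<longrightarrow> d \<le> dist x y"
      using finite_set_avoid[OF finZ, of x] by blast
    define \<epsilon> where "\<epsilon> = Min {\<epsilon>1, \<epsilon>2, d / 2, x - a, b - x}"
    have "\<epsilon> > 0" unfolding \<epsilon>_def using 1(1) 2(1) 3(1) ab by simp
    moreover have "\<epsilon> \<le> \<epsilon>1" "\<epsilon> \<le> \<epsilon>2" "\<epsilon> \<le> d / 2" "\<epsilon> \<le> x - a" "\<epsilon> \<le> b - x"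
      unfolding \<epsilon>_def by (rule Min_le; simp)+
    ultimately have \<epsilon>: "\<epsilon> > 0" "\<epsilon> \<le> \<epsilon>1" "\<epsilon> \<le> \<epsilon>2" "2 * \<epsilon> \<le> d" "\<epsilon> \<le> x - a" "\<epsilon> \<le> b - x"
      by linarith+
    have "P x \<epsilon>"
      unfolding P_def
    proof (intro conjI)
      show "a \<le> x - \<epsilon>" "x + \<epsilon> \<le> b" using \<epsilon> by auto
      show "\<forall>y\<in>Z s\<^sub>0. y \<noteq> x \<longrightarrow> 2 * \<epsilon> \<le> \<bar>y - x\<bar>"
        using 3(2) \<epsilon>(4) by (auto simp: dist_real_def abs_minus_commute intro: order_trans)
      show "\<forall>\<eta>. 0 < \<eta> \<longrightarrow> \<eta> < \<epsilon> \<longrightarrow> F (x - \<eta>) s\<^sub>0 * F (x + \<eta>) s\<^sub>0 < 0"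
        using 2(2) \<epsilon>(3) by auto
      show "\<forall>s\<in>T. \<bar>s - s\<^sub>0\<bar> < \<epsilon> \<longrightarrow> (\<forall>y\<in>{a..b}. \<forall>z\<in>{a..b}. \<bar>y - x\<bar> < \<epsilon> \<longrightarrow> \<bar>z - x\<bar> < \<epsilon> \<longrightarrow>
          F y s = 0 \<longrightarrow> F z s = 0 \<longrightarrow> y = z)"
        using 1(2) less_le_trans[OF _ \<epsilon>(2)] by blast
    qed
    then show "\<exists>\<epsilon>>0. P x \<epsilon>" using \<epsilon>(1) by blast
  next
    fix x \<epsilon> \<delta> :: real assume P: "P x \<epsilon>" and \<delta>: "0 < \<delta>" "\<delta> \<le> \<epsilon>"
    show "P x \<delta>"
      unfolding P_def
    proof (intro conjI)
      show "a \<le> x - \<delta>" "x + \<delta> \<le> b" using P \<delta> by (auto simp: P_def)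
      show "\<forall>y\<in>Z s\<^sub>0. y \<noteq> x \<longrightarrow> 2 * \<delta> \<le> \<bar>y - x\<bar>"
        using P \<delta> order_trans[of "2 * \<delta>" "2 * \<epsilon>"] by (auto simp: P_def)
      show "\<forall>\<eta>. 0 < \<eta> \<longrightarrow> \<eta> < \<delta> \<longrightarrow> F (x - \<eta>) s\<^sub>0 * F (x + \<eta>) s\<^sub>0 < 0"
        using P \<delta> by (auto simp: P_def)
      have "\<forall>s\<in>T. \<bar>s - s\<^sub>0\<bar> < \<epsilon> \<longrightarrow> (\<forall>y\<in>{a..b}. \<forall>z\<in>{a..b}. \<bar>y - x\<bar> < \<epsilon> \<longrightarrow> \<bar>z - x\<bar> < \<epsilon> \<longrightarrow>
          F y s = 0 \<longrightarrow> F z s = 0 \<longrightarrow> y = z)"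
        using P unfolding P_def by blast
      then show "\<forall>s\<in>T. \<bar>s - s\<^sub>0\<bar> < \<delta> \<longrightarrow> (\<forall>y\<in>{a..b}. \<forall>z\<in>{a..b}. \<bar>y - x\<bar> < \<delta> \<longrightarrow> \<bar>z - x\<bar> < \<delta> \<longrightarrow>
          F y s = 0 \<longrightarrow> F z s = 0 \<longrightarrow> y = z)"
        using less_le_trans[OF _ \<delta>(2)] by blast
    qed
  qed
  then obtain \<epsilon> where \<epsilon>0: "\<epsilon> > 0" and P: "\<And>x. x \<in> Z s\<^sub>0 \<Longrightarrow> P x \<epsilon>" by blast
  define \<eta> where "\<eta> = \<epsilon> / 2"
  have \<eta>: "0 < \<eta>" "\<eta> < \<epsilon>" "2 * \<eta> = \<epsilon>" using \<epsilon>0 by (auto simp: \<eta>_def)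
  \<comment> \<open>Only open balls are removed, so \<open>C\<close> is compact and contains the
    points \<open>x - \<eta>\<close> and \<open>x + \<eta>\<close> where the signs are
    compared.\<close>
  define C where "C = {a..b} - (\<Union>x\<in>Z s\<^sub>0. ball x \<eta>)"
  have "compact C" unfolding C_def by (intro compact_diff compact_Icc open_UN) auto
  obtain m where m: "m > 0" "\<And>x. x \<in> C \<Longrightarrow> m \<le> \<bar>F x s\<^sub>0\<bar>"
  proof (cases "C = {}")
    case False
    have "continuous_on C (\<lambda>x. \<bar>F x s\<^sub>0\<bar>)"
      by (intro continuous_on_rabs continuous_on_subset[OF cont1[OF T(2)]]) (auto simp: C_def)
    then obtain x where x: "x \<in> C" "\<And>y. y \<in> C \<Longrightarrow> \<bar>F x s\<^sub>0\<bar> \<le> \<bar>F y s\<^sub>0\<bar>"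
      using continuous_attains_inf[OF \<open>compact C\<close> False] by blast
    have "F x s\<^sub>0 \<noteq> 0"
    proof
      assume "F x s\<^sub>0 = 0"
      then have "x \<in> Z s\<^sub>0" using x(1) by (auto simp: C_def Z_def)
      then show False using x(1) \<eta>(1) by (auto simp: C_def)
    qed
    then show thesis using x that[of "\<bar>F x s\<^sub>0\<bar>"] by auto
  qed (use that[of 1] in auto)
  have "uniformly_continuous_on ({a..b} \<times> T) (\<lambda>p. F (fst p) (snd p))"
    using cont T(1) by (intro compact_uniformly_continuous compact_Times compact_Icc)
  then obtain \<rho>1 where \<rho>1: "\<rho>1 > 0" and u: "\<And>p q. p \<in> {a..b} \<times> T \<Longrightarrow> q \<in> {a..b} \<times> T \<Longrightarrow> dist q p < \<rho>1 \<Longrightarrow>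
      dist (F (fst q) (snd q)) (F (fst p) (snd p)) < m"
    using m(1) unfolding uniformly_continuous_on_def by metis
  have close: "\<bar>F x s - F x s\<^sub>0\<bar> < m" if "x \<in> {a..b}" "s \<in> T" "\<bar>s - s\<^sub>0\<bar> < \<rho>1" for x s
    using u[of "(x, s\<^sub>0)" "(x, s)"] that T(2) by (simp add: dist_Pair_Pair dist_real_def)
  define \<rho> where "\<rho> = min \<rho>1 \<epsilon>"
  have "card (Z s) = card (Z s\<^sub>0)" if s: "s \<in> T" "\<bar>s - s\<^sub>0\<bar> < \<rho>" for s
  proof -
    have c: "\<bar>F x s - F x s\<^sub>0\<bar> < m" if "x \<in> {a..b}" for x
      using close[OF that s(1)] s(2) by (simp add: \<rho>_def)
    have ball_in: "{x - \<eta>..x + \<eta>} \<subseteq> {a..b}" if "x \<in> Z s\<^sub>0" for x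
      using P[OF that] \<eta> unfolding P_def by auto
    have "\<exists>y. y \<in> Z s \<and> \<bar>y - x\<bar> < \<eta>" if x: "x \<in> Z s\<^sub>0" for x
    proof -
      have in_C: "x - \<eta> \<in> C" "x + \<eta> \<in> C"
      proof -
        have far: "\<eta> \<le> \<bar>w - y\<bar>" if "\<bar>w - x\<bar> = \<eta>" "y \<in> Z s\<^sub>0" for w y
        proof (cases "y = x")
          case False
          then have "2 * \<epsilon> \<le> \<bar>y - x\<bar>" using P[OF x] that(2) unfolding P_def by blast
          then show ?thesis using that(1) \<eta> by linarith
        qed (use that in simp)
        have "x - \<eta> \<in> {a..b}" "x + \<eta> \<in> {a..b}" using ball_in[OF x] \<eta>(1) by auto
        then show "x - \<eta> \<in> C" "x + \<eta> \<in> C"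
          using far[of "x - \<eta>"] far[of "x + \<eta>"] \<eta>(1)
          by (auto simp: C_def dist_real_def abs_minus_commute not_less)
      qed
      then have ab: "x - \<eta> \<in> {a..b}" "x + \<eta> \<in> {a..b}" by (auto simp: C_def)
      have sg: "F (x - \<eta>) s\<^sub>0 * F (x + \<eta>) s\<^sub>0 < 0" using P[OF x] \<eta> unfolding P_def by blast
      have cl: "\<bar>F (x - \<eta>) s - F (x - \<eta>) s\<^sub>0\<bar> < \<bar>F (x - \<eta>) s\<^sub>0\<bar>"
        "\<bar>F (x + \<eta>) s - F (x + \<eta>) s\<^sub>0\<bar> < \<bar>F (x + \<eta>) s\<^sub>0\<bar>"
        using c[OF ab(1)] c[OF ab(2)] m(2)[OF in_C(1)] m(2)[OF in_C(2)] by linarith+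
      have cs: "continuous_on {x - \<eta>..x + \<eta>} (\<lambda>y. F y s)"
        by (rule continuous_on_subset[OF cont1[OF s(1)] ball_in[OF x]])
      from sg have "F (x - \<eta>) s\<^sub>0 < 0 \<and> 0 < F (x + \<eta>) s\<^sub>0 \<or> 0 < F (x - \<eta>) s\<^sub>0 \<and> F (x + \<eta>) s\<^sub>0 < 0"
        by (auto simp: mult_less_0_iff)
      then have "\<exists>y\<ge>x - \<eta>. y \<le> x + \<eta> \<and> F y s = 0"
      proof
        assume "F (x - \<eta>) s\<^sub>0 < 0 \<and> 0 < F (x + \<eta>) s\<^sub>0"
        then have "F (x - \<eta>) s \<le> 0" "0 \<le> F (x + \<eta>) s" using cl by linarith+
        then show ?thesis using IVT'[of "\<lambda>y. F y s" "x - \<eta>" 0 "x + \<eta>"] cs \<eta>(1) by auto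
      next
        assume "0 < F (x - \<eta>) s\<^sub>0 \<and> F (x + \<eta>) s\<^sub>0 < 0"
        then have "F (x + \<eta>) s \<le> 0" "0 \<le> F (x - \<eta>) s" using cl by linarith+
        then show ?thesis using IVT2'[of "\<lambda>y. F y s" "x + \<eta>" 0 "x - \<eta>"] cs \<eta>(1) by auto
      qed
      then obtain y where y: "x - \<eta> \<le> y" "y \<le> x + \<eta>" "F y s = 0" by blast
      have "F (x - \<eta>) s \<noteq> 0" "F (x + \<eta>) s \<noteq> 0" using cl by auto
      then have "y \<noteq> x - \<eta>" "y \<noteq> x + \<eta>" using y(3) by auto
      then have "\<bar>y - x\<bar> < \<eta>" using y by linarith
      moreover have "y \<in> Z s" using y ball_in[OF x] by (auto simp: Z_def)
      ultimately show ?thesis by blast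
    qed
    then obtain f where f: "\<And>x. x \<in> Z s\<^sub>0 \<Longrightarrow> f x \<in> Z s \<and> \<bar>f x - x\<bar> < \<eta>" by metis
    have "bij_betw f (Z s\<^sub>0) (Z s)"
      unfolding bij_betw_def
    proof
      show "inj_on f (Z s\<^sub>0)"
      proof (rule inj_onI, rule ccontr)
        fix x y assume xy: "x \<in> Z s\<^sub>0" "y \<in> Z s\<^sub>0" "f x = f y" "x \<noteq> y"
        then have "2 * \<epsilon> \<le> \<bar>x - y\<bar>" using P[OF xy(2)] unfolding P_def by blast
        then show False using f[OF xy(1)] f[OF xy(2)] xy(3) \<eta> by linarith
      qed
      show "f ` Z s\<^sub>0 = Z s"
      proof (intro equalityI subsetI)
        fix z assume z: "z \<in> Z s"
        have "z \<notin> C"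
        proof
          assume "z \<in> C"
          then have "m \<le> \<bar>F z s\<^sub>0\<bar>" by (rule m(2))
          moreover have "\<bar>F z s - F z s\<^sub>0\<bar> < m" using c[of z] z by (simp add: Z_def)
          ultimately show False using z by (simp add: Z_def)
        qed
        then obtain x where x: "x \<in> Z s\<^sub>0" "\<bar>z - x\<bar> < \<eta>"
          using z by (auto simp: C_def Z_def dist_real_def abs_minus_commute)
        have "f x \<in> Z s" "\<bar>f x - x\<bar> < \<epsilon>" "\<bar>z - x\<bar> < \<epsilon>" using f[OF x(1)] x(2) \<eta> by auto
        moreover have "\<bar>s - s\<^sub>0\<bar> < \<epsilon>" using s(2) by (simp add: \<rho>_def)
        ultimately have "f x = z"
          using P[OF x(1)] z s(1) unfolding P_def Z_def by blast
        then show "z \<in> f ` Z s\<^sub>0" using x(1) by blast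
      qed (use f in auto)
    qed
    then show ?thesis by (rule bij_betw_same_card[symmetric])
  qed
  moreover have "\<rho> > 0" using \<rho>1 \<epsilon>0 by (simp add: \<rho>_def)
  ultimately show ?thesis unfolding Z_def by blast
qed

section \<open>Continuous dependence of the matching data on the spectral parameter and the
  coupling\<close>

lemma continuous_on_forward:
  fixes e :: "'b::topological_space \<Rightarrow> nat \<Rightarrow> real"
  assumes b: "\<And>k. b k \<noteq> 0" and "\<And>k. continuous_on A (\<lambda>p. e p k)"
  shows "continuous_on A (\<lambda>p. forward b (e p) (\<lambda>_. 0) 1 k)"
proof (induction k rule: induct_nat_012)
  case (ge2 k)
  then show ?case using assms by (auto intro!: continuous_intros)
qed (use assms in \<open>auto intro!: continuous_intros\<close>)

text \<open>The Lipschitz constant is \<open>2 * 2\<close>: the diagonal moves by at most twice the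
  distance of the parameters, and \<open>tail_sol_lipschitz\<close> doubles this.\<close>

lemma continuous_on_jost:
  fixes A :: "(real \<times> real) set"
  assumes K: "\<And>p. p \<in> A \<Longrightarrow> diag_dominant b (\<lambda>k. shifted_diag g (snd p) k - fst p) K"
  shows "continuous_on A (\<lambda>p. jost b (\<lambda>k. shifted_diag g (snd p) k - fst p) K)"
proof (rule lipschitz_on_continuous_on[OF lipschitz_onI[of _ _ 4]])
  fix p q :: "real \<times> real" assume pq: "p \<in> A" "q \<in> A"
  have "norm ((shifted_diag g (snd p) k - fst p) - (shifted_diag g (snd q) k - fst q)) \<le> 2 * dist p q" for k
  proof -
    have "(shifted_diag g (snd p) k - fst p) - (shifted_diag g (snd q) k - fst q)
        = (snd p - snd q) * (-1) ^ k - (fst p - fst q)"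
      by (simp add: shifted_diag_def algebra_simps)
    then have "norm ((shifted_diag g (snd p) k - fst p) - (shifted_diag g (snd q) k - fst q))
        \<le> \<bar>snd p - snd q\<bar> + \<bar>fst p - fst q\<bar>"
      using abs_triangle_ineq4[of "(snd p - snd q) * (-1) ^ k" "fst p - fst q"] by (simp add: abs_mult)
    then show ?thesis
      using dist_fst_le[of p q] dist_snd_le[of p q] by (simp add: dist_real_def)
  qed
  from tail_sol_lipschitz[OF K[OF pq(1)] K[OF pq(2)] this, of "ell2_unit (K - 1)"]
  show "dist (jost b (\<lambda>k. shifted_diag g (snd p) k - fst p) K) (jost b (\<lambda>k. shifted_diag g (snd q) k - fst q) K)
      \<le> 4 * dist p q"
    by (simp add: jost_def dist_norm[of "tail_sol _ _ _ _"])
qed simp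

lemma ell2_smult_real: "ell2_smult c x = c *\<^sub>R x" for x :: "real ell2"
  by (rule ell2_eqI) simp

lemma continuous_on_glued:
  fixes A :: "(real \<times> real) set"
  assumes K: "\<And>p. p \<in> A \<Longrightarrow> diag_dominant b (\<lambda>k. shifted_diag g (snd p) k - fst p) K"
    and b: "\<And>k. b k \<noteq> 0"
  shows "continuous_on A (\<lambda>p. glued b (\<lambda>k. shifted_diag g (snd p) k - fst p) K)"
    and "continuous_on A (\<lambda>p. defect b (\<lambda>k. shifted_diag g (snd p) k - fst p) K)"
proof -
  have e: "continuous_on A (\<lambda>p. shifted_diag g (snd p) k - fst p)" for k
    unfolding shifted_diag_def by (intro continuous_intros)
  note f = continuous_on_forward[OF b e] and j = continuous_on_jost[of A b g K, OF K]
  show "continuous_on A (\<lambda>p. glued b (\<lambda>k. shifted_diag g (snd p) k - fst p) K)"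
    unfolding glued_def glue_def ell2_smult_real by (intro continuous_intros f j) auto
  show "continuous_on A (\<lambda>p. defect b (\<lambda>k. shifted_diag g (snd p) k - fst p) K)"
    unfolding defect_def
    by (intro continuous_intros f bounded_linear.continuous_on[OF bounded_linear_coord] j) auto
qed

text \<open>On a compact box of parameters one matching row works throughout, so the eigenvalues are
  the zeros of one continuous \<open>F\<close>. Their number is locally constant in
  \<open>s\<close>, as none reaches an end point, and \<open>{- S..S}\<close> is connected.\<close>

lemma shifted_eigvals_card_constant:
  assumes g: "g \<noteq> 0" and ends: "\<And>s. \<bar>s\<bar> \<le> S \<Longrightarrow> a \<notin> shifted_eigvals g s \<and> b \<notin> shifted_eigvals g s"
    and s: "\<bar>s\<bar> \<le> S" and t: "\<bar>t\<bar> \<le> S"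
  shows "card (shifted_eigvals g s \<inter> {a..b}) = card (shifted_eigvals g t \<inter> {a..b})"
proof -
  let ?o = "jac_off g"
  \<comment> \<open>The extra 1 keeps points slightly outside \<open>{a..b}\<close> in the box,
    since \<open>F\<close> is examined on both sides of a zero.\<close>
  define L where "L = max \<bar>a\<bar> \<bar>b\<bar> + 1"
  obtain K where K0: "\<And>e :: nat \<Rightarrow> real. (\<And>k. norm (e k - of_nat k) \<le> g\<^sup>2 + S + L) \<Longrightarrow> diag_dominant ?o e K"
    using jac_off_diag_dominant by blast
  define e where "e p k = shifted_diag g (snd p) k - fst p" for p :: "real \<times> real" and k
  define B where "B = {- L..L} \<times> {- S..S}"
  have K: "diag_dominant ?o (e p) K" if "p \<in> B" for p
  proof (rule K0)
    fix k
    have "e p k - of_nat k = g\<^sup>2 + snd p * (-1) ^ k - fst p" by (simp add: e_def shifted_diag_def)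
    moreover have "\<bar>snd p * (-1) ^ k\<bar> \<le> S" "\<bar>fst p\<bar> \<le> L" using that by (auto simp: B_def abs_mult)
    moreover have "0 \<le> g\<^sup>2" by simp
    ultimately show "norm (e p k - of_nat k) \<le> g\<^sup>2 + S + L" unfolding real_norm_def by linarith
  qed
  define v F where "v p = glued ?o (e p) K" and "F p = defect ?o (e p) K" for p
  have cv: "continuous_on B v" and cF: "continuous_on B F"
    unfolding v_def F_def e_def
    by (rule continuous_on_glued[of B ?o g K, OF K[unfolded e_def] jac_off_nonzero[OF g]]; assumption)+
  have v0: "coord (v p) 0 = 1" if "p \<in> B" for p
    unfolding v_def by (rule coord_glued_0[OF K[OF that]])
  have jv: "jrow ?o (shifted_diag g s) (coord (v (x, s))) k
      = coord (x *\<^sub>R v (x, s) + (?o (K - 1) * F (x, s)) *\<^sub>R ell2_unit (K - 1)) k" if "(x, s) \<in> B" for x s k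
  proof -
    have "e (x, s) = (\<lambda>k. shifted_diag g s k - x)" by (simp add: e_def fun_eq_iff)
    then have "jrow ?o (shifted_diag g s) u k = jrow ?o (e (x, s)) u k + x * u k" for u
      by (simp add: jrow_diag_diff)
    then show ?thesis
      using jrow_glued[OF K[OF that] jac_off_nonzero[OF g], of k] by (simp add: v_def F_def coord_unit)
  qed
  have zero: "F (x, s) = 0 \<longleftrightarrow> x \<in> shifted_eigvals g s" if xs: "(x, s) \<in> B" for x s
  proof
    assume "F (x, s) = 0"
    moreover have "v (x, s) \<noteq> 0" using v0[OF xs] by auto
    ultimately show "x \<in> shifted_eigvals g s"
      using jv[OF xs] unfolding shifted_eigvals_def by auto
  next
    assume "x \<in> shifted_eigvals g s"
    then obtain y where y: "y \<noteq> 0" "\<And>k. jrow ?o (e (x, s)) (coord y) k = coord 0 k"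
      unfolding shifted_eigvals_def e_def jrow_diag_diff by auto
    show "F (x, s) = 0"
    proof (rule ccontr)
      assume "F (x, s) \<noteq> 0"
      then obtain R where R: "\<And>y k. jrow ?o (e (x, s)) (coord (R y)) k = coord y k"
        using jacobi_inverse[OF K[OF xs] jac_off_nonzero[OF g]] unfolding F_def by blast
      \<comment> \<open>Symmetry pairs the kernel vector \<open>y\<close> with a preimage of itself,
        which forces its norm to vanish.\<close>
      have "0 \<bullet> R y = y \<bullet> y" by (rule jac_symmetric_real[OF g y(2) R])
      then show False using y(1) by simp
    qed
  qed
  text \<open>The Wronskian identity makes \<open>F\<close> change sign at each zero.\<close>
  have wronskian: "(x - y) * (v (x, s) \<bullet> v (y, s)) = ?o (K - 1) * F (y, s) * coord (v (x, s)) (K - 1)"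
    if "(x, s) \<in> B" "(y, s) \<in> B" "F (x, s) = 0" for x y s
  proof -
    have u: "v (x, s) \<bullet> ell2_unit (K - 1) = coord (v (x, s)) (K - 1)"
    proof -
      have "v (x, s) \<bullet> ell2_unit (K - 1) = (\<Sum>j\<in>{K - 1}. coord (v (x, s)) j * coord (ell2_unit (K - 1)) j)"
        unfolding inner_real_ell2 by (rule suminf_finite) (auto simp: coord_unit)
      then show ?thesis by (simp add: coord_unit)
    qed
    have "(x *\<^sub>R v (x, s) + (?o (K - 1) * F (x, s)) *\<^sub>R ell2_unit (K - 1)) \<bullet> v (y, s)
        = v (x, s) \<bullet> (y *\<^sub>R v (y, s) + (?o (K - 1) * F (y, s)) *\<^sub>R ell2_unit (K - 1))"
      by (rule jac_symmetric_real[OF g]) (use jv that in auto)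
    then show ?thesis using that(3) by (simp add: inner_add_right u[simplified] algebra_simps)
  qed
  \<comment> \<open>By continuity, solutions at nearby parameters have positive inner product. This
    is the sign information needed to read off the sign of \<open>F\<close> from the Wronskian
    identity.\<close>
  have near: "\<exists>\<epsilon>>0. \<forall>q\<in>B. \<forall>r\<in>B. dist q p < \<epsilon> \<longrightarrow> dist r p < \<epsilon> \<longrightarrow> 0 < v q \<bullet> v r" if p: "p \<in> B" for p
  proof -
    have "continuous_on (B \<times> B) (\<lambda>z. v (fst z) \<bullet> v (snd z))"
      by (intro continuous_intros continuous_on_compose2[OF cv]) auto
    moreover have "0 < v p \<bullet> v p" using v0[OF p] by auto
    ultimately obtain d where d: "d > 0" "\<forall>z\<in>B \<times> B. dist z (p, p) < d \<longrightarrow>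
        dist (v (fst z) \<bullet> v (snd z)) (v p \<bullet> v p) < v p \<bullet> v p"
      using p unfolding continuous_on_iff by (metis (no_types, lifting) SigmaI fst_conv snd_conv)
    have "0 < v q \<bullet> v r" if "q \<in> B" "r \<in> B" "dist q p < d / 2" "dist r p < d / 2" for q r
    proof -
      have "dist (q, r) (p, p) < d"
        using sqrt_sum_squares_le_sum_abs[of "dist q p" "dist r p"] that by (simp add: dist_Pair_Pair)
      then have "dist (v q \<bullet> v r) (v p \<bullet> v p) < v p \<bullet> v p" using d(2) that by force
      then show ?thesis by (simp add: dist_real_def)
    qed
    then show ?thesis using d(1) by (intro exI[of _ "d / 2"]) auto
  qed
  define Z where "Z s = card {x\<in>{a..b}. F (x, s) = 0}" for s
  have inB: "(x, s) \<in> B" if "x \<in> {a - 1..b + 1}" "s \<in> {- S..S}" for x s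
    using that by (auto simp: B_def L_def)
  have "\<exists>\<rho>>0. \<forall>s\<in>{- S..S}. \<bar>s - s\<^sub>0\<bar> < \<rho> \<longrightarrow> Z s = Z s\<^sub>0" if s0: "s\<^sub>0 \<in> {- S..S}" for s\<^sub>0
    unfolding Z_def
  proof (rule card_zeros_locally_constant[where F = "\<lambda>x s. F (x, s)"])
    have "{a..b} \<times> {- S..S} \<subseteq> B" using inB by auto
    then show "continuous_on ({a..b} \<times> {- S..S}) (\<lambda>p. F (fst p, snd p))"
      using continuous_on_subset[OF cF] by simp
    fix s assume s: "s \<in> {- S..S}"
    have "(a, s) \<in> B" "(b, s) \<in> B" using s by (auto simp: B_def L_def)
    then show "F (a, s) \<noteq> 0 \<and> F (b, s) \<noteq> 0"
      using ends[of s] s zero[of a s] zero[of b s] by (auto simp: abs_le_iff)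
  next
    fix x assume x: "x \<in> {a..b}" "F (x, s\<^sub>0) = 0"
    then have p: "(x, s\<^sub>0) \<in> B" using inB s0 by auto
    obtain \<epsilon> where \<epsilon>: "\<epsilon> > 0" "\<And>q r. q \<in> B \<Longrightarrow> r \<in> B \<Longrightarrow> dist q (x, s\<^sub>0) < \<epsilon> \<Longrightarrow> dist r (x, s\<^sub>0) < \<epsilon> \<Longrightarrow> 0 < v q \<bullet> v r"
      using near[OF p] by blast
    have d: "dist (y, s) (x, s\<^sub>0) < \<epsilon>" if "\<bar>y - x\<bar> < \<epsilon> / 2" "\<bar>s - s\<^sub>0\<bar> < \<epsilon> / 2" for y s
      using sqrt_sum_squares_le_sum_abs[of "dist y x" "dist s s\<^sub>0"] that by (simp add: dist_Pair_Pair dist_real_def)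
    show "\<exists>\<epsilon>>0. \<forall>s\<in>{- S..S}. \<bar>s - s\<^sub>0\<bar> < \<epsilon> \<longrightarrow> (\<forall>y\<in>{a..b}. \<forall>z\<in>{a..b}. \<bar>y - x\<bar> < \<epsilon> \<longrightarrow> \<bar>z - x\<bar> < \<epsilon> \<longrightarrow>
        F (y, s) = 0 \<longrightarrow> F (z, s) = 0 \<longrightarrow> y = z)"
    proof (intro exI[of _ "\<epsilon> / 2"] conjI ballI impI)
      fix s y z assume h: "s \<in> {- S..S}" "\<bar>s - s\<^sub>0\<bar> < \<epsilon> / 2" "y \<in> {a..b}" "z \<in> {a..b}"
        "\<bar>y - x\<bar> < \<epsilon> / 2" "\<bar>z - x\<bar> < \<epsilon> / 2" "F (y, s) = 0" "F (z, s) = 0"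
      then have B: "(y, s) \<in> B" "(z, s) \<in> B" using inB by auto
      \<comment> \<open>At two zeros the right-hand side of the Wronskian identity vanishes, so a
        positive inner product leaves only \<open>y = z\<close>.\<close>
      have "0 < v (y, s) \<bullet> v (z, s)" using \<epsilon>(2)[OF B d d] h by auto
      then show "y = z" using wronskian[OF B h(7)] h(8) by simp
    qed (use \<epsilon>(1) in simp)
    show "\<exists>\<epsilon>>0. \<forall>\<eta>. 0 < \<eta> \<longrightarrow> \<eta> < \<epsilon> \<longrightarrow> F (x - \<eta>, s\<^sub>0) * F (x + \<eta>, s\<^sub>0) < 0"
    proof (intro exI[of _ "min 1 (\<epsilon> / 2)"] conjI allI impI)
      fix \<eta> assume \<eta>: "0 < \<eta>" "\<eta> < min 1 (\<epsilon> / 2)"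
      then have B: "(x - \<eta>, s\<^sub>0) \<in> B" "(x + \<eta>, s\<^sub>0) \<in> B" using inB s0 x by auto
      have pos: "0 < v (x, s\<^sub>0) \<bullet> v (x - \<eta>, s\<^sub>0)" "0 < v (x, s\<^sub>0) \<bullet> v (x + \<eta>, s\<^sub>0)"
        using \<epsilon>(2)[OF p B(1) d d] \<epsilon>(2)[OF p B(2) d d] \<eta> \<epsilon>(1) by auto
      \<comment> \<open>As \<open>c\<close> does not depend on \<eta>, the product
        \<open>c * F\<close> is positive to the left of the zero and negative to the right, whatever
        the sign of \<open>c\<close>.\<close>
      define c where "c = ?o (K - 1) * coord (v (x, s\<^sub>0)) (K - 1)"
      have "0 < c * F (x - \<eta>, s\<^sub>0)"
        using wronskian[OF p B(1) x(2)] mult_pos_pos[OF \<eta>(1) pos(1)] by (simp add: c_def mult_ac)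
      moreover have "c * F (x + \<eta>, s\<^sub>0) < 0"
        using wronskian[OF p B(2) x(2)] mult_pos_pos[OF \<eta>(1) pos(2)] by (simp add: c_def mult_ac)
      ultimately show "F (x - \<eta>, s\<^sub>0) * F (x + \<eta>, s\<^sub>0) < 0"
        by (auto simp: zero_less_mult_iff mult_less_0_iff)
    qed (use \<epsilon>(1) in simp)
  qed (use s0 in auto)
  then have "\<forall>u\<in>{- S..S}. eventually (\<lambda>w. Z u = Z w) (at u within {- S..S})"
    unfolding eventually_at dist_real_def by metis
  then have "Z s = Z t"
    using connected_local_const[of "{- S..S}" s t Z] s t by (auto simp: abs_le_iff)
  moreover have "shifted_eigvals g u \<inter> {a..b} = {x\<in>{a..b}. F (x, u) = 0}" if "\<bar>u\<bar> \<le> S" for u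
    using zero[of _ u] inB[of _ u] that by (auto simp: abs_le_iff)
  ultimately show ?thesis using s t by (simp add: Z_def)
qed

section \<open>Enumeration of the eigenvalues and their asymptotics\<close>

text \<open>\<open>lam\<close> inverts the map that counts the elements of \<open>E\<close> below a
  point. This map is strictly increasing on \<open>E\<close> and takes every value \<open>n\<close>:
  if the least element of rank at least \<open>n\<close> had a larger rank, its predecessor would
  qualify too.\<close>

lemma real_set_enumeration:
  fixes E :: "real set"
  assumes fin: "\<And>x. finite (E \<inter> {..x})" and inf: "infinite E"
  shows "\<exists>lam :: nat \<Rightarrow> real. strict_mono lam \<and> range lam = E \<and> (\<forall>n. card (E \<inter> {..<lam n}) = n)"
proof -
  define rank where "rank x = card (E \<inter> {..<x})" for x
  have finl: "finite (E \<inter> {..<x})" for x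
    by (rule finite_subset[OF _ fin[of x]]) auto
  have mono: "rank x < rank y" if "x \<in> E" "x < y" for x y
    unfolding rank_def by (rule psubset_card_mono[OF finl]) (use that in auto)
  have ex: "\<exists>x\<in>E. rank x = n" for n
  proof -
    obtain B where B: "finite B" "card B = Suc n" "B \<subseteq> E"
      using infinite_arbitrarily_large[OF inf] by blast
    define x where "x = Max B"
    have xB: "x \<in> B" unfolding x_def using B by (intro Max_in) auto
    have "card (B - {x}) \<le> rank x"
      unfolding rank_def using B(1,3) by (intro card_mono[OF finl]) (auto simp: x_def less_le)
    then have "n \<le> rank x" using B xB by simp
    define G where "G = {y\<in>E. y \<le> x \<and> n \<le> rank y}"
    have "G \<subseteq> E \<inter> {..x}" by (auto simp: G_def)
    then have G: "finite G" using fin by (rule finite_subset)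
    have xG: "x \<in> G" using xB B(3) \<open>n \<le> rank x\<close> by (auto simp: G_def)
    define m where "m = Min G"
    have m: "m \<in> G" "\<And>y. y \<in> G \<Longrightarrow> m \<le> y"
      unfolding m_def using G xG by (auto intro!: Min_in)
    have "rank m = n"
    proof (rule ccontr)
      assume "rank m \<noteq> n"
      then have gt: "n < rank m" using m(1) by (auto simp: G_def)
      define y where "y = Max (E \<inter> {..<m})"
      have ne: "E \<inter> {..<m} \<noteq> {}" using gt unfolding rank_def by (metis card.empty not_less0)
      have y: "y \<in> E" "y < m" using Max_in[OF finl ne] by (auto simp: y_def)
      have "E \<inter> {..<m} \<subseteq> insert y (E \<inter> {..<y})"
        using Max_ge[OF finl, of _ m] by (fastforce simp: y_def[symmetric] less_le)
      then have "rank m \<le> card (insert y (E \<inter> {..<y}))"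
        unfolding rank_def using finl by (intro card_mono) auto
      also have "\<dots> = Suc (rank y)" unfolding rank_def using finl by simp
      finally have "y \<in> G" using gt y m(1) by (auto simp: G_def)
      then show False using m(2) y(2) by force
    qed
    then show ?thesis using m(1) by (auto simp: G_def)
  qed
  then obtain lam where lam: "\<And>n. lam n \<in> E" "\<And>n. rank (lam n) = n" by metis
  have inj: "x = y" if "x \<in> E" "y \<in> E" "rank x = rank y" for x y
    using mono[of x y] mono[of y x] that by (metis less_irrefl linorder_neqE)
  have "strict_mono lam"
  proof (rule strict_monoI)
    fix m n :: nat assume "m < n"
    show "lam m < lam n"
    proof (rule ccontr)
      assume "\<not> lam m < lam n"
      then have "rank (lam n) \<le> rank (lam m)"
        using mono[OF lam(1), of n "lam m"] by (cases "lam m = lam n") auto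
      then show False using \<open>m < n\<close> by (simp add: lam(2))
    qed
  qed
  moreover have "range lam = E"
  proof (intro equalityI subsetI)
    fix x assume "x \<in> E"
    then have "lam (rank x) = x" using lam by (intro inj) auto
    then show "x \<in> range lam" by (metis rangeI)
  qed (use lam in auto)
  ultimately show ?thesis using lam(2) unfolding rank_def by blast
qed

text \<open>\<open>J\<close> is the integer part of \<open>(n / 2) powr (1/4)\<close>, and
  \<open>n \<ge> 32\<close> makes it at least 2. Since \<open>n powr (1/4) \<le> 4 * J\<close>,
  localization gives \<open>d ^ 4 * n powr (1/4) \<le> 4 * M\<close>, whose fourth root has the
  exponent 1/16.\<close>

lemma shifted_eigvals_near:
  assumes g: "g \<noteq> 0"
  shows "\<exists>M\<ge>0. \<forall>n\<ge>32. \<forall>s \<nu>. \<bar>s\<bar> \<le> S \<longrightarrow> \<nu> \<in> shifted_eigvals g s \<longrightarrow> \<bar>\<nu> - real n\<bar> \<le> 1/2 \<longrightarrow>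
    \<bar>\<nu> - real n\<bar> \<le> M * (1 / real n powr (1/16))"
proof -
  obtain M where M0: "M \<ge> 0" and M: "\<And>J n \<nu> s. 2 \<le> J \<Longrightarrow> 2 * J ^ 4 \<le> n \<Longrightarrow> \<bar>s\<bar> \<le> S \<Longrightarrow>
      \<nu> \<in> shifted_eigvals g s \<Longrightarrow> \<bar>\<nu> - real n\<bar> \<le> 1/2 \<Longrightarrow> \<bar>\<nu> - real n\<bar> ^ 4 * real J \<le> M"
    using shifted_eigvals_localized[OF g, of S] by blast
  define R where "R = (4 * M) powr (1/4)"
  have "\<bar>\<nu> - real n\<bar> \<le> R * (1 / real n powr (1/16))"
    if n: "32 \<le> n" and s: "\<bar>s\<bar> \<le> S" "\<nu> \<in> shifted_eigvals g s" "\<bar>\<nu> - real n\<bar> \<le> 1/2" for n \<nu> s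
  proof -
    define y where "y = (real n / 2) powr (1/4)"
    define J where "J = nat \<lfloor>y\<rfloor>"
    define d where "d = \<bar>\<nu> - real n\<bar>"
    have "(2 powr 4) powr (1/4) \<le> y"
      unfolding y_def using n by (intro powr_mono2) auto
    then have y2: "2 \<le> y" by (simp only: powr_powr) simp
    then have J2: "2 \<le> J" unfolding J_def by linarith
    have Jy: "real J \<le> y" "y < real J + 1" unfolding J_def using y2 by linarith+
    have "real J ^ 4 \<le> y ^ 4" using Jy by (intro power_mono) auto
    also have "y ^ 4 = y powr real 4" using y2 by (intro powr_realpow[symmetric]) simp
    also have "\<dots> = real n / 2" using n by (simp add: y_def powr_powr)
    finally have "real (2 * J ^ 4) \<le> real n" by simp
    then have "2 * J ^ 4 \<le> n" by (simp only: of_nat_le_iff)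
    from M[OF J2 this s] have dM: "d ^ 4 * real J \<le> M" unfolding d_def .
    have "real n powr (1/4) = y * 2 powr (1/4)"
      using n by (simp add: y_def powr_divide)
    also have "\<dots> \<le> y * 2"
    proof -
      have "(2::real) powr (1/4) \<le> 2 powr 1" by (rule powr_mono) auto
      then show ?thesis using y2 by (intro mult_left_mono) auto
    qed
    also have "\<dots> \<le> 4 * real J" using Jy J2 by linarith
    finally have "d ^ 4 * real n powr (1/4) \<le> d ^ 4 * (4 * real J)"
      by (intro mult_left_mono) auto
    then have "d ^ 4 * real n powr (1/4) \<le> 4 * M" using dM by linarith
    then have "(d ^ 4 * real n powr (1/4)) powr (1/4) \<le> R"
      unfolding R_def by (intro powr_mono2) auto
    moreover have "(d ^ 4 * real n powr (1/4)) powr (1/4) = d * real n powr (1/16)"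
    proof (cases "d = 0")
      case False
      then have "d > 0" by (simp add: d_def)
      then have "(d ^ 4) powr (1/4) = d"
        by (simp add: powr_realpow[symmetric] powr_powr del: powr_numeral)
      then show ?thesis using n \<open>d > 0\<close> by (simp add: powr_mult powr_powr)
    qed simp
    ultimately show ?thesis
      using n unfolding d_def by (simp add: field_simps)
  qed
  moreover have "R \<ge> 0" by (simp add: R_def)
  ultimately show ?thesis by blast
qed

text \<open>\<open>M\<close> is uniform for couplings up to \<open>\<bar>s\<bar>\<close>, so from
  one \<open>n0\<close> on no eigenvalue meets \<open>n + 1/2\<close> at any stage of the homotopy
  to 0, where the count is known. The count fixes the index of each large eigenvalue up to an error
  1/2, and localization improves this to the stated rate.\<close>

lemma shifted_eigvals_enumeration:
  assumes g: "g \<noteq> 0"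
  shows "\<exists>lam :: nat \<Rightarrow> real. strict_mono lam \<and> range lam = shifted_eigvals g s \<and>
    (\<lambda>n. lam n - real n) \<in> O(\<lambda>n. 1 / real n powr (1/16))"
proof -
  define S where "S = \<bar>s\<bar>"
  define E where "E = shifted_eigvals g s"
  obtain M where M0: "M \<ge> 0" and M: "\<And>n t \<nu>. 32 \<le> n \<Longrightarrow> \<bar>t\<bar> \<le> S \<Longrightarrow> \<nu> \<in> shifted_eigvals g t \<Longrightarrow>
      \<bar>\<nu> - real n\<bar> \<le> 1/2 \<Longrightarrow> \<bar>\<nu> - real n\<bar> \<le> M * (1 / real n powr (1/16))"
    using shifted_eigvals_near[OF g, of S] by blast
  \<comment> \<open>Large enough that \<open>M / n powr (1/16) < 1/2\<close> from there on.\<close>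
  obtain n1 :: nat where n1: "(2 * M + 1) powr 16 < real n1" using reals_Archimedean2 by blast
  define n0 where "n0 = max 32 n1"
  have half: "real n + 1/2 \<notin> shifted_eigvals g t" if "n0 \<le> n" "\<bar>t\<bar> \<le> S" for n t
  proof
    assume "real n + 1/2 \<in> shifted_eigvals g t"
    from M[OF _ that(2) this, of n] that(1) have h: "1/2 \<le> M * (1 / real n powr (1/16))"
      by (simp add: n0_def)
    have "((2 * M + 1) powr 16) powr (1/16) \<le> real n powr (1/16)"
      using that(1) n1 by (intro powr_mono2) (auto simp: n0_def)
    then have "2 * M + 1 \<le> real n powr (1/16)" using M0 by (simp only: powr_powr) simp
    then show False using h M0 that(1) by (simp add: n0_def field_simps)
  qed
  have low: "- S - 2 \<notin> shifted_eigvals g t" if "\<bar>t\<bar> \<le> S" for t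
    using shifted_eigvals_lower[OF g, of "- S - 2" t] that by auto
  have cnt: "card (E \<inter> {..real n + 1/2}) = Suc n" if "n0 \<le> n" for n
  proof -
    have "E \<inter> {..real n + 1/2} = shifted_eigvals g s \<inter> {- S - 2..real n + 1/2}"
      using shifted_eigvals_lower[OF g, of _ s] by (force simp: E_def S_def)
    also have "card \<dots> = card (shifted_eigvals g 0 \<inter> {- S - 2..real n + 1/2})"
      using half[OF that] low by (intro shifted_eigvals_card_constant[OF g, of S]) (auto simp: S_def)
    also have "shifted_eigvals g 0 \<inter> {- S - 2..real n + 1/2} = real ` {..n}"
    proof -
      have "real k \<le> real n + 1/2 \<longleftrightarrow> k \<le> n" for k
      proof
        assume "real k \<le> real n + 1/2"
        then have "real k < real (Suc n)" by simp
        then show "k \<le> n" by simp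
      qed simp
      moreover have "- S - 2 \<le> real k" for k by (simp add: S_def)
      ultimately show ?thesis by (auto simp: shifted_eigvals_0[OF g])
    qed
    also have "card (real ` {..n}) = Suc n" by (simp add: card_image)
    finally show ?thesis .
  qed
  have fin: "finite (E \<inter> {..x})" for x
  proof -
    obtain n :: nat where n: "x < real n" using reals_Archimedean2 by blast
    have "finite (E \<inter> {..real (max n n0) + 1/2})"
      using cnt[of "max n n0"] by (intro card_ge_0_finite) simp
    then show ?thesis by (rule finite_subset[rotated]) (use n in auto)
  qed
  have inf: "infinite E"
  proof
    assume "finite E"
    then have "card (E \<inter> {..real (max n0 (card E)) + 1/2}) \<le> card E" by (intro card_mono) auto
    then show False using cnt[of "max n0 (card E)"] by simp
  qed
  obtain lam where lam: "strict_mono lam" "range lam = E" "\<And>n. card (E \<inter> {..<lam n}) = n"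
    using real_set_enumeration[OF fin inf] by blast
  \<comment> \<open>The index starts at \<open>Suc n0\<close> because the lower estimate uses the
    count at \<open>n - 1\<close>.\<close>
  have close: "\<bar>lam n - real n\<bar> \<le> 1/2" if n: "Suc n0 \<le> n" for n
  proof -
    have "lam n \<le> real n + 1/2"
    proof (rule ccontr)
      assume "\<not> lam n \<le> real n + 1/2"
      then have "card (E \<inter> {..real n + 1/2}) \<le> card (E \<inter> {..<lam n})"
        by (intro card_mono finite_subset[OF _ fin[of "lam n"]]) auto
      then show False using cnt[of n] lam(3)[of n] n by simp
    qed
    moreover have "real n - 1/2 < lam n"
    proof (rule ccontr)
      assume "\<not> real n - 1/2 < lam n"
      moreover obtain k where k: "n = Suc k" "n0 \<le> k" using n by (cases n) auto
      ultimately have le: "lam n \<le> real k + 1/2" by simp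
      have fl: "finite (E \<inter> {..<lam n})" by (rule finite_subset[OF _ fin[of "lam n"]]) auto
      have "insert (lam n) (E \<inter> {..<lam n}) \<subseteq> E \<inter> {..real k + 1/2}"
        using le lam(2) by auto
      then have "card (insert (lam n) (E \<inter> {..<lam n})) \<le> card (E \<inter> {..real k + 1/2})"
        by (rule card_mono[OF fin])
      then show False using cnt[OF k(2)] k(1) fl by (simp add: lam(3))
    qed
    ultimately show ?thesis by linarith
  qed
  have "(\<lambda>n. lam n - real n) \<in> O(\<lambda>n. 1 / real n powr (1/16))"
  proof (rule bigoI[of _ M])
    show "eventually (\<lambda>n. norm (lam n - real n) \<le> M * norm (1 / real n powr (1/16))) sequentially"
      unfolding eventually_sequentially
    proof (intro exI[of _ "Suc n0"] allI impI)
      fix n assume n: "Suc n0 \<le> n"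
      have "lam n \<in> shifted_eigvals g s" using lam(2) by (auto simp: E_def)
      from M[OF _ _ this close[OF n]] n
      show "norm (lam n - real n) \<le> M * norm (1 / real n powr (1/16))" by (simp add: n0_def S_def)
    qed
  qed
  then show ?thesis using lam(1,2) unfolding E_def by blast
qed

text \<open>Eigenspaces are lines, so a strictly increasing enumeration respects multiplicities; the
  asymptotics make it unbounded, which is the discreteness of the spectrum.\<close>

theorem theorem2:
  fixes g c1 c2 :: real
  assumes "g \<noteq> 0"
  shows "\<exists>lam :: nat \<Rightarrow> real.
           strict_mono lam
         \<and> jac_spectrum g c1 c2 = complex_of_real ` range lam
         \<and> (\<forall>n. (\<exists>x. jac_eigvec g c1 c2 (complex_of_real (lam n)) x)
                \<and> (\<forall>x y. jac_eigvec g c1 c2 (complex_of_real (lam n)) x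
                         \<and> jac_eigvec g c1 c2 (complex_of_real (lam n)) y
                         \<longrightarrow> (\<exists>c. y = (\<lambda>k. c * x k))))
         \<and> (\<lambda>n. lam n - (real n - g^2 + (c1 + c2) / 2))
             \<in> O(\<lambda>n. 1 / real n powr (1/16))"
proof -
  define c where "c = (c1 + c2) / 2 - g\<^sup>2"
  obtain mu :: "nat \<Rightarrow> real" where mu: "strict_mono mu"
      "range mu = shifted_eigvals g ((c1 - c2) / 2)"
      "(\<lambda>n. mu n - real n) \<in> O(\<lambda>n. 1 / real n powr (1/16))"
    using shifted_eigvals_enumeration[OF assms] by blast
  define lam where "lam n = mu n + c" for n
  have eig: "(\<exists>x. jac_eigvec g c1 c2 (complex_of_real l) x) \<longleftrightarrow> l \<in> range lam" for l
  proof -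
    have "l - c \<in> range mu \<longleftrightarrow> l \<in> range lam"
      by (auto simp: lam_def image_iff algebra_simps)
    then show ?thesis
      unfolding jac_eigval_iff[OF assms] mu(2)[symmetric] c_def .
  qed
  have "jac_spectrum g c1 c2 = complex_of_real ` range lam"
  proof (intro equalityI subsetI)
    fix z assume "z \<in> jac_spectrum g c1 c2"
    then obtain x where x: "jac_eigvec g c1 c2 z x" using jac_spectrum_iff[OF assms] by blast
    then obtain l where "z = complex_of_real l"
      using jac_eigval_real[OF assms x] by (auto elim: Reals_cases)
    with x show "z \<in> complex_of_real ` range lam" using eig[of l] by blast
  next
    fix z assume "z \<in> complex_of_real ` range lam"
    then show "z \<in> jac_spectrum g c1 c2" unfolding jac_spectrum_iff[OF assms] using eig by blast
  qed
  moreover have "strict_mono lam" using mu(1) by (simp add: lam_def strict_mono_def)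
  moreover have "(\<lambda>n. lam n - (real n - g^2 + (c1 + c2) / 2)) \<in> O(\<lambda>n. 1 / real n powr (1/16))"
    using mu(3) by (simp add: lam_def c_def algebra_simps)
  moreover have "\<exists>x. jac_eigvec g c1 c2 (complex_of_real (lam n)) x" for n
    using eig by blast
  ultimately show ?thesis using jac_eigvec_multiple[OF assms] by blast
qed

end
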